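(* Let $\mathcal V=(\mathcal V,\le,\otimes,\mathrm k)$ be a (unital, commutative) quantale. The 2-category $\mathsf{Cat}/\!/\mathcal V$ of small $\mathcal V$-normed categories, $\mathcal V$-normed functors and $\mathcal V$-normed natural transformations is symmetric monoidal closed and topological over $\mathsf{Cat}$. In particular, $\mathsf{Cat}/\!/\mathcal V$ is complete and cocomplete, and the forgetful functor $\mathsf{Cat}/\!/\mathcal V\to\mathsf{Cat}$ has both a right adjoint and a left adjoint. The restriction to small $\mathcal V$-normed categories whose carrier is indiscrete reproduces the corresponding statements for the category $\mathcal V\text{-}\mathsf{Cat}$ and its forgetful functor to $\mathsf{Set}$; that is, $\mathcal V\text{-}\mathsf{Cat}$ is symmetric monoidal closed and topological over $\mathsf{Set}$, hence complete and cocomplete, and the forgetful functor $\mathcal V\text{-}\mathsf{Cat}\to\mathsf{Set}$ has both a right and a left adjoint.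
   Context: A quantale $(\mathcal V,\le,\otimes,\mathrm k)$ is a complete lattice with a commutative monoid structure $(\mathcal V,\otimes,\mathrm k)$ such that each $-\otimes v$ preserves arbitrary joins. A $\mathcal V$-normed category is a category $\mathbb X$ (with small hom-sets) in which every morphism $f$ is assigned a value $|f|\in\mathcal V$ with $\mathrm k\le|1_x|$ and $|f|\otimes|g|\le|g\cdot f|$ for all objects $x$ and composable $f:x\to y$, $g:y\to z$. A functor $F$ between $\mathcal V$-normed categories is $\mathcal V$-normed if $|f|\le|Ff|$ for all morphisms $f$. A natural transformation $\alpha$ between $\mathcal V$-normed functors is $\mathcal V$-normed if $\mathrm k\le|\alpha_x|$ for all objects $x$. The symmetric monoidal closed structure is as follows. The tensor product $\mathbb X\otimes\mathbb Y$ is the category $\mathbb X\times\mathbb Y$ normed by $|(f,f')|=|f|\otimes|f'|$. The unit is the terminal category with $|1_*|=\mathrm k$. The internal hom $[\mathbb X,\mathbb Y]$ has as objects the $\mathcal V$-normed functors $\mathbb X\to\mathbb Y$ and as morphisms all natural transformations between them, normed by $|\alpha|=\bigwedge_{x}|\alpha_x|$. Topological over $\mathsf{Cat}$ (via the norm-forgetting functor) means: for every (arbitrarily large) family of functors $F_i:\mathbb X\to\mathbb Y_i$ $(i\in I)$ from a small category $\mathbb X$ to small $\mathcal V$-normed categories $\mathbb Y_i$, there is an initial $\mathcal V$-norm on $\mathbb X$, i.e. one making all $F_i$ $\mathcal V$-normed and such that a functor $G:\mathbb Z\to\mathbb X$ from a small $\mathcal V$-normed category $\mathbb Z$ is $\mathcal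 V$-normed whenever all $F_iG$ are; it is given by $|f|=\bigwedge_{i\in I}|F_if|$. Topological over $\mathsf{Set}$ is defined analogously. $\mathcal V\text{-}\mathsf{Cat}$ is the category of small $\mathcal V$-categories: sets $X$ with a function $X\times X\to\mathcal V$, $(x,y)\mapsto X(x,y)$, satisfying $\mathrm k\le X(x,x)$ and $X(x,y)\otimes X(y,z)\le X(x,z)$. Its morphisms ($\mathcal V$-functors) are maps $f:X\to Y$ with $X(x,x')\le Y(fx,fx')$. Its tensor product is $X\times Y$ with $(X\otimes Y)((x,y),(x',y'))=X(x,x')\otimes Y(y,y')$; its unit is $\{*\}$ with $( *,* )\mapsto\mathrm k$; its internal hom is $[X,Y]=\mathcal V\text{-}\mathsf{Cat}(X,Y)$ with $[X,Y](f,g)=\bigwedge_{x}Y(fx,gx)$. A $\mathcal V$-category $X$ is identified with the indiscrete category $\mathrm iX$ with object set $X$ (exactly one morphism $x\to y$ for all $x,y$), normed by $|x\to y|=X(x,y)$. *)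

theory Defs
  imports Main "HOL-Library.FuncSet"
begin

section \<open>Quantales\<close>

text \<open>Multiplication is the tensor and \<open>1\<close> is its neutral element \<open>k\<close>; the lattice order is the
  order of the quantale. Preservation of the empty join gives \<open>bot * v = bot\<close>.\<close>

class quantale = complete_lattice + comm_monoid_mult +
  assumes Sup_mult: "Sup A * v = (SUP a\<in>A. a * v)"


section \<open>Small sets\<close>

text \<open>Smallness is relative to a Grothendieck universe: a type \<open>'u\<close> whose elements are the small
  sets, with \<open>elts x\<close> the set of members of \<open>x\<close>. The assumptions are extensionality, separation,
  replacement, union, power set and infinity; pairing is a consequence. Every set that is small in
  the informal sense is in bijection with a member of the universe, so that all small structures
  are carried by small sets of elements of \<open>'u\<close>. (HOL alone does not provide such a type; it exists
  in every model that has an inaccessible cardinal.)\<close>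

class universe =
  fixes elts :: "'a \<Rightarrow> 'a set"
  assumes elts_inject: "elts x = elts y \<Longrightarrow> x = y"
    and separation: "A \<subseteq> elts x \<Longrightarrow> \<exists>y. elts y = A"
    and replacement: "\<exists>y. elts y = f ` elts x"
    and union_set: "\<exists>y. elts y = (\<Union>z\<in>elts x. elts z)"
    and power_set: "\<exists>y. elts y = {z. elts z \<subseteq> elts x}"
    and infinity: "\<exists>x. infinite (elts x)"

definition small :: "'u::universe set \<Rightarrow> bool" where
  "small A \<longleftrightarrow> (\<exists>x. elts x = A)"

definition mkset :: "'u::universe set \<Rightarrow> 'u" where
  "mkset A = (THE x. elts x = A)"

text \<open>Kuratowski pairs, and functions coded by their graphs.\<close>

definition upair :: "'u::universe \<Rightarrow> 'u \<Rightarrow> 'u" where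
  "upair a b = mkset {mkset {a}, mkset {a, b}}"

definition ufst :: "'u::universe \<Rightarrow> 'u" where
  "ufst p = (THE a. \<exists>b. p = upair a b)"

definition usnd :: "'u::universe \<Rightarrow> 'u" where
  "usnd p = (THE b. \<exists>a. p = upair a b)"

definition utimes :: "'u::universe set \<Rightarrow> 'u set \<Rightarrow> 'u set" where
  "utimes A B = {upair a b | a b. a \<in> A \<and> b \<in> B}"

definition ulam :: "'u::universe set \<Rightarrow> ('u \<Rightarrow> 'u) \<Rightarrow> 'u" where
  "ulam A f = mkset {upair a (f a) | a. a \<in> A}"

definition uapp :: "'u::universe \<Rightarrow> 'u \<Rightarrow> 'u" where
  "uapp g a = (THE b. upair a b \<in> elts g)"

definition upoint :: "'u::universe" where
  "upoint = mkset {}"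


section \<open>Categories, functors and natural transformations\<close>

text \<open>One record serves for small categories and for large ones. \<open>cmp C g f\<close> is \<open>g\<close> after \<open>f\<close>.\<close>

record ('o, 'a) cat =
  obj :: "'o set"
  arr :: "'a set"
  src :: "'a \<Rightarrow> 'o"
  tgt :: "'a \<Rightarrow> 'o"
  ide :: "'o \<Rightarrow> 'a"
  cmp :: "'a \<Rightarrow> 'a \<Rightarrow> 'a"

definition homset :: "('o, 'a, 'm) cat_scheme \<Rightarrow> 'o \<Rightarrow> 'o \<Rightarrow> 'a set" where
  "homset C x y = {f \<in> arr C. src C f = x \<and> tgt C f = y}"

definition category :: "('o, 'a, 'm) cat_scheme \<Rightarrow> bool" where
  "category C \<longleftrightarrow>
     (\<forall>f\<in>arr C. src C f \<in> obj C \<and> tgt C f \<in> obj C) \<and>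
     (\<forall>x\<in>obj C. ide C x \<in> homset C x x) \<and>
     (\<forall>f\<in>arr C. \<forall>g\<in>arr C. tgt C f = src C g \<longrightarrow> cmp C g f \<in> homset C (src C f) (tgt C g)) \<and>
     (\<forall>f\<in>arr C. cmp C f (ide C (src C f)) = f \<and> cmp C (ide C (tgt C f)) f = f) \<and>
     (\<forall>f\<in>arr C. \<forall>g\<in>arr C. \<forall>h\<in>arr C. tgt C f = src C g \<longrightarrow> tgt C g = src C h \<longrightarrow>
        cmp C h (cmp C g f) = cmp C (cmp C h g) f)"

definition iso :: "('o, 'a, 'm) cat_scheme \<Rightarrow> 'a \<Rightarrow> bool" where
  "iso C f \<longleftrightarrow> f \<in> arr C \<and> (\<exists>g\<in>homset C (tgt C f) (src C f).
     cmp C g f = ide C (src C f) \<and> cmp C f g = ide C (tgt C f))"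

definition opcat :: "('o, 'a, 'm) cat_scheme \<Rightarrow> ('o, 'a) cat" where
  "opcat C = \<lparr>obj = obj C, arr = arr C, src = tgt C, tgt = src C, ide = ide C,
              cmp = (\<lambda>f g. cmp C g f)\<rparr>"

record ('o, 'a, 'p, 'b) ftr =
  fo :: "'o \<Rightarrow> 'p"
  fa :: "'a \<Rightarrow> 'b"

definition is_functor ::
    "('o, 'a, 'm) cat_scheme \<Rightarrow> ('p, 'b, 'n) cat_scheme \<Rightarrow> ('o, 'a, 'p, 'b) ftr \<Rightarrow> bool" where
  "is_functor C D F \<longleftrightarrow> category C \<and> category D \<and>
     (\<forall>x\<in>obj C. fo F x \<in> obj D) \<and>
     (\<forall>f\<in>arr C. fa F f \<in> homset D (fo F (src C f)) (fo F (tgt C f))) \<and>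
     (\<forall>x\<in>obj C. fa F (ide C x) = ide D (fo F x)) \<and>
     (\<forall>f\<in>arr C. \<forall>g\<in>arr C. tgt C f = src C g \<longrightarrow>
        fa F (cmp C g f) = cmp D (fa F g) (fa F f))"

definition nat_trans ::
    "('o, 'a, 'm) cat_scheme \<Rightarrow> ('p, 'b, 'n) cat_scheme \<Rightarrow>
     ('o, 'a, 'p, 'b) ftr \<Rightarrow> ('o, 'a, 'p, 'b) ftr \<Rightarrow> ('o \<Rightarrow> 'b) \<Rightarrow> bool" where
  "nat_trans C D F G \<alpha> \<longleftrightarrow> is_functor C D F \<and> is_functor C D G \<and>
     (\<forall>x\<in>obj C. \<alpha> x \<in> homset D (fo F x) (fo G x)) \<and>
     (\<forall>f\<in>arr C. cmp D (\<alpha> (tgt C f)) (fa F f) = cmp D (fa G f) (\<alpha> (src C f)))"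

definition faithful ::
    "('o, 'a, 'm) cat_scheme \<Rightarrow> ('p, 'b, 'n) cat_scheme \<Rightarrow> ('o, 'a, 'p, 'b) ftr \<Rightarrow> bool" where
  "faithful C D F \<longleftrightarrow> (\<forall>x\<in>obj C. \<forall>y\<in>obj C. inj_on (fa F) (homset C x y))"

definition full ::
    "('o, 'a, 'm) cat_scheme \<Rightarrow> ('p, 'b, 'n) cat_scheme \<Rightarrow> ('o, 'a, 'p, 'b) ftr \<Rightarrow> bool" where
  "full C D F \<longleftrightarrow>
     (\<forall>x\<in>obj C. \<forall>y\<in>obj C. homset D (fo F x) (fo F y) \<subseteq> fa F ` homset C x y)"

definition adjunction ::
    "('o, 'a, 'm) cat_scheme \<Rightarrow> ('p, 'b, 'n) cat_scheme \<Rightarrow>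
     ('p, 'b, 'o, 'a) ftr \<Rightarrow> ('o, 'a, 'p, 'b) ftr \<Rightarrow> bool" where
  "adjunction C D L R \<longleftrightarrow> is_functor D C L \<and> is_functor C D R \<and>
     (\<exists>\<phi>. (\<forall>x\<in>obj D. \<forall>a\<in>obj C.
              bij_betw (\<phi> x a) (homset C (fo L x) a) (homset D x (fo R a))) \<and>
          (\<forall>h\<in>arr D. \<forall>g\<in>arr C. \<forall>f\<in>homset C (fo L (tgt D h)) (src C g).
              \<phi> (src D h) (tgt C g) (cmp C g (cmp C f (fa L h))) =
              cmp D (fa R g) (cmp D (\<phi> (tgt D h) (src C g) f) h)))"

definition has_left_adjoint ::
    "('o, 'a, 'm) cat_scheme \<Rightarrow> ('p, 'b, 'n) cat_scheme \<Rightarrow> ('o, 'a, 'p, 'b) ftr \<Rightarrow> bool" where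
  "has_left_adjoint C D U \<longleftrightarrow> (\<exists>L. adjunction C D L U)"

definition has_right_adjoint ::
    "('o, 'a, 'm) cat_scheme \<Rightarrow> ('p, 'b, 'n) cat_scheme \<Rightarrow> ('o, 'a, 'p, 'b) ftr \<Rightarrow> bool" where
  "has_right_adjoint C D U \<longleftrightarrow> (\<exists>R. adjunction D C U R)"


section \<open>Small limits and colimits\<close>

text \<open>Small structures are extensional (undefined outside their carriers), so that equality of
  small categories, functors and transformations is the set-theoretic one.\<close>

definition extensional_cat :: "('o, 'a, 'm) cat_scheme \<Rightarrow> bool" where
  "extensional_cat C \<longleftrightarrow>
     src C \<in> extensional (arr C) \<and> tgt C \<in> extensional (arr C) \<and> ide C \<in> extensional (obj C) \<and>
     (\<forall>g f. \<not> (f \<in> arr C \<and> g \<in> arr C \<and> tgt C f = src C g) \<longrightarrow> cmp C g f = undefined)"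

definition small_cat :: "('u::universe, 'u, 'm) cat_scheme \<Rightarrow> bool" where
  "small_cat C \<longleftrightarrow> category C \<and> extensional_cat C \<and> small (obj C) \<and> small (arr C)"

definition cone ::
    "('j, 'k, 'n) cat_scheme \<Rightarrow> ('o, 'a, 'm) cat_scheme \<Rightarrow> ('j, 'k, 'o, 'a) ftr \<Rightarrow>
     'o \<Rightarrow> ('j \<Rightarrow> 'a) \<Rightarrow> bool" where
  "cone J C D l \<pi> \<longleftrightarrow> l \<in> obj C \<and>
     (\<forall>j\<in>obj J. \<pi> j \<in> homset C l (fo D j)) \<and>
     (\<forall>u\<in>arr J. cmp C (fa D u) (\<pi> (src J u)) = \<pi> (tgt J u))"

definition limit_cone ::
    "('j, 'k, 'n) cat_scheme \<Rightarrow> ('o, 'a, 'm) cat_scheme \<Rightarrow> ('j, 'k, 'o, 'a) ftr \<Rightarrow>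
     'o \<Rightarrow> ('j \<Rightarrow> 'a) \<Rightarrow> bool" where
  "limit_cone J C D l \<pi> \<longleftrightarrow> cone J C D l \<pi> \<and>
     (\<forall>z \<zeta>. cone J C D z \<zeta> \<longrightarrow>
        (\<exists>!h. h \<in> homset C z l \<and> (\<forall>j\<in>obj J. cmp C (\<pi> j) h = \<zeta> j)))"

text \<open>The type argument is the universe from which the index categories are taken.\<close>

definition small_complete :: "'u::universe itself \<Rightarrow> ('o, 'a, 'm) cat_scheme \<Rightarrow> bool" where
  "small_complete _ C \<longleftrightarrow> category C \<and>
     (\<forall>(J :: ('u, 'u) cat) D. small_cat J \<longrightarrow> is_functor J C D \<longrightarrow>
        (\<exists>l \<pi>. limit_cone J C D l \<pi>))"

definition small_cocomplete :: "'u::universe itself \<Rightarrow> ('o, 'a, 'm) cat_scheme \<Rightarrow> bool" where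
  "small_cocomplete U C \<longleftrightarrow> small_complete U (opcat C)"


section \<open>Topological functors\<close>

text \<open>\<open>a\<close> is an initial lift of the source \<open>f i : x \<rightarrow> U (Y i)\<close> (\<open>i \<in> I\<close>): each \<open>f i\<close> lifts to
  \<open>a \<rightarrow> Y i\<close>, and \<open>h : U z \<rightarrow> x\<close> lifts to \<open>z \<rightarrow> a\<close> as soon as every \<open>f i \<cdot> h\<close> lifts.\<close>

definition initial_lift ::
    "('o, 'a, 'm) cat_scheme \<Rightarrow> ('p, 'b, 'n) cat_scheme \<Rightarrow> ('o, 'a, 'p, 'b) ftr \<Rightarrow>
     'i set \<Rightarrow> 'p \<Rightarrow> ('i \<Rightarrow> 'o) \<Rightarrow> ('i \<Rightarrow> 'b) \<Rightarrow> 'o \<Rightarrow> bool" where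
  "initial_lift C D U I x Y f a \<longleftrightarrow>
     a \<in> obj C \<and> fo U a = x \<and>
     (\<forall>i\<in>I. \<exists>g\<in>homset C a (Y i). fa U g = f i) \<and>
     (\<forall>z\<in>obj C. \<forall>h\<in>homset D (fo U z) x.
        (\<forall>i\<in>I. \<exists>g\<in>homset C z (Y i). fa U g = cmp D (f i) h) \<longrightarrow>
        (\<exists>g\<in>homset C z a. fa U g = h))"

definition structured_source ::
    "('o, 'a, 'm) cat_scheme \<Rightarrow> ('p, 'b, 'n) cat_scheme \<Rightarrow> ('o, 'a, 'p, 'b) ftr \<Rightarrow>
     'i set \<Rightarrow> 'p \<Rightarrow> ('i \<Rightarrow> 'o) \<Rightarrow> ('i \<Rightarrow> 'b) \<Rightarrow> bool" where
  "structured_source C D U I x Y f \<longleftrightarrow>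
     x \<in> obj D \<and> (\<forall>i\<in>I. Y i \<in> obj C \<and> f i \<in> homset D x (fo U (Y i)))"

text \<open>The families are indexed by arbitrary sets over the type argument, with no size restriction.\<close>

definition topological ::
    "'i itself \<Rightarrow> ('o, 'a, 'm) cat_scheme \<Rightarrow> ('p, 'b, 'n) cat_scheme \<Rightarrow>
     ('o, 'a, 'p, 'b) ftr \<Rightarrow> bool" where
  "topological _ C D U \<longleftrightarrow> is_functor C D U \<and> faithful C D U \<and>
     (\<forall>(I :: 'i set) x Y f. structured_source C D U I x Y f \<longrightarrow>
        (\<exists>a. initial_lift C D U I x Y f a))"


section \<open>Symmetric monoidal closed categories\<close>

record ('o, 'a) smc =
  tenO :: "'o \<Rightarrow> 'o \<Rightarrow> 'o"
  tenA :: "'a \<Rightarrow> 'a \<Rightarrow> 'a"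
  unitO :: "'o"
  assoc :: "'o \<Rightarrow> 'o \<Rightarrow> 'o \<Rightarrow> 'a"
  lunit :: "'o \<Rightarrow> 'a"
  runit :: "'o \<Rightarrow> 'a"
  braid :: "'o \<Rightarrow> 'o \<Rightarrow> 'a"
  ihom :: "'o \<Rightarrow> 'o \<Rightarrow> 'o"
  evalA :: "'o \<Rightarrow> 'o \<Rightarrow> 'a"

definition tensor_functor :: "('o, 'a, 'm) cat_scheme \<Rightarrow> ('o, 'a, 'n) smc_scheme \<Rightarrow> bool" where
  "tensor_functor C M \<longleftrightarrow>
     (\<forall>x\<in>obj C. \<forall>y\<in>obj C. tenO M x y \<in> obj C) \<and>
     (\<forall>f\<in>arr C. \<forall>g\<in>arr C. tenA M f g \<in>
        homset C (tenO M (src C f) (src C g)) (tenO M (tgt C f) (tgt C g))) \<and>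
     (\<forall>x\<in>obj C. \<forall>y\<in>obj C. tenA M (ide C x) (ide C y) = ide C (tenO M x y)) \<and>
     (\<forall>f\<in>arr C. \<forall>f'\<in>arr C. \<forall>g\<in>arr C. \<forall>g'\<in>arr C.
        tgt C f = src C f' \<longrightarrow> tgt C g = src C g' \<longrightarrow>
        tenA M (cmp C f' f) (cmp C g' g) = cmp C (tenA M f' g') (tenA M f g))"

definition constraints_iso :: "('o, 'a, 'm) cat_scheme \<Rightarrow> ('o, 'a, 'n) smc_scheme \<Rightarrow> bool" where
  "constraints_iso C M \<longleftrightarrow> unitO M \<in> obj C \<and>
     (\<forall>x\<in>obj C. \<forall>y\<in>obj C. \<forall>z\<in>obj C.
        assoc M x y z \<in> homset C (tenO M (tenO M x y) z) (tenO M x (tenO M y z)) \<and>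
        iso C (assoc M x y z)) \<and>
     (\<forall>x\<in>obj C. lunit M x \<in> homset C (tenO M (unitO M) x) x \<and> iso C (lunit M x)) \<and>
     (\<forall>x\<in>obj C. runit M x \<in> homset C (tenO M x (unitO M)) x \<and> iso C (runit M x)) \<and>
     (\<forall>x\<in>obj C. \<forall>y\<in>obj C.
        braid M x y \<in> homset C (tenO M x y) (tenO M y x) \<and> iso C (braid M x y))"

definition constraints_natural :: "('o, 'a, 'm) cat_scheme \<Rightarrow> ('o, 'a, 'n) smc_scheme \<Rightarrow> bool" where
  "constraints_natural C M \<longleftrightarrow>
     (\<forall>f\<in>arr C. \<forall>g\<in>arr C. \<forall>h\<in>arr C.
        cmp C (assoc M (tgt C f) (tgt C g) (tgt C h)) (tenA M (tenA M f g) h) =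
        cmp C (tenA M f (tenA M g h)) (assoc M (src C f) (src C g) (src C h))) \<and>
     (\<forall>f\<in>arr C.
        cmp C (lunit M (tgt C f)) (tenA M (ide C (unitO M)) f) = cmp C f (lunit M (src C f))) \<and>
     (\<forall>f\<in>arr C.
        cmp C (runit M (tgt C f)) (tenA M f (ide C (unitO M))) = cmp C f (runit M (src C f))) \<and>
     (\<forall>f\<in>arr C. \<forall>g\<in>arr C.
        cmp C (braid M (tgt C f) (tgt C g)) (tenA M f g) =
        cmp C (tenA M g f) (braid M (src C f) (src C g)))"

text \<open>Pentagon, triangle, hexagon and symmetry.\<close>

definition constraints_coherent :: "('o, 'a, 'm) cat_scheme \<Rightarrow> ('o, 'a, 'n) smc_scheme \<Rightarrow> bool" where
  "constraints_coherent C M \<longleftrightarrow>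
     (\<forall>w\<in>obj C. \<forall>x\<in>obj C. \<forall>y\<in>obj C. \<forall>z\<in>obj C.
        cmp C (assoc M w x (tenO M y z)) (assoc M (tenO M w x) y z) =
        cmp C (tenA M (ide C w) (assoc M x y z))
          (cmp C (assoc M w (tenO M x y) z) (tenA M (assoc M w x y) (ide C z)))) \<and>
     (\<forall>x\<in>obj C. \<forall>y\<in>obj C.
        cmp C (tenA M (ide C x) (lunit M y)) (assoc M x (unitO M) y) =
        tenA M (runit M x) (ide C y)) \<and>
     (\<forall>x\<in>obj C. \<forall>y\<in>obj C. \<forall>z\<in>obj C.
        cmp C (assoc M y z x) (cmp C (braid M x (tenO M y z)) (assoc M x y z)) =
        cmp C (tenA M (ide C y) (braid M x z))
          (cmp C (assoc M y x z) (tenA M (braid M x y) (ide C z)))) \<and>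
     (\<forall>x\<in>obj C. \<forall>y\<in>obj C. cmp C (braid M y x) (braid M x y) = ide C (tenO M x y))"

text \<open>\<open>ihom M y z\<close> with \<open>evalA M y z\<close> represents maps out of \<open>- \<otimes> y\<close>: the functor \<open>- \<otimes> y\<close> has
  right adjoint \<open>ihom M y\<close> with counit \<open>evalA M y\<close>.\<close>

definition closed :: "('o, 'a, 'm) cat_scheme \<Rightarrow> ('o, 'a, 'n) smc_scheme \<Rightarrow> bool" where
  "closed C M \<longleftrightarrow>
     (\<forall>y\<in>obj C. \<forall>z\<in>obj C.
        ihom M y z \<in> obj C \<and> evalA M y z \<in> homset C (tenO M (ihom M y z) y) z \<and>
        (\<forall>x\<in>obj C. \<forall>f\<in>homset C (tenO M x y) z.
           \<exists>!g. g \<in> homset C x (ihom M y z) \<and> cmp C (evalA M y z) (tenA M g (ide C y)) = f))"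

definition symmetric_monoidal_closed ::
    "('o, 'a, 'm) cat_scheme \<Rightarrow> ('o, 'a, 'n) smc_scheme \<Rightarrow> bool" where
  "symmetric_monoidal_closed C M \<longleftrightarrow> category C \<and> tensor_functor C M \<and> constraints_iso C M \<and>
     constraints_natural C M \<and> constraints_coherent C M \<and> closed C M"


section \<open>Strict 2-categories\<close>

text \<open>\<open>vert\<close> has the 1-cells as objects, the 2-cells as arrows and vertical composition as
  composition; \<open>hcmp C b a\<close> is horizontal composition, \<open>b\<close> after \<open>a\<close>.\<close>

record ('o, 'a, 'c) twocat = "('o, 'a) cat" +
  vert :: "('a, 'c) cat"
  hcmp :: "'c \<Rightarrow> 'c \<Rightarrow> 'c"

definition src0 :: "('o, 'a, 'c, 'm) twocat_scheme \<Rightarrow> 'c \<Rightarrow> 'o" where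
  "src0 C a = src C (src (vert C) a)"

definition tgt0 :: "('o, 'a, 'c, 'm) twocat_scheme \<Rightarrow> 'c \<Rightarrow> 'o" where
  "tgt0 C a = tgt C (src (vert C) a)"

definition two_category :: "('o, 'a, 'c, 'm) twocat_scheme \<Rightarrow> bool" where
  "two_category C \<longleftrightarrow> category C \<and> category (vert C) \<and> obj (vert C) = arr C \<and>
     (\<forall>a\<in>arr (vert C). src C (tgt (vert C) a) = src0 C a \<and> tgt C (tgt (vert C) a) = tgt0 C a) \<and>
     (\<forall>a\<in>arr (vert C). \<forall>b\<in>arr (vert C). tgt0 C a = src0 C b \<longrightarrow>
        hcmp C b a \<in> homset (vert C) (cmp C (src (vert C) b) (src (vert C) a))
                                     (cmp C (tgt (vert C) b) (tgt (vert C) a))) \<and>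
     (\<forall>f\<in>arr C. \<forall>g\<in>arr C. tgt C f = src C g \<longrightarrow>
        hcmp C (ide (vert C) g) (ide (vert C) f) = ide (vert C) (cmp C g f)) \<and>
     (\<forall>a\<in>arr (vert C). \<forall>a'\<in>arr (vert C). \<forall>b\<in>arr (vert C). \<forall>b'\<in>arr (vert C).
        tgt (vert C) a = src (vert C) a' \<longrightarrow> tgt (vert C) b = src (vert C) b' \<longrightarrow>
        tgt0 C a = src0 C b \<longrightarrow>
        hcmp C (cmp (vert C) b' b) (cmp (vert C) a' a) =
        cmp (vert C) (hcmp C b' a') (hcmp C b a)) \<and>
     (\<forall>a\<in>arr (vert C). \<forall>b\<in>arr (vert C). \<forall>c\<in>arr (vert C).
        tgt0 C a = src0 C b \<longrightarrow> tgt0 C b = src0 C c \<longrightarrow>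
        hcmp C c (hcmp C b a) = hcmp C (hcmp C c b) a) \<and>
     (\<forall>a\<in>arr (vert C).
        hcmp C a (ide (vert C) (ide C (src0 C a))) = a \<and>
        hcmp C (ide (vert C) (ide C (tgt0 C a))) a = a)"

text \<open>Symmetric monoidal closed structure on a 2-category in the \<open>Cat\<close>-enriched sense: the
  tensor is a 2-functor, the constraints are 2-natural, and evaluation induces isomorphisms
  of hom-categories.\<close>

record ('o, 'a, 'c) smc2 = "('o, 'a) smc" +
  tenC :: "'c \<Rightarrow> 'c \<Rightarrow> 'c"

definition tensor_2functor ::
    "('o, 'a, 'c, 'm) twocat_scheme \<Rightarrow> ('o, 'a, 'c, 'n) smc2_scheme \<Rightarrow> bool" where
  "tensor_2functor C M \<longleftrightarrow>
     (\<forall>a\<in>arr (vert C). \<forall>b\<in>arr (vert C). tenC M a b \<in>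
        homset (vert C) (tenA M (src (vert C) a) (src (vert C) b))
                        (tenA M (tgt (vert C) a) (tgt (vert C) b))) \<and>
     (\<forall>f\<in>arr C. \<forall>g\<in>arr C.
        tenC M (ide (vert C) f) (ide (vert C) g) = ide (vert C) (tenA M f g)) \<and>
     (\<forall>a\<in>arr (vert C). \<forall>a'\<in>arr (vert C). \<forall>b\<in>arr (vert C). \<forall>b'\<in>arr (vert C).
        tgt (vert C) a = src (vert C) a' \<longrightarrow> tgt (vert C) b = src (vert C) b' \<longrightarrow>
        tenC M (cmp (vert C) a' a) (cmp (vert C) b' b) =
        cmp (vert C) (tenC M a' b') (tenC M a b)) \<and>
     (\<forall>a\<in>arr (vert C). \<forall>a'\<in>arr (vert C). \<forall>b\<in>arr (vert C). \<forall>b'\<in>arr (vert C).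
        tgt0 C a = src0 C a' \<longrightarrow> tgt0 C b = src0 C b' \<longrightarrow>
        tenC M (hcmp C a' a) (hcmp C b' b) = hcmp C (tenC M a' b') (tenC M a b))"

definition constraints_2natural ::
    "('o, 'a, 'c, 'm) twocat_scheme \<Rightarrow> ('o, 'a, 'c, 'n) smc2_scheme \<Rightarrow> bool" where
  "constraints_2natural C M \<longleftrightarrow>
     (\<forall>a\<in>arr (vert C). \<forall>b\<in>arr (vert C). \<forall>c\<in>arr (vert C).
        hcmp C (ide (vert C) (assoc M (tgt0 C a) (tgt0 C b) (tgt0 C c))) (tenC M (tenC M a b) c) =
        hcmp C (tenC M a (tenC M b c)) (ide (vert C) (assoc M (src0 C a) (src0 C b) (src0 C c)))) \<and>
     (\<forall>a\<in>arr (vert C).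
        hcmp C (ide (vert C) (lunit M (tgt0 C a))) (tenC M (ide (vert C) (ide C (unitO M))) a) =
        hcmp C a (ide (vert C) (lunit M (src0 C a)))) \<and>
     (\<forall>a\<in>arr (vert C).
        hcmp C (ide (vert C) (runit M (tgt0 C a))) (tenC M a (ide (vert C) (ide C (unitO M)))) =
        hcmp C a (ide (vert C) (runit M (src0 C a)))) \<and>
     (\<forall>a\<in>arr (vert C). \<forall>b\<in>arr (vert C).
        hcmp C (ide (vert C) (braid M (tgt0 C a) (tgt0 C b))) (tenC M a b) =
        hcmp C (tenC M b a) (ide (vert C) (braid M (src0 C a) (src0 C b))))"

definition closed_2dim ::
    "('o, 'a, 'c, 'm) twocat_scheme \<Rightarrow> ('o, 'a, 'c, 'n) smc2_scheme \<Rightarrow> bool" where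
  "closed_2dim C M \<longleftrightarrow>
     (\<forall>x\<in>obj C. \<forall>y\<in>obj C. \<forall>z\<in>obj C.
        \<forall>\<theta>\<in>arr (vert C). src0 C \<theta> = tenO M x y \<longrightarrow> tgt0 C \<theta> = z \<longrightarrow>
          (\<exists>!\<sigma>. \<sigma> \<in> arr (vert C) \<and> src0 C \<sigma> = x \<and> tgt0 C \<sigma> = ihom M y z \<and>
             hcmp C (ide (vert C) (evalA M y z)) (tenC M \<sigma> (ide (vert C) (ide C y))) = \<theta>))"

definition symmetric_monoidal_closed_2cat ::
    "('o, 'a, 'c, 'm) twocat_scheme \<Rightarrow> ('o, 'a, 'c, 'n) smc2_scheme \<Rightarrow> bool" where
  "symmetric_monoidal_closed_2cat C M \<longleftrightarrow>
     two_category C \<and> symmetric_monoidal_closed C M \<and>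
     tensor_2functor C M \<and> constraints_2natural C M \<and> closed_2dim C M"


section \<open>The categories of small sets and of small categories\<close>

text \<open>Arrows of the large categories below carry their domain and codomain.\<close>

datatype ('c, 'f) mor = Mor (msrc: 'c) (mmap: 'f) (mtgt: 'c)

type_synonym 'u smallcat = "('u, 'u) cat"
type_synonym 'u smallftr = "('u, 'u, 'u, 'u) ftr"
type_synonym 'u set_cat = "('u set, ('u set, 'u \<Rightarrow> 'u) mor) cat"
type_synonym 'u cat_cat = "('u smallcat, ('u smallcat, 'u smallftr) mor) cat"

definition mk_ftr ::
    "('u, 'u, 'm) cat_scheme \<Rightarrow> ('u \<Rightarrow> 'u) \<Rightarrow> ('u \<Rightarrow> 'u) \<Rightarrow> 'u smallftr" where
  "mk_ftr X f g = \<lparr>fo = restrict f (obj X), fa = restrict g (arr X)\<rparr>"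

definition small_functor ::
    "('u, 'u, 'm) cat_scheme \<Rightarrow> ('u, 'u, 'n) cat_scheme \<Rightarrow> 'u smallftr \<Rightarrow> bool" where
  "small_functor X Y F \<longleftrightarrow>
     is_functor X Y F \<and> fo F \<in> extensional (obj X) \<and> fa F \<in> extensional (arr X)"

definition SetC :: "'u::universe set_cat" where
  "SetC = \<lparr>obj = {X. small X},
           arr = {Mor X f Y | X f Y. small X \<and> small Y \<and> f \<in> X \<rightarrow>\<^sub>E Y},
           src = msrc, tgt = mtgt,
           ide = (\<lambda>X. Mor X (restrict (\<lambda>x. x) X) X),
           cmp = (\<lambda>g f. Mor (msrc f) (compose (msrc f) (mmap g) (mmap f)) (mtgt g))\<rparr>"

definition CatC :: "'u::universe cat_cat" where
  "CatC = \<lparr>obj = {X. small_cat X},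
           arr = {Mor X F Y | X F Y. small_cat X \<and> small_cat Y \<and> small_functor X Y F},
           src = msrc, tgt = mtgt,
           ide = (\<lambda>X. Mor X (mk_ftr X (\<lambda>x. x) (\<lambda>f. f)) X),
           cmp = (\<lambda>G F. Mor (msrc F)
                    (mk_ftr (msrc F) (\<lambda>x. fo (mmap G) (fo (mmap F) x))
                                     (\<lambda>f. fa (mmap G) (fa (mmap F) f))) (mtgt G))\<rparr>"


section \<open>Normed categories\<close>

record ('u, 'v) ncat = "('u, 'u) cat" +
  nrm :: "'u \<Rightarrow> 'v"

definition normed_cat :: "('u::universe, 'v::quantale) ncat \<Rightarrow> bool" where
  "normed_cat X \<longleftrightarrow> small_cat X \<and> nrm X \<in> extensional (arr X) \<and>
     (\<forall>x\<in>obj X. 1 \<le> nrm X (ide X x)) \<and>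
     (\<forall>f\<in>arr X. \<forall>g\<in>arr X. tgt X f = src X g \<longrightarrow> nrm X f * nrm X g \<le> nrm X (cmp X g f))"

definition normed_functor ::
    "('u::universe, 'v::quantale) ncat \<Rightarrow> ('u, 'v) ncat \<Rightarrow> 'u smallftr \<Rightarrow> bool" where
  "normed_functor X Y F \<longleftrightarrow> small_functor X Y F \<and> (\<forall>f\<in>arr X. nrm X f \<le> nrm Y (fa F f))"

definition normed_nat_trans ::
    "('u::universe, 'v::quantale) ncat \<Rightarrow> ('u, 'v) ncat \<Rightarrow>
     'u smallftr \<Rightarrow> 'u smallftr \<Rightarrow> ('u \<Rightarrow> 'u) \<Rightarrow> bool" where
  "normed_nat_trans X Y F G \<alpha> \<longleftrightarrow> normed_functor X Y F \<and> normed_functor X Y G \<and>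
     nat_trans X Y F G \<alpha> \<and> \<alpha> \<in> extensional (obj X) \<and> (\<forall>x\<in>obj X. 1 \<le> nrm Y (\<alpha> x))"

type_synonym ('u, 'v) nmor = "(('u, 'v) ncat, 'u smallftr) mor"
type_synonym ('u, 'v) ncell = "(('u, 'v) nmor, 'u \<Rightarrow> 'u) mor"
type_synonym ('u, 'v) ncat_2cat = "(('u, 'v) ncat, ('u, 'v) nmor, ('u, 'v) ncell) twocat"

definition NCat_vert :: "(('u::universe, 'v::quantale) nmor, ('u, 'v) ncell) cat" where
  "NCat_vert =
     \<lparr>obj = {Mor X F Y | X F Y. normed_cat X \<and> normed_cat Y \<and> normed_functor X Y F},
      arr = {Mor (Mor X F Y) \<alpha> (Mor X G Y) | X Y F G \<alpha>.
               normed_cat X \<and> normed_cat Y \<and> normed_nat_trans X Y F G \<alpha>},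
      src = msrc, tgt = mtgt,
      ide = (\<lambda>F. Mor F (restrict (\<lambda>x. ide (mtgt F) (fo (mmap F) x)) (obj (msrc F))) F),
      cmp = (\<lambda>\<beta> \<alpha>. Mor (msrc \<alpha>)
               (restrict (\<lambda>x. cmp (mtgt (msrc \<alpha>)) (mmap \<beta> x) (mmap \<alpha> x)) (obj (msrc (msrc \<alpha>))))
               (mtgt \<beta>))\<rparr>"

definition ncomp :: "('u::universe, 'v::quantale) nmor \<Rightarrow> ('u, 'v) nmor \<Rightarrow> ('u, 'v) nmor" where
  "ncomp G F = Mor (msrc F)
     (mk_ftr (msrc F) (\<lambda>x. fo (mmap G) (fo (mmap F) x)) (\<lambda>f. fa (mmap G) (fa (mmap F) f)))
     (mtgt G)"

text \<open>For \<open>\<alpha> : F \<Rightarrow> F'\<close> and \<open>\<beta> : G \<Rightarrow> G'\<close>, the horizontal composite at \<open>x\<close> is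
  \<open>\<beta> (F' x) \<cdot> G (\<alpha> x)\<close>.\<close>

definition NCat :: "('u::universe, 'v::quantale) ncat_2cat" where
  "NCat =
     \<lparr>obj = {X. normed_cat X},
      arr = {Mor X F Y | X F Y. normed_cat X \<and> normed_cat Y \<and> normed_functor X Y F},
      src = msrc, tgt = mtgt,
      ide = (\<lambda>X. Mor X (mk_ftr X (\<lambda>x. x) (\<lambda>f. f)) X),
      cmp = ncomp,
      vert = NCat_vert,
      hcmp = (\<lambda>\<beta> \<alpha>. Mor (ncomp (msrc \<beta>) (msrc \<alpha>))
                (restrict (\<lambda>x. cmp (mtgt (msrc \<beta>))
                                 (mmap \<beta> (fo (mmap (mtgt \<alpha>)) x))
                                 (fa (mmap (msrc \<beta>)) (mmap \<alpha> x)))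
                          (obj (msrc (msrc \<alpha>))))
                (ncomp (mtgt \<beta>) (mtgt \<alpha>)))\<rparr>"

definition forget_norm ::
    "(('u::universe, 'v::quantale) ncat, ('u, 'v) nmor,
      'u smallcat, ('u smallcat, 'u smallftr) mor) ftr" where
  "forget_norm = \<lparr>fo = cat.truncate,
                  fa = (\<lambda>F. Mor (cat.truncate (msrc F)) (mmap F) (cat.truncate (mtgt F)))\<rparr>"

definition add_norm :: "'u smallcat \<Rightarrow> ('u \<Rightarrow> 'v) \<Rightarrow> ('u, 'v) ncat" where
  "add_norm X n = \<lparr>obj = obj X, arr = arr X, src = src X, tgt = tgt X, ide = ide X, cmp = cmp X,
                   nrm = restrict n (arr X)\<rparr>"

definition initial_norm ::
    "'i set \<Rightarrow> 'u::universe smallcat \<Rightarrow> ('i \<Rightarrow> ('u, 'v::quantale) ncat) \<Rightarrow>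
     ('i \<Rightarrow> ('u smallcat, 'u smallftr) mor) \<Rightarrow> ('u, 'v) ncat" where
  "initial_norm I X Y F = add_norm X (\<lambda>f. INF i\<in>I. nrm (Y i) (fa (mmap (F i)) f))"


subsection \<open>Symmetric monoidal closed structure\<close>

definition mk_ncat ::
    "'u set \<Rightarrow> 'u set \<Rightarrow> ('u \<Rightarrow> 'u) \<Rightarrow> ('u \<Rightarrow> 'u) \<Rightarrow> ('u \<Rightarrow> 'u) \<Rightarrow> ('u \<Rightarrow> 'u \<Rightarrow> 'u) \<Rightarrow>
     ('u \<Rightarrow> 'v) \<Rightarrow> ('u, 'v) ncat" where
  "mk_ncat Ob Ar s t i c n =
     \<lparr>obj = Ob, arr = Ar, src = restrict s Ar, tgt = restrict t Ar, ide = restrict i Ob,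
      cmp = (\<lambda>g f. if f \<in> Ar \<and> g \<in> Ar \<and> t f = s g then c g f else undefined),
      nrm = restrict n Ar\<rparr>"

definition mk_nmor ::
    "('u, 'v) ncat \<Rightarrow> ('u, 'v) ncat \<Rightarrow> ('u \<Rightarrow> 'u) \<Rightarrow> ('u \<Rightarrow> 'u) \<Rightarrow> ('u, 'v) nmor" where
  "mk_nmor X Y f g = Mor X (mk_ftr X f g) Y"

definition umap :: "('u::universe \<Rightarrow> 'u) \<Rightarrow> ('u \<Rightarrow> 'u) \<Rightarrow> 'u \<Rightarrow> 'u" where
  "umap f g p = upair (f (ufst p)) (g (usnd p))"

definition ntensor :: "('u::universe, 'v::quantale) ncat \<Rightarrow> ('u, 'v) ncat \<Rightarrow> ('u, 'v) ncat" where
  "ntensor X Y = mk_ncat (utimes (obj X) (obj Y)) (utimes (arr X) (arr Y))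
     (umap (src X) (src Y)) (umap (tgt X) (tgt Y)) (umap (ide X) (ide Y))
     (\<lambda>q p. upair (cmp X (ufst q) (ufst p)) (cmp Y (usnd q) (usnd p)))
     (\<lambda>p. nrm X (ufst p) * nrm Y (usnd p))"

definition ntensor_mor ::
    "('u::universe, 'v::quantale) nmor \<Rightarrow> ('u, 'v) nmor \<Rightarrow> ('u, 'v) nmor" where
  "ntensor_mor F G = mk_nmor (ntensor (msrc F) (msrc G)) (ntensor (mtgt F) (mtgt G))
     (umap (fo (mmap F)) (fo (mmap G))) (umap (fa (mmap F)) (fa (mmap G)))"

definition ntensor_cell ::
    "('u::universe, 'v::quantale) ncell \<Rightarrow> ('u, 'v) ncell \<Rightarrow> ('u, 'v) ncell" where
  "ntensor_cell \<alpha> \<beta> = Mor (ntensor_mor (msrc \<alpha>) (msrc \<beta>))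
     (restrict (umap (mmap \<alpha>) (mmap \<beta>)) (obj (ntensor (msrc (msrc \<alpha>)) (msrc (msrc \<beta>)))))
     (ntensor_mor (mtgt \<alpha>) (mtgt \<beta>))"

definition nunit :: "('u::universe, 'v::quantale) ncat" where
  "nunit = mk_ncat {upoint} {upoint} (\<lambda>_. upoint) (\<lambda>_. upoint) (\<lambda>_. upoint) (\<lambda>_ _. upoint) (\<lambda>_. 1)"

text \<open>Objects of the internal hom are pairs of graphs (object map, arrow map); its morphisms are
  pairs of a (domain, codomain) pair and the graph of the components.\<close>

definition code_ftr :: "('u::universe, 'v::quantale) ncat \<Rightarrow> 'u smallftr \<Rightarrow> 'u" where
  "code_ftr X F = upair (ulam (obj X) (fo F)) (ulam (arr X) (fa F))"

definition code_nat ::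
    "('u::universe, 'v::quantale) ncat \<Rightarrow> 'u smallftr \<Rightarrow> 'u smallftr \<Rightarrow> ('u \<Rightarrow> 'u) \<Rightarrow> 'u" where
  "code_nat X F G \<alpha> = upair (upair (code_ftr X F) (code_ftr X G)) (ulam (obj X) \<alpha>)"

definition nhom :: "('u::universe, 'v::quantale) ncat \<Rightarrow> ('u, 'v) ncat \<Rightarrow> ('u, 'v) ncat" where
  "nhom X Y = mk_ncat
     {code_ftr X F | F. normed_functor X Y F}
     {code_nat X F G \<alpha> | F G \<alpha>. normed_functor X Y F \<and> normed_functor X Y G \<and> nat_trans X Y F G \<alpha>}
     (\<lambda>a. ufst (ufst a)) (\<lambda>a. usnd (ufst a))
     (\<lambda>F. upair (upair F F) (ulam (obj X) (\<lambda>x. ide Y (uapp (ufst F) x))))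
     (\<lambda>b a. upair (upair (ufst (ufst a)) (usnd (ufst b)))
              (ulam (obj X) (\<lambda>x. cmp Y (uapp (usnd b) x) (uapp (usnd a) x))))
     (\<lambda>a. INF x\<in>obj X. nrm Y (uapp (usnd a) x))"

text \<open>Evaluation sends \<open>(\<alpha> : F \<Rightarrow> G, f : x \<rightarrow> x')\<close> to \<open>\<alpha> x' \<cdot> F f\<close>.\<close>

definition neval :: "('u::universe, 'v::quantale) ncat \<Rightarrow> ('u, 'v) ncat \<Rightarrow> ('u, 'v) nmor" where
  "neval X Y = mk_nmor (ntensor (nhom X Y) X) Y
     (\<lambda>p. uapp (ufst (ufst p)) (usnd p))
     (\<lambda>p. cmp Y (uapp (usnd (ufst p)) (tgt X (usnd p)))
                (uapp (usnd (ufst (ufst (ufst p)))) (usnd p)))"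

definition reassoc :: "'u::universe \<Rightarrow> 'u" where
  "reassoc p = upair (ufst (ufst p)) (upair (usnd (ufst p)) (usnd p))"

definition uswap :: "'u::universe \<Rightarrow> 'u" where
  "uswap p = upair (usnd p) (ufst p)"

definition NCat_smc ::
    "(('u::universe, 'v::quantale) ncat, ('u, 'v) nmor, ('u, 'v) ncell) smc2" where
  "NCat_smc =
     \<lparr>tenO = ntensor, tenA = ntensor_mor, unitO = nunit,
      assoc = (\<lambda>X Y Z. mk_nmor (ntensor (ntensor X Y) Z) (ntensor X (ntensor Y Z)) reassoc reassoc),
      lunit = (\<lambda>X. mk_nmor (ntensor nunit X) X usnd usnd),
      runit = (\<lambda>X. mk_nmor (ntensor X nunit) X ufst ufst),
      braid = (\<lambda>X Y. mk_nmor (ntensor X Y) (ntensor Y X) uswap uswap),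
      ihom = nhom, evalA = neval, tenC = ntensor_cell\<rparr>"


section \<open>Quantale-enriched categories\<close>

record ('u, 'v) vcat =
  pts :: "'u set"
  vhm :: "'u \<Rightarrow> 'u \<Rightarrow> 'v"

definition v_category :: "('u::universe, 'v::quantale) vcat \<Rightarrow> bool" where
  "v_category X \<longleftrightarrow> small (pts X) \<and>
     (\<forall>x y. \<not> (x \<in> pts X \<and> y \<in> pts X) \<longrightarrow> vhm X x y = undefined) \<and>
     (\<forall>x\<in>pts X. 1 \<le> vhm X x x) \<and>
     (\<forall>x\<in>pts X. \<forall>y\<in>pts X. \<forall>z\<in>pts X. vhm X x y * vhm X y z \<le> vhm X x z)"

definition v_functor ::
    "('u::universe, 'v::quantale) vcat \<Rightarrow> ('u, 'v) vcat \<Rightarrow> ('u \<Rightarrow> 'u) \<Rightarrow> bool" where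
  "v_functor X Y f \<longleftrightarrow> f \<in> pts X \<rightarrow>\<^sub>E pts Y \<and>
     (\<forall>x\<in>pts X. \<forall>x'\<in>pts X. vhm X x x' \<le> vhm Y (f x) (f x'))"

type_synonym ('u, 'v) vmor = "(('u, 'v) vcat, 'u \<Rightarrow> 'u) mor"
type_synonym ('u, 'v) vcat_cat = "(('u, 'v) vcat, ('u, 'v) vmor) cat"

definition VCat :: "('u::universe, 'v::quantale) vcat_cat" where
  "VCat = \<lparr>obj = {X. v_category X},
           arr = {Mor X f Y | X f Y. v_category X \<and> v_category Y \<and> v_functor X Y f},
           src = msrc, tgt = mtgt,
           ide = (\<lambda>X. Mor X (restrict (\<lambda>x. x) (pts X)) X),
           cmp = (\<lambda>g f. Mor (msrc f) (compose (pts (msrc f)) (mmap g) (mmap f)) (mtgt g))\<rparr>"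

definition forget_vcat ::
    "(('u::universe, 'v::quantale) vcat, ('u, 'v) vmor, 'u set, ('u set, 'u \<Rightarrow> 'u) mor) ftr" where
  "forget_vcat = \<lparr>fo = pts, fa = (\<lambda>f. Mor (pts (msrc f)) (mmap f) (pts (mtgt f)))\<rparr>"

definition mk_vcat :: "'u set \<Rightarrow> ('u \<Rightarrow> 'u \<Rightarrow> 'v) \<Rightarrow> ('u, 'v) vcat" where
  "mk_vcat A d = \<lparr>pts = A, vhm = (\<lambda>x y. if x \<in> A \<and> y \<in> A then d x y else undefined)\<rparr>"

definition initial_vcat ::
    "'i set \<Rightarrow> 'u::universe set \<Rightarrow> ('i \<Rightarrow> ('u, 'v::quantale) vcat) \<Rightarrow>
     ('i \<Rightarrow> ('u set, 'u \<Rightarrow> 'u) mor) \<Rightarrow> ('u, 'v) vcat" where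
  "initial_vcat I A Y f = mk_vcat A (\<lambda>x y. INF i\<in>I. vhm (Y i) (mmap (f i) x) (mmap (f i) y))"

definition mk_vmor :: "('u, 'v) vcat \<Rightarrow> ('u, 'v) vcat \<Rightarrow> ('u \<Rightarrow> 'u) \<Rightarrow> ('u, 'v) vmor" where
  "mk_vmor X Y f = Mor X (restrict f (pts X)) Y"

definition vtensor :: "('u::universe, 'v::quantale) vcat \<Rightarrow> ('u, 'v) vcat \<Rightarrow> ('u, 'v) vcat" where
  "vtensor X Y = mk_vcat (utimes (pts X) (pts Y))
     (\<lambda>p q. vhm X (ufst p) (ufst q) * vhm Y (usnd p) (usnd q))"

definition vtensor_mor ::
    "('u::universe, 'v::quantale) vmor \<Rightarrow> ('u, 'v) vmor \<Rightarrow> ('u, 'v) vmor" where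
  "vtensor_mor f g = mk_vmor (vtensor (msrc f) (msrc g)) (vtensor (mtgt f) (mtgt g))
     (umap (mmap f) (mmap g))"

definition vunit :: "('u::universe, 'v::quantale) vcat" where
  "vunit = mk_vcat {upoint} (\<lambda>_ _. 1)"

definition vhom :: "('u::universe, 'v::quantale) vcat \<Rightarrow> ('u, 'v) vcat \<Rightarrow> ('u, 'v) vcat" where
  "vhom X Y = mk_vcat {ulam (pts X) f | f. v_functor X Y f}
     (\<lambda>f g. INF x\<in>pts X. vhm Y (uapp f x) (uapp g x))"

definition VCat_smc :: "(('u::universe, 'v::quantale) vcat, ('u, 'v) vmor) smc" where
  "VCat_smc =
     \<lparr>tenO = vtensor, tenA = vtensor_mor, unitO = vunit,
      assoc = (\<lambda>X Y Z. mk_vmor (vtensor (vtensor X Y) Z) (vtensor X (vtensor Y Z)) reassoc),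
      lunit = (\<lambda>X. mk_vmor (vtensor vunit X) X usnd),
      runit = (\<lambda>X. mk_vmor (vtensor X vunit) X ufst),
      braid = (\<lambda>X Y. mk_vmor (vtensor X Y) (vtensor Y X) uswap),
      ihom = vhom,
      evalA = (\<lambda>X Y. mk_vmor (vtensor (vhom X Y) X) Y (\<lambda>p. uapp (ufst p) (usnd p)))\<rparr>"


section \<open>Quantale-enriched categories as normed indiscrete categories\<close>

definition indiscrete :: "('o, 'a, 'm) cat_scheme \<Rightarrow> bool" where
  "indiscrete X \<longleftrightarrow> (\<forall>x\<in>obj X. \<forall>y\<in>obj X. \<exists>!f. f \<in> homset X x y)"

text \<open>In the indiscrete category on \<open>A\<close> the unique morphism \<open>x \<rightarrow> y\<close> is the pair \<open>(x, y)\<close>.\<close>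

definition indisc :: "'u::universe set \<Rightarrow> 'u smallcat" where
  "indisc A = \<lparr>obj = A, arr = utimes A A, src = restrict ufst (utimes A A),
               tgt = restrict usnd (utimes A A), ide = restrict (\<lambda>x. upair x x) A,
               cmp = (\<lambda>g f. if f \<in> utimes A A \<and> g \<in> utimes A A \<and> usnd f = ufst g
                             then upair (ufst f) (usnd g) else undefined)\<rparr>"

definition indisc_ftr ::
    "('u::universe set, ('u set, 'u \<Rightarrow> 'u) mor, 'u smallcat, ('u smallcat, 'u smallftr) mor) ftr"
  where
  "indisc_ftr = \<lparr>fo = indisc,
     fa = (\<lambda>f. Mor (indisc (msrc f))
                 (mk_ftr (indisc (msrc f)) (mmap f) (umap (mmap f) (mmap f)))
                 (indisc (mtgt f)))\<rparr>"

definition embed_vcat :: "('u::universe, 'v::quantale) vcat \<Rightarrow> ('u, 'v) ncat" where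
  "embed_vcat X = add_norm (indisc (pts X)) (\<lambda>p. vhm X (ufst p) (usnd p))"

definition embed_ftr ::
    "(('u::universe, 'v::quantale) vcat, ('u, 'v) vmor, ('u, 'v) ncat, ('u, 'v) nmor) ftr" where
  "embed_ftr = \<lparr>fo = embed_vcat,
     fa = (\<lambda>f. mk_nmor (embed_vcat (msrc f)) (embed_vcat (mtgt f))
                 (mmap f) (umap (mmap f) (mmap f)))\<rparr>"

definition iso_via :: "('u::universe, 'v::quantale) ncat \<Rightarrow> ('u, 'v) ncat \<Rightarrow> ('u \<Rightarrow> 'u) \<Rightarrow> bool" where
  "iso_via X Y m \<longleftrightarrow>
     (\<exists>h\<in>homset NCat X Y. iso NCat h \<and> (\<forall>x\<in>obj X. fo (mmap h) x = m x))"

end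

(*
The initial norm on X for functors F_i : X -> Y_i is the infimum of the norms |F_i f|. Lifting the
empty source and the source of all morphisms out of X gives the right and the left adjoint of the
forgetful functor. The internal hom is the usual functor category; currying respects norms because
the unit of the quantale lies below the norm of every identity.

A limit is a subobject of a product with the infimum norm. So is a colimit: in the (large) product
of the vertices of all cocones, take the subcategory generated by the images of the legs. It is
small, since it is the closure of a small set under a binary partial operation, and it is initial
among cocones through its projections. The same construction works for quantale-enriched categories.
*)
theory Submission
  imports Defs
begin

section \<open>Small sets\<close>

text \<open>Limits and colimits could be lifted from the base along the topological functor, but
  those of small categories would then have to be constructed first; one scheme, substructures of
  products, serves for limits and colimits alike. Its obstacle is size. A tuple over all cocones is
  a HOL function and not a member of the universe, so smallness is measured by
  \<open>covered\<close>, and an injection of codes then carries the set of tuples back into the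
  universe. A second choice makes the two settings uniform: an element of a normed category is an
  arrow, and objects are recovered from identities. Morphisms are then determined by what they do to
  elements, and a factorization that exists element by element is automatically a morphism, because
  joint injectivity of the projections forces the functor laws and the infimum norm forces the
  inequality. A colimit needs, besides, that two morphisms which agree on the images of the legs
  agree everywhere; this is an induction along the generation of the tuples.\<close>

lemma small_subset: "small A \<Longrightarrow> B \<subseteq> A \<Longrightarrow> small (B :: 'u::universe set)"
  unfolding small_def using separation by metis

lemma small_image: "small A \<Longrightarrow> small (f ` A)"
  for A :: "'u::universe set" and f :: "'u \<Rightarrow> 'u"
  unfolding small_def using replacement by metis

lemma elts_mkset: "small A \<Longrightarrow> elts (mkset A) = (A :: 'u::universe set)"
  unfolding small_def mkset_def by (rule theI') (metis elts_inject)

lemma small_elts: "small (elts x)"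
  unfolding small_def by blast

lemma mkset_inject: "small A \<Longrightarrow> small B \<Longrightarrow> mkset A = mkset B \<longleftrightarrow> A = (B :: 'u::universe set)"
  by (metis elts_mkset)

lemma ex_infinite_small: "\<exists>A :: 'u::universe set. small A \<and> infinite A"
  using infinity small_elts by metis

text \<open>Pairing comes from infinity and replacement: an infinite small set has two distinct
  members \<open>x\<close> and \<open>y\<close>, and the small set of these two is mapped onto
  \<open>{a, b}\<close>.\<close>

lemma small_pair: "small {a, b :: 'u::universe}"
proof -
  obtain A :: "'u set" where A: "small A" "infinite A" using ex_infinite_small by blast
  then obtain x where x: "x \<in> A" by fastforce
  obtain y where y: "y \<in> A - {x}"
    using A by (metis all_not_in_conv finite.emptyI infinite_remove)
  have "(\<lambda>z. if z = x then a else b) ` {x, y} = {a, b}" using y by auto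
  moreover have "small {x, y}" by (rule small_subset[OF A(1)]) (use x y in auto)
  ultimately show ?thesis using small_image by metis
qed

lemma small_singleton: "small {a :: 'u::universe}"
  using small_pair[of a a] by simp

text \<open>Each \<open>f a\<close> is a set of members rather than a member, so replacement is
  applied to the codes \<open>mkset (f a)\<close>, after which the union axiom applies.\<close>

lemma small_UN: "small A \<Longrightarrow> (\<And>a. a \<in> A \<Longrightarrow> small (f a)) \<Longrightarrow> small (\<Union>a\<in>A. f a)"
  for A :: "'u::universe set" and f :: "'u \<Rightarrow> 'u set"
proof -
  assume A: "small A" and f: "\<And>a. a \<in> A \<Longrightarrow> small (f a)"
  obtain x where x: "elts x = (\<lambda>a. mkset (f a)) ` A"
    using small_image[OF A, of "\<lambda>a. mkset (f a)"] unfolding small_def by blast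
  obtain y where "elts y = (\<Union>z\<in>elts x. elts z)" using union_set by blast
  also have "\<dots> = (\<Union>a\<in>A. f a)" unfolding x using f by (auto simp: elts_mkset)
  finally show ?thesis using small_elts by metis
qed

lemma small_powerset: "small A \<Longrightarrow> small {z. elts z \<subseteq> (A :: 'u::universe set)}"
  unfolding small_def using power_set by metis

section \<open>Ordered pairs and graphs of functions\<close>

lemma upair_inject [simp]: "upair a b = upair c d \<longleftrightarrow> a = c \<and> b = d"
  unfolding upair_def
  by (auto simp: mkset_inject small_pair small_singleton doubleton_eq_iff)

lemma ufst_upair [simp]: "ufst (upair a b) = a"
  unfolding ufst_def by simp

lemma usnd_upair [simp]: "usnd (upair a b) = b"
  unfolding usnd_def by simp

lemma umap_upair [simp]: "umap f g (upair a b) = upair (f a) (g b)"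
  by (simp add: umap_def)

lemma reassoc_upair [simp]: "reassoc (upair (upair a b) c) = upair a (upair b c)"
  by (simp add: reassoc_def)

lemma uswap_upair [simp]: "uswap (upair a b) = upair b a"
  by (simp add: uswap_def)

lemma upair_in_utimes [simp]: "upair a b \<in> utimes A B \<longleftrightarrow> a \<in> A \<and> b \<in> B"
  unfolding utimes_def by simp

lemma utimesE: "p \<in> utimes A B \<Longrightarrow> (\<And>a b. p = upair a b \<Longrightarrow> a \<in> A \<Longrightarrow> b \<in> B \<Longrightarrow> P) \<Longrightarrow> P"
  unfolding utimes_def by blast

lemma ball_utimes [simp]: "(\<forall>p\<in>utimes A B. P p) \<longleftrightarrow> (\<forall>a\<in>A. \<forall>b\<in>B. P (upair a b))"
  unfolding utimes_def by blast

text \<open>Slicing the product over its first coordinate reduces the claim to replacement and small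
  unions.\<close>

lemma small_utimes: "small A \<Longrightarrow> small B \<Longrightarrow> small (utimes A B)"
proof -
  assume A: "small A" and B: "small B"
  have "utimes A B = (\<Union>a\<in>A. upair a ` B)" unfolding utimes_def by blast
  then show ?thesis by (simp add: small_UN small_image A B)
qed

lemma elts_ulam: "small A \<Longrightarrow> elts (ulam A f) = {upair a (f a) | a. a \<in> A}"
proof -
  assume A: "small A"
  have "{upair a (f a) | a. a \<in> A} = (\<lambda>a. upair a (f a)) ` A" by blast
  then show ?thesis unfolding ulam_def by (metis (no_types, lifting) A elts_mkset small_image)
qed

lemma uapp_ulam [simp]: "small A \<Longrightarrow> a \<in> A \<Longrightarrow> uapp (ulam A f) a = f a"
  unfolding uapp_def by (simp add: elts_ulam)

lemma ulam_cong: "(\<And>a. a \<in> A \<Longrightarrow> f a = g a) \<Longrightarrow> ulam A f = ulam A g"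
  unfolding ulam_def by (rule arg_cong[where f = mkset]) auto

lemma ulam_eq_iff: "small A \<Longrightarrow> ulam A f = ulam A g \<longleftrightarrow> (\<forall>a\<in>A. f a = g a)"
  by (metis uapp_ulam ulam_cong)

text \<open>A graph is a subset of the product, so all graphs lie in the small collection of codes
  of subsets of \<open>utimes A B\<close>.\<close>

lemma small_ulams: "small A \<Longrightarrow> small B \<Longrightarrow> small {ulam A f | f. f ` A \<subseteq> B}"
proof -
  assume A: "small A" and B: "small B"
  show ?thesis
    by (rule small_subset[OF small_powerset[OF small_utimes[OF A B]]])
      (use elts_ulam[OF A] in \<open>auto simp: image_subset_iff\<close>)
qed

text \<open>Smallness of a set whose elements are not members of the universe.\<close>

definition covered :: "'u::universe itself \<Rightarrow> 'a set \<Rightarrow> bool" where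
  "covered _ S \<longleftrightarrow> (\<exists>(A :: 'u set) f. small A \<and> S \<subseteq> f ` A)"

lemma covered_subset: "covered U S \<Longrightarrow> R \<subseteq> S \<Longrightarrow> covered U R"
  unfolding covered_def by (meson subset_trans)

lemma covered_image: "covered U S \<Longrightarrow> covered U (f ` S)"
  unfolding covered_def by (metis image_comp image_mono)

lemma covered_small: "small (A :: 'u::universe set) \<Longrightarrow> covered TYPE('u) A"
  unfolding covered_def by (metis image_ident order_refl)

lemma covered_Times:
  assumes "covered TYPE('u::universe) R" "covered TYPE('u) S"
  shows "covered TYPE('u) (R \<times> S)"
proof -
  obtain A :: "'u set" and f where A: "small A" "R \<subseteq> f ` A" using assms(1) unfolding covered_def by blast
  obtain B :: "'u set" and g where B: "small B" "S \<subseteq> g ` B" using assms(2) unfolding covered_def by blast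
  have "R \<times> S \<subseteq> (\<lambda>p. (f (ufst p), g (usnd p))) ` utimes A B"
  proof
    fix p assume "p \<in> R \<times> S"
    then obtain a b where "a \<in> A" "b \<in> B" "p = (f a, g b)" using A B by blast
    then show "p \<in> (\<lambda>p. (f (ufst p), g (usnd p))) ` utimes A B"
      by (intro image_eqI[of _ _ "upair a b"]) auto
  qed
  then show ?thesis unfolding covered_def using small_utimes[OF A(1) B(1)] by blast
qed

lemma covered_UN:
  assumes "covered TYPE('u::universe) I" "\<And>i. i \<in> I \<Longrightarrow> covered TYPE('u) (S i)"
  shows "covered TYPE('u) (\<Union>i\<in>I. S i)"
proof -
  obtain A :: "'u set" and f where A: "small A" "I \<subseteq> f ` A" using assms(1) unfolding covered_def by blast
  have "\<forall>i\<in>I. \<exists>B g. small (B :: 'u set) \<and> S i \<subseteq> g ` B" using assms(2) unfolding covered_def by blast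
  then obtain B g where B: "\<And>i. i \<in> I \<Longrightarrow> small (B i :: 'u set) \<and> S i \<subseteq> g i ` B i" by metis
  \<comment> \<open>The covering map may send some \<open>a\<close> outside \<open>I\<close>, where
    nothing is known about \<open>B (f a)\<close>; these \<open>a\<close> are dropped so that
    \<open>W\<close> is small.\<close>
  define A' where "A' = {a \<in> A. f a \<in> I}"
  have A': "small A'" unfolding A'_def by (rule small_subset[OF A(1)]) auto
  define W where "W = (\<Union>a\<in>A'. upair a ` B (f a))"
  have W: "small W" unfolding W_def by (rule small_UN[OF A' small_image]) (use B A'_def in auto)
  have "(\<Union>i\<in>I. S i) \<subseteq> (\<lambda>p. g (f (ufst p)) (usnd p)) ` W"
  proof
    fix s assume "s \<in> (\<Union>i\<in>I. S i)"
    then obtain i where i: "i \<in> I" "s \<in> S i" by blast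
    then obtain a b where "a \<in> A'" "i = f a" "b \<in> B i" "s = g i b" using A B unfolding A'_def by blast
    then show "s \<in> (\<lambda>p. g (f (ufst p)) (usnd p)) ` W"
      unfolding W_def by (intro image_eqI[of _ _ "upair a b"]) auto
  qed
  then show ?thesis unfolding covered_def using W by blast
qed

text \<open>Here the axiom of infinity makes countable unions of covered sets covered, as they arise
  from the stages of a generation process.\<close>

lemma covered_nat: "covered TYPE('u::universe) (UNIV :: nat set)"
proof -
  obtain A :: "'u set" where A: "small A" "infinite A" using ex_infinite_small by blast
  then obtain e :: "nat \<Rightarrow> 'u" where e: "inj e" "range e \<subseteq> A" using infinite_countable_subset by blast
  have "UNIV \<subseteq> inv e ` A" using e by (metis (no_types, lifting) UNIV_I image_eqI inv_f_f rangeI subsetD subsetI)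
  then show ?thesis unfolding covered_def using A by blast
qed

text \<open>A function in the product is recovered from its graph by \<open>uapp\<close>, and the
  graphs of maps from \<open>K\<close> into the union of the \<open>B k\<close> form a small
  set.\<close>

lemma covered_PiE:
  assumes "small (K :: 'u::universe set)" "\<And>k. k \<in> K \<Longrightarrow> small (B k :: 'u set)"
  shows "covered TYPE('u) (PiE K B)"
proof -
  let ?B = "\<Union>k\<in>K. B k"
  have "PiE K B \<subseteq> (\<lambda>g. restrict (uapp g) K) ` {ulam K f | f. f ` K \<subseteq> ?B}"
  proof
    fix f assume f: "f \<in> PiE K B"
    then have "f = restrict (uapp (ulam K f)) K"
      using assms(1) by (auto simp: fun_eq_iff PiE_def extensional_def)
    then show "f \<in> (\<lambda>g. restrict (uapp g) K) ` {ulam K f | f. f ` K \<subseteq> ?B}"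
      using f by (intro image_eqI[of _ _ "ulam K f"]) auto
  qed
  then show ?thesis unfolding covered_def using small_ulams[OF assms(1) small_UN[OF assms, of "\<lambda>k. k"]] by auto
qed

text \<open>Choosing one preimage per element under a covering map assigns codes in the universe; in
  this way a set of tuples becomes the carrier of a small structure.\<close>

lemma covered_injection:
  assumes "covered TYPE('u::universe) S"
  shows "\<exists>c :: 'a \<Rightarrow> 'u. inj_on c S \<and> small (c ` S)"
proof -
  obtain A :: "'u set" and f where A: "small A" "S \<subseteq> f ` A" using assms unfolding covered_def by blast
  have "inj_on (inv_into A f) S" using A(2) by (rule inj_on_inv_into)
  moreover have "small (inv_into A f ` S)"
    by (rule small_subset[OF A(1)]) (use A(2) in \<open>auto intro: inv_into_into\<close>)
  ultimately show ?thesis by blast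
qed

text \<open>Premise \<open>T\<close> has the form of the induction principle of an inductive set,
  with \<open>m\<close> total; it applies to a closure under a partial operation as well, which is
  contained in the closure under \<open>m\<close>. The bound is the union of countably many
  stages.\<close>

lemma covered_closure:
  assumes G: "covered TYPE('u::universe) G"
    and T: "\<And>P t. t \<in> T \<Longrightarrow> (\<And>g. g \<in> G \<Longrightarrow> P g) \<Longrightarrow> (\<And>f g. P f \<Longrightarrow> P g \<Longrightarrow> P (m g f)) \<Longrightarrow> P t"
  shows "covered TYPE('u) T"
proof -
  define S where "S = rec_nat G (\<lambda>_ R. R \<union> (\<lambda>p. m (fst p) (snd p)) ` (R \<times> R))"
  have S0: "S 0 = G" and SS: "\<And>n. S (Suc n) = S n \<union> (\<lambda>p. m (fst p) (snd p)) ` (S n \<times> S n)"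
    by (simp_all add: S_def)
  \<comment> \<open>Binary unions are written as countable ones: \<open>A\<close> at stage 0 and
    \<open>B\<close> at all later stages.\<close>
  have un: "covered TYPE('u) (A \<union> B)" if "covered TYPE('u) A" "covered TYPE('u) B" for A B :: "'b set"
  proof -
    have "covered TYPE('u) (\<Union>n\<in>(UNIV::nat set). if n = 0 then A else B)"
      by (rule covered_UN[OF covered_nat]) (use that in simp)
    then show ?thesis by (rule covered_subset) (auto split: if_splits)
  qed
  have cov: "covered TYPE('u) (S n)" for n
  proof (induction n)
    case 0 show ?case unfolding S0 by (rule G)
  next
    case (Suc n) show ?case unfolding SS
      by (intro un covered_image covered_Times Suc)
  qed
  have mono: "S n \<subseteq> S (n + k)" for n k
    by (induction k) (auto simp: SS)
  have "T \<subseteq> (\<Union>n. S n)"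
  proof
    fix t assume "t \<in> T"
    then show "t \<in> (\<Union>n. S n)"
    proof (rule T)
      show "g \<in> (\<Union>n. S n)" if "g \<in> G" for g using that S0 by blast
      fix f g assume "f \<in> (\<Union>n. S n)" "g \<in> (\<Union>n. S n)"
      then obtain i j where "f \<in> S i" "g \<in> S j" by blast
      \<comment> \<open>Both arguments are moved up to the common stage \<open>i + j\<close>, so
        that their value under \<open>m\<close> appears at the next one.\<close>
      then have "f \<in> S (i + j)" "g \<in> S (i + j)" using mono[of i j] mono[of j i] by (auto simp: add.commute)
      then have "m g f \<in> S (Suc (i + j))" unfolding SS by force
      then show "m g f \<in> (\<Union>n. S n)" by blast
    qed
  qed
  then show ?thesis by (rule covered_subset[OF covered_UN[OF covered_nat cov]])
qed

section \<open>Quantales and categories\<close>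

text \<open>For \<open>a \<le> b\<close> the join of the pair is \<open>b\<close>, so monotonicity
  is the binary case of preservation of joins.\<close>

lemma quantale_mult_right_mono: "a \<le> b \<Longrightarrow> a * v \<le> b * (v :: 'v::quantale)"
proof -
  assume "a \<le> b"
  then have "b * v = Sup {a, b} * v" by (simp add: sup_absorb2)
  also have "\<dots> = sup (a * v) (b * v)" using Sup_mult[of "{a, b}" v] by simp
  finally show ?thesis by (metis sup.cobounded1)
qed

lemma quantale_mult_mono: "a \<le> b \<Longrightarrow> c \<le> d \<Longrightarrow> a * c \<le> b * (d :: 'v::quantale)"
  by (metis mult.commute order_trans quantale_mult_right_mono)

lemma quantale_one_le_mult: "1 \<le> a \<Longrightarrow> 1 \<le> b \<Longrightarrow> 1 \<le> a * (b :: 'v::quantale)"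
  using quantale_mult_mono[of 1 a 1 b] by simp

lemma quantale_le_mult_one: "1 \<le> b \<Longrightarrow> a \<le> a * (b :: 'v::quantale)"
  using quantale_mult_mono[of a a 1 b] by simp

lemma quantale_le_one_mult: "1 \<le> b \<Longrightarrow> a \<le> b * (a :: 'v::quantale)"
  using quantale_le_mult_one[of b a] by (simp add: mult.commute)

text \<open>By monotonicity the product of two infima lies below the product of the terms at any one
  index. This gives the composition inequality, or transitivity, for every structure defined by an
  infimum: internal homs, initial structures and subproducts.\<close>

lemma INF_mult_INF_le:
  "(\<And>i. i \<in> I \<Longrightarrow> a i * b i \<le> c i) \<Longrightarrow> (INF i\<in>I. a i) * (INF i\<in>I. b i) \<le> (INF i\<in>I. c i :: 'v::quantale)"
  by (rule INF_greatest) (meson INF_lower order_trans quantale_mult_mono)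

section \<open>Rules for categories and functors\<close>

lemma in_homset: "f \<in> homset C x y \<longleftrightarrow> f \<in> arr C \<and> src C f = x \<and> tgt C f = y"
  by (simp add: homset_def)

lemma category_simps [simp]:
  assumes "category C"
  shows "f \<in> arr C \<Longrightarrow> src C f \<in> obj C"
    and "f \<in> arr C \<Longrightarrow> tgt C f \<in> obj C"
    and "x \<in> obj C \<Longrightarrow> ide C x \<in> arr C"
    and "x \<in> obj C \<Longrightarrow> src C (ide C x) = x"
    and "x \<in> obj C \<Longrightarrow> tgt C (ide C x) = x"
    and "f \<in> arr C \<Longrightarrow> g \<in> arr C \<Longrightarrow> tgt C f = src C g \<Longrightarrow> cmp C g f \<in> arr C"
    and "f \<in> arr C \<Longrightarrow> g \<in> arr C \<Longrightarrow> tgt C f = src C g \<Longrightarrow> src C (cmp C g f) = src C f"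
    and "f \<in> arr C \<Longrightarrow> g \<in> arr C \<Longrightarrow> tgt C f = src C g \<Longrightarrow> tgt C (cmp C g f) = tgt C g"
    and "f \<in> arr C \<Longrightarrow> src C f = x \<Longrightarrow> cmp C f (ide C x) = f"
    and "f \<in> arr C \<Longrightarrow> tgt C f = x \<Longrightarrow> cmp C (ide C x) f = f"
  using assms unfolding category_def homset_def by auto

lemma category_assoc:
  "category C \<Longrightarrow> f \<in> arr C \<Longrightarrow> g \<in> arr C \<Longrightarrow> h \<in> arr C \<Longrightarrow> tgt C f = src C g \<Longrightarrow> tgt C g = src C h \<Longrightarrow>
    cmp C (cmp C h g) f = cmp C h (cmp C g f)"
  unfolding category_def by simp

lemma categoryI:
  assumes "\<And>f. f \<in> arr C \<Longrightarrow> src C f \<in> obj C"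
    and "\<And>f. f \<in> arr C \<Longrightarrow> tgt C f \<in> obj C"
    and "\<And>x. x \<in> obj C \<Longrightarrow> ide C x \<in> arr C"
    and "\<And>x. x \<in> obj C \<Longrightarrow> src C (ide C x) = x"
    and "\<And>x. x \<in> obj C \<Longrightarrow> tgt C (ide C x) = x"
    and "\<And>f g. f \<in> arr C \<Longrightarrow> g \<in> arr C \<Longrightarrow> tgt C f = src C g \<Longrightarrow> cmp C g f \<in> arr C"
    and "\<And>f g. f \<in> arr C \<Longrightarrow> g \<in> arr C \<Longrightarrow> tgt C f = src C g \<Longrightarrow> src C (cmp C g f) = src C f"
    and "\<And>f g. f \<in> arr C \<Longrightarrow> g \<in> arr C \<Longrightarrow> tgt C f = src C g \<Longrightarrow> tgt C (cmp C g f) = tgt C g"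
    and "\<And>f. f \<in> arr C \<Longrightarrow> cmp C f (ide C (src C f)) = f"
    and "\<And>f. f \<in> arr C \<Longrightarrow> cmp C (ide C (tgt C f)) f = f"
    and "\<And>f g h. f \<in> arr C \<Longrightarrow> g \<in> arr C \<Longrightarrow> h \<in> arr C \<Longrightarrow> tgt C f = src C g \<Longrightarrow> tgt C g = src C h \<Longrightarrow>
      cmp C h (cmp C g f) = cmp C (cmp C h g) f"
  shows "category C"
  unfolding category_def homset_def using assms by simp

lemma is_functor_simps:
  assumes "is_functor C D F"
  shows "category C" "category D"
    and "x \<in> obj C \<Longrightarrow> fo F x \<in> obj D"
    and "f \<in> arr C \<Longrightarrow> fa F f \<in> arr D"
    and "f \<in> arr C \<Longrightarrow> src D (fa F f) = fo F (src C f)"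
    and "f \<in> arr C \<Longrightarrow> tgt D (fa F f) = fo F (tgt C f)"
    and "x \<in> obj C \<Longrightarrow> fa F (ide C x) = ide D (fo F x)"
    and "f \<in> arr C \<Longrightarrow> g \<in> arr C \<Longrightarrow> tgt C f = src C g \<Longrightarrow> fa F (cmp C g f) = cmp D (fa F g) (fa F f)"
  using assms unfolding is_functor_def homset_def by auto

lemma is_functorI:
  assumes "category C" "category D"
    and "\<And>x. x \<in> obj C \<Longrightarrow> fo F x \<in> obj D"
    and "\<And>f. f \<in> arr C \<Longrightarrow> fa F f \<in> arr D"
    and "\<And>f. f \<in> arr C \<Longrightarrow> src D (fa F f) = fo F (src C f)"
    and "\<And>f. f \<in> arr C \<Longrightarrow> tgt D (fa F f) = fo F (tgt C f)"
    and "\<And>x. x \<in> obj C \<Longrightarrow> fa F (ide C x) = ide D (fo F x)"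
    and "\<And>f g. f \<in> arr C \<Longrightarrow> g \<in> arr C \<Longrightarrow> tgt C f = src C g \<Longrightarrow> fa F (cmp C g f) = cmp D (fa F g) (fa F f)"
  shows "is_functor C D F"
  using assms unfolding is_functor_def homset_def by simp


section \<open>The 2-category of normed categories\<close>

lemma mk_ftr_simps [simp]:
  "x \<in> obj X \<Longrightarrow> fo (mk_ftr X f g) x = f x"
  "a \<in> arr X \<Longrightarrow> fa (mk_ftr X f g) a = g a"
  by (simp_all add: mk_ftr_def)

lemma mk_ftr_eq_iff [simp]:
  "mk_ftr X f g = mk_ftr X f' g' \<longleftrightarrow> (\<forall>x\<in>obj X. f x = f' x) \<and> (\<forall>a\<in>arr X. g a = g' a)"
  by (auto simp: mk_ftr_def restrict_def fun_eq_iff)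

lemma small_functorD: "small_functor X Y F \<Longrightarrow> is_functor X Y F"
  by (simp add: small_functor_def)

lemma mk_ftr_collapse: "small_functor X Y F \<Longrightarrow> mk_ftr X (fo F) (fa F) = F"
  by (cases F) (simp add: mk_ftr_def small_functor_def extensional_restrict)

lemma small_functor_eq_iff:
  "small_functor X Y F \<Longrightarrow> mk_ftr X f g = F \<longleftrightarrow> (\<forall>x\<in>obj X. f x = fo F x) \<and> (\<forall>a\<in>arr X. g a = fa F a)"
  using mk_ftr_eq_iff[of X f g "fo F" "fa F"] mk_ftr_collapse[of X Y F] by simp

lemma small_functor_ext:
  "small_functor X Y F \<Longrightarrow> small_functor X Y' G \<Longrightarrow> (\<And>x. x \<in> obj X \<Longrightarrow> fo F x = fo G x) \<Longrightarrow>
    (\<And>a. a \<in> arr X \<Longrightarrow> fa F a = fa G a) \<Longrightarrow> F = G"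
  using mk_ftr_eq_iff[of X "fo F" "fa F" "fo G" "fa G"] mk_ftr_collapse[of X Y F]
    mk_ftr_collapse[of X Y' G] by simp

lemma small_functor_mk_ftrI:
  assumes "category X" "category Y"
    and "\<And>x. x \<in> obj X \<Longrightarrow> f x \<in> obj Y"
    and "\<And>a. a \<in> arr X \<Longrightarrow> g a \<in> arr Y"
    and "\<And>a. a \<in> arr X \<Longrightarrow> src Y (g a) = f (src X a)"
    and "\<And>a. a \<in> arr X \<Longrightarrow> tgt Y (g a) = f (tgt X a)"
    and "\<And>x. x \<in> obj X \<Longrightarrow> g (ide X x) = ide Y (f x)"
    and "\<And>a b. a \<in> arr X \<Longrightarrow> b \<in> arr X \<Longrightarrow> tgt X a = src X b \<Longrightarrow> g (cmp X b a) = cmp Y (g b) (g a)"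
  shows "small_functor X Y (mk_ftr X f g)"
  unfolding small_functor_def
  by (auto intro!: is_functorI simp: assms) (auto simp: mk_ftr_def)

lemma normed_functor_mk_ftrI:
  assumes "category X" "category Y"
    and "\<And>x. x \<in> obj X \<Longrightarrow> f x \<in> obj Y"
    and "\<And>a. a \<in> arr X \<Longrightarrow> g a \<in> arr Y"
    and "\<And>a. a \<in> arr X \<Longrightarrow> src Y (g a) = f (src X a)"
    and "\<And>a. a \<in> arr X \<Longrightarrow> tgt Y (g a) = f (tgt X a)"
    and "\<And>x. x \<in> obj X \<Longrightarrow> g (ide X x) = ide Y (f x)"
    and "\<And>a b. a \<in> arr X \<Longrightarrow> b \<in> arr X \<Longrightarrow> tgt X a = src X b \<Longrightarrow> g (cmp X b a) = cmp Y (g b) (g a)"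
    and "\<And>a. a \<in> arr X \<Longrightarrow> nrm X a \<le> nrm Y (g a)"
  shows "normed_functor X Y (mk_ftr X f g)"
proof -
  have "small_functor X Y (mk_ftr X f g)"
    by (rule small_functor_mk_ftrI) (use assms in blast)+
  then show ?thesis unfolding normed_functor_def using assms(9) by simp
qed

lemma normed_cat_category [simp]: "normed_cat X \<Longrightarrow> category X"
  by (simp add: normed_cat_def small_cat_def)

lemma normed_cat_small [simp]:
  "normed_cat X \<Longrightarrow> small (obj X)" "normed_cat X \<Longrightarrow> small (arr X)"
  by (simp_all add: normed_cat_def small_cat_def)

lemma nrm_ide: "normed_cat X \<Longrightarrow> x \<in> obj X \<Longrightarrow> 1 \<le> nrm X (ide X x)"
  by (simp add: normed_cat_def)

lemma nrm_cmp:
  "normed_cat X \<Longrightarrow> f \<in> arr X \<Longrightarrow> g \<in> arr X \<Longrightarrow> tgt X f = src X g \<Longrightarrow>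
    nrm X f * nrm X g \<le> nrm X (cmp X g f)"
  by (simp add: normed_cat_def)

lemma normed_functor_simps [simp]:
  assumes "normed_functor X Y F"
  shows "x \<in> obj X \<Longrightarrow> fo F x \<in> obj Y"
    and "f \<in> arr X \<Longrightarrow> fa F f \<in> arr Y"
    and "f \<in> arr X \<Longrightarrow> src Y (fa F f) = fo F (src X f)"
    and "f \<in> arr X \<Longrightarrow> tgt Y (fa F f) = fo F (tgt X f)"
    and "f \<in> arr X \<Longrightarrow> g \<in> arr X \<Longrightarrow> tgt X f = src X g \<Longrightarrow> fa F (cmp X g f) = cmp Y (fa F g) (fa F f)"
    and "f \<in> arr X \<Longrightarrow> nrm X f \<le> nrm Y (fa F f)"
  using assms unfolding normed_functor_def by (auto dest: small_functorD simp: is_functor_simps)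

lemma normed_functor_ide:
  "normed_functor X Y F \<Longrightarrow> x \<in> obj X \<Longrightarrow> fa F (ide X x) = ide Y (fo F x)"
  unfolding normed_functor_def by (auto dest: small_functorD simp: is_functor_simps)

lemma normed_functor_is_functor: "normed_functor X Y F \<Longrightarrow> is_functor X Y F"
  by (simp add: normed_functor_def small_functor_def)

text \<open>Extensionality reduces equality of functors to pointwise equality on the carriers. As
  rewrite rules these equivalences let the category laws and the coherence equations be checked by
  simplification.\<close>

lemma normed_functor_eq_iff [simp]:
  assumes "normed_functor X Y F"
  shows "mk_ftr X f g = F \<longleftrightarrow> (\<forall>x\<in>obj X. f x = fo F x) \<and> (\<forall>a\<in>arr X. g a = fa F a)"
    and "F = mk_ftr X f g \<longleftrightarrow> (\<forall>x\<in>obj X. fo F x = f x) \<and> (\<forall>a\<in>arr X. fa F a = g a)"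
proof -
  show *: "mk_ftr X f g = F \<longleftrightarrow> (\<forall>x\<in>obj X. f x = fo F x) \<and> (\<forall>a\<in>arr X. g a = fa F a)"
    using small_functor_eq_iff[of X Y F f g] assms unfolding normed_functor_def by blast
  show "F = mk_ftr X f g \<longleftrightarrow> (\<forall>x\<in>obj X. fo F x = f x) \<and> (\<forall>a\<in>arr X. fa F a = g a)"
    unfolding eq_commute[of F] * by (intro arg_cong2[where f = "(\<and>)"] ball_cong refl eq_commute)
qed

lemma normed_functor_ext:
  "normed_functor X Y F \<Longrightarrow> normed_functor X Y' G \<Longrightarrow> (\<And>x. x \<in> obj X \<Longrightarrow> fo F x = fo G x) \<Longrightarrow>
    (\<And>a. a \<in> arr X \<Longrightarrow> fa F a = fa G a) \<Longrightarrow> F = G"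
  unfolding normed_functor_def using small_functor_ext by blast

lemma normed_functor_id [simp]: "normed_cat X \<Longrightarrow> normed_functor X X (mk_ftr X (\<lambda>x. x) (\<lambda>f. f))"
  by (rule normed_functor_mk_ftrI) simp_all

lemma normed_functor_comp [simp]:
  "normed_cat X \<Longrightarrow> normed_cat Z \<Longrightarrow> normed_functor X Y F \<Longrightarrow> normed_functor Y Z G \<Longrightarrow>
    normed_functor X Z (mk_ftr X (\<lambda>x. fo G (fo F x)) (\<lambda>f. fa G (fa F f)))"
  by (rule normed_functor_mk_ftrI)
    (auto simp: normed_functor_ide intro: order_trans[OF normed_functor_simps(6)[of X Y F]])

lemma NCat_sel [simp]:
  "obj NCat = {X. normed_cat X}" "src NCat = msrc" "tgt NCat = mtgt"
  "ide NCat X = Mor X (mk_ftr X (\<lambda>x. x) (\<lambda>f. f)) X" "cmp NCat = ncomp" "vert NCat = NCat_vert"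
  by (simp_all add: NCat_def)

lemma arr_NCat [simp]:
  "Mor X F Y \<in> arr NCat \<longleftrightarrow> normed_cat X \<and> normed_cat Y \<and> normed_functor X Y F"
  by (simp add: NCat_def)

lemma arr_NCatE:
  assumes "h \<in> arr NCat"
  obtains X F Y where "h = Mor X F Y" "normed_cat X" "normed_cat Y" "normed_functor X Y F"
  using assms by (auto simp: NCat_def)

text \<open>Unfolded axioms about arrows of \<open>NCat\<close> turn into statements about functors,
  to which the rules above apply.\<close>

lemma ball_arr_NCat [simp]:
  "(\<forall>h\<in>arr NCat. P h) \<longleftrightarrow>
    (\<forall>X F Y. normed_cat X \<longrightarrow> normed_cat Y \<longrightarrow> normed_functor X Y F \<longrightarrow> P (Mor X F Y))"
  by (metis arr_NCat arr_NCatE)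

lemma homset_NCat [simp]:
  "Mor X' F Y' \<in> homset NCat X Y \<longleftrightarrow> X' = X \<and> Y' = Y \<and> normed_cat X \<and> normed_cat Y \<and> normed_functor X Y F"
  by (auto simp: in_homset)

lemma homset_NCatE:
  assumes "h \<in> homset NCat X Y"
  obtains F where "h = Mor X F Y" "normed_cat X" "normed_cat Y" "normed_functor X Y F"
  using assms by (auto simp: in_homset elim: arr_NCatE)

lemma ball_homset_NCat [simp]:
  "(\<forall>h\<in>homset NCat X Y. P h) \<longleftrightarrow>
    (\<forall>F. normed_cat X \<longrightarrow> normed_cat Y \<longrightarrow> normed_functor X Y F \<longrightarrow> P (Mor X F Y))"
  by (metis homset_NCat homset_NCatE)

lemma ncomp_Mor [simp]:
  "ncomp (Mor Y G Z) (Mor X F Y') = Mor X (mk_ftr X (\<lambda>x. fo G (fo F x)) (\<lambda>f. fa G (fa F f))) Z"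
  by (simp add: ncomp_def)

lemma category_NCat [simp]: "category NCat"
  unfolding category_def by (simp add: in_homset) clarsimp

section \<open>Natural transformations and their vertical and horizontal composition\<close>

lemma normed_nat_trans_simps [simp]:
  assumes "normed_nat_trans X Y F G \<alpha>"
  shows "x \<in> obj X \<Longrightarrow> \<alpha> x \<in> arr Y"
    and "x \<in> obj X \<Longrightarrow> src Y (\<alpha> x) = fo F x"
    and "x \<in> obj X \<Longrightarrow> tgt Y (\<alpha> x) = fo G x"
    and "x \<in> obj X \<Longrightarrow> 1 \<le> nrm Y (\<alpha> x)"
  using assms unfolding normed_nat_trans_def nat_trans_def homset_def by auto

lemma normed_nat_trans_functors:
  assumes "normed_nat_trans X Y F G \<alpha>"
  shows "normed_functor X Y F" and "normed_functor X Y G"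
  using assms unfolding normed_nat_trans_def by auto

lemma normed_nat_trans_natural:
  "normed_nat_trans X Y F G \<alpha> \<Longrightarrow> f \<in> arr X \<Longrightarrow>
    cmp Y (\<alpha> (tgt X f)) (fa F f) = cmp Y (fa G f) (\<alpha> (src X f))"
  unfolding normed_nat_trans_def nat_trans_def by simp

lemma normed_nat_transI:
  assumes "normed_functor X Y F" "normed_functor X Y G"
    and "\<And>x. x \<in> obj X \<Longrightarrow> \<alpha> x \<in> arr Y"
    and "\<And>x. x \<in> obj X \<Longrightarrow> src Y (\<alpha> x) = fo F x"
    and "\<And>x. x \<in> obj X \<Longrightarrow> tgt Y (\<alpha> x) = fo G x"
    and "\<And>f. f \<in> arr X \<Longrightarrow> cmp Y (\<alpha> (tgt X f)) (fa F f) = cmp Y (fa G f) (\<alpha> (src X f))"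
    and "\<And>x. x \<in> obj X \<Longrightarrow> 1 \<le> nrm Y (\<alpha> x)"
  shows "normed_nat_trans X Y F G (restrict \<alpha> (obj X))"
proof -
  have "is_functor X Y F" "is_functor X Y G" by (simp_all add: normed_functor_is_functor assms)
  moreover from this have "category X" by (simp add: is_functor_simps)
  ultimately show ?thesis
    unfolding normed_nat_trans_def nat_trans_def homset_def using assms by simp
qed

lemma normed_nat_trans_eq_iff [simp]:
  assumes "normed_nat_trans X Y F G \<alpha>"
  shows "restrict \<beta> (obj X) = \<alpha> \<longleftrightarrow> (\<forall>x\<in>obj X. \<beta> x = \<alpha> x)"
    and "\<alpha> = restrict \<beta> (obj X) \<longleftrightarrow> (\<forall>x\<in>obj X. \<alpha> x = \<beta> x)"
  using assms unfolding normed_nat_trans_def by (auto simp: fun_eq_iff extensional_def)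

lemma restrict_eq_restrict_iff [simp]: "restrict f A = restrict g A \<longleftrightarrow> (\<forall>x\<in>A. f x = g x)"
  by (auto simp: fun_eq_iff)

lemma NCat_vert_sel [simp]:
  "obj NCat_vert = arr NCat" "src NCat_vert = msrc" "tgt NCat_vert = mtgt"
  "ide NCat_vert (Mor X F Y) = Mor (Mor X F Y) (restrict (\<lambda>x. ide Y (fo F x)) (obj X)) (Mor X F Y)"
  "cmp NCat_vert (Mor G' \<beta> H) (Mor (Mor X F Y) \<alpha> G) =
    Mor (Mor X F Y) (restrict (\<lambda>x. cmp Y (\<beta> x) (\<alpha> x)) (obj X)) H"
  by (simp_all add: NCat_vert_def NCat_def)

lemma arr_NCat_vert [simp]:
  "Mor (Mor X F Y) \<alpha> (Mor X' G Y') \<in> arr NCat_vert \<longleftrightarrow>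
    X' = X \<and> Y' = Y \<and> normed_cat X \<and> normed_cat Y \<and> normed_nat_trans X Y F G \<alpha>"
  by (auto simp: NCat_vert_def)

lemma arr_NCat_vertE:
  assumes "c \<in> arr NCat_vert"
  obtains X F Y G \<alpha> where "c = Mor (Mor X F Y) \<alpha> (Mor X G Y)" "normed_cat X" "normed_cat Y"
    "normed_functor X Y F" "normed_functor X Y G" "normed_nat_trans X Y F G \<alpha>"
proof -
  obtain X F Y G \<alpha> where c: "c = Mor (Mor X F Y) \<alpha> (Mor X G Y)" "normed_cat X" "normed_cat Y"
      "normed_nat_trans X Y F G \<alpha>"
    using assms by (auto simp: NCat_vert_def)
  show thesis
    by (rule that[OF c(1-3) normed_nat_trans_functors(1)[OF c(4)] normed_nat_trans_functors(2)[OF c(4)] c(4)])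
qed

lemma ball_arr_NCat_vert [simp]:
  "(\<forall>c\<in>arr NCat_vert. P c) \<longleftrightarrow>
    (\<forall>X F Y G \<alpha>. normed_cat X \<longrightarrow> normed_cat Y \<longrightarrow>
      normed_functor X Y F \<longrightarrow> normed_functor X Y G \<longrightarrow> normed_nat_trans X Y F G \<alpha> \<longrightarrow>
      P (Mor (Mor X F Y) \<alpha> (Mor X G Y)))"
  by (intro iffI ballI) (simp, erule arr_NCat_vertE, simp)

lemma hcmp_NCat [simp]:
  "hcmp NCat (Mor (Mor Y G Z) \<beta> (Mor Y' G' Z')) (Mor (Mor X F Y'') \<alpha> (Mor X' F' Y''')) =
    Mor (ncomp (Mor Y G Z) (Mor X F Y''))
      (restrict (\<lambda>x. cmp Z (\<beta> (fo F' x)) (fa G (\<alpha> x))) (obj X))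
      (ncomp (Mor Y' G' Z') (Mor X' F' Y'''))"
  by (simp add: NCat_def)

lemma src0_NCat [simp]: "src0 NCat (Mor (Mor X F Y) \<alpha> G) = X"
  and tgt0_NCat [simp]: "tgt0 NCat (Mor (Mor X F Y) \<alpha> G) = Y"
  by (simp_all add: src0_def tgt0_def)

lemma normed_nat_trans_id [simp]:
  "normed_cat X \<Longrightarrow> normed_cat Y \<Longrightarrow> normed_functor X Y F \<Longrightarrow>
    normed_nat_trans X Y F F (restrict (\<lambda>x. ide Y (fo F x)) (obj X))"
  by (rule normed_nat_transI) (simp_all add: nrm_ide)

lemma normed_nat_trans_vcomp [simp]:
  assumes "normed_cat X" "normed_cat Y" "normed_nat_trans X Y F G \<alpha>" "normed_nat_trans X Y G H \<beta>"
  shows "normed_nat_trans X Y F H (restrict (\<lambda>x. cmp Y (\<beta> x) (\<alpha> x)) (obj X))"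
proof -
  note facts = assms normed_nat_trans_functors[OF assms(3)] normed_nat_trans_functors[OF assms(4)]
  show ?thesis
  proof (rule normed_nat_transI)
  fix f assume f: "f \<in> arr X"
  have "cmp Y (cmp Y (\<beta> (tgt X f)) (\<alpha> (tgt X f))) (fa F f) =
      cmp Y (\<beta> (tgt X f)) (cmp Y (fa G f) (\<alpha> (src X f)))"
    using facts f by (simp add: category_assoc normed_nat_trans_natural[OF assms(3)])
  also have "\<dots> = cmp Y (cmp Y (\<beta> (tgt X f)) (fa G f)) (\<alpha> (src X f))"
    using facts f by (simp add: category_assoc)
  also have "\<dots> = cmp Y (fa H f) (cmp Y (\<beta> (src X f)) (\<alpha> (src X f)))"
    using facts normed_nat_trans_natural[OF assms(4) f] f by (simp flip: category_assoc)
  finally show "cmp Y (cmp Y (\<beta> (tgt X f)) (\<alpha> (tgt X f))) (fa F f) =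
      cmp Y (fa H f) (cmp Y (\<beta> (src X f)) (\<alpha> (src X f)))" .
next
  fix x assume "x \<in> obj X"
  then show "1 \<le> nrm Y (cmp Y (\<beta> x) (\<alpha> x))"
    using facts by (auto intro!: order_trans[OF quantale_one_le_mult nrm_cmp])
qed (use facts in simp_all)
qed

text \<open>Naturality is the pasting of \<open>G\<close> applied to the square of \<alpha> with the
  square of \<beta> at \<open>fa F' f\<close>. For the norm, \<open>G\<close> keeps \<open>1\<close>
  below the norm of the image of \<open>\<alpha> x\<close>, and the product of two values above
  \<open>1\<close> lies below the norm of the composite.\<close>

lemma normed_nat_trans_hcomp [simp]:
  assumes "normed_cat X" "normed_cat Y" "normed_cat Z"
    and "normed_nat_trans X Y F F' \<alpha>" "normed_nat_trans Y Z G G' \<beta>"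
  shows "normed_nat_trans X Z
    (mk_ftr X (\<lambda>x. fo G (fo F x)) (\<lambda>f. fa G (fa F f)))
    (mk_ftr X (\<lambda>x. fo G' (fo F' x)) (\<lambda>f. fa G' (fa F' f)))
    (restrict (\<lambda>x. cmp Z (\<beta> (fo F' x)) (fa G (\<alpha> x))) (obj X))"
proof -
  note facts = assms normed_nat_trans_functors[OF assms(4)] normed_nat_trans_functors[OF assms(5)]
  show ?thesis
  proof (rule normed_nat_transI)
    fix f assume f: "f \<in> arr X"
    have G\<alpha>: "cmp Z (fa G (\<alpha> (tgt X f))) (fa G (fa F f)) = cmp Z (fa G (fa F' f)) (fa G (\<alpha> (src X f)))"
      using arg_cong[OF normed_nat_trans_natural[OF assms(4) f], of "fa G"] facts f by simp
    have \<beta>: "cmp Z (\<beta> (fo F' (tgt X f))) (fa G (fa F' f)) = cmp Z (fa G' (fa F' f)) (\<beta> (fo F' (src X f)))"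
      using normed_nat_trans_natural[OF assms(5), of "fa F' f"] facts f by simp
    have "cmp Z (cmp Z (\<beta> (fo F' (tgt X f))) (fa G (\<alpha> (tgt X f)))) (fa G (fa F f)) =
        cmp Z (\<beta> (fo F' (tgt X f))) (cmp Z (fa G (fa F' f)) (fa G (\<alpha> (src X f))))"
      using facts f by (simp add: category_assoc G\<alpha>)
    also have "\<dots> = cmp Z (cmp Z (\<beta> (fo F' (tgt X f))) (fa G (fa F' f))) (fa G (\<alpha> (src X f)))"
      using facts f by (simp add: category_assoc)
    also have "\<dots> = cmp Z (fa G' (fa F' f)) (cmp Z (\<beta> (fo F' (src X f))) (fa G (\<alpha> (src X f))))"
      using facts f by (simp add: category_assoc \<beta>)
    finally show "cmp Z (cmp Z (\<beta> (fo F' (tgt X f))) (fa G (\<alpha> (tgt X f))))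
        (fa (mk_ftr X (\<lambda>x. fo G (fo F x)) (\<lambda>f. fa G (fa F f))) f) =
      cmp Z (fa (mk_ftr X (\<lambda>x. fo G' (fo F' x)) (\<lambda>f. fa G' (fa F' f))) f)
        (cmp Z (\<beta> (fo F' (src X f))) (fa G (\<alpha> (src X f))))"
      using facts f by simp
  next
    fix x assume x: "x \<in> obj X"
    have "1 \<le> nrm Z (fa G (\<alpha> x))"
      by (rule order_trans[OF normed_nat_trans_simps(4)[OF assms(4)] normed_functor_simps(6)]) (use facts x in simp_all)
    then show "1 \<le> nrm Z (cmp Z (\<beta> (fo F' x)) (fa G (\<alpha> x)))"
      using facts x by (auto intro!: order_trans[OF quantale_one_le_mult nrm_cmp])
  qed (use facts in simp_all)
qed

lemma category_NCat_vert: "category NCat_vert"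
  unfolding category_def by (auto simp: in_homset category_assoc)

text \<open>The two middle factors are exchanged by naturality of \<beta> at the component
  \<open>\<alpha>' x\<close>; the rest is associativity.\<close>

lemma interchange_NCat:
  assumes "normed_cat X" "normed_cat Y" "normed_cat Z"
    and \<alpha>: "normed_nat_trans X Y F F' \<alpha>" and \<alpha>': "normed_nat_trans X Y F' F'' \<alpha>'"
    and \<beta>: "normed_nat_trans Y Z G G' \<beta>" and \<beta>': "normed_nat_trans Y Z G' G'' \<beta>'"
    and x: "x \<in> obj X"
  shows "cmp Z (cmp Z (\<beta>' (fo F'' x)) (\<beta> (fo F'' x))) (cmp Z (fa G (\<alpha>' x)) (fa G (\<alpha> x))) =
    cmp Z (cmp Z (\<beta>' (fo F'' x)) (fa G' (\<alpha>' x))) (cmp Z (\<beta> (fo F' x)) (fa G (\<alpha> x)))"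
proof -
  note facts = assms normed_nat_trans_functors[OF \<alpha>] normed_nat_trans_functors[OF \<beta>]
    normed_nat_trans_functors[OF \<alpha>'] normed_nat_trans_functors[OF \<beta>']
  have "cmp Z (\<beta> (fo F'' x)) (fa G (\<alpha>' x)) = cmp Z (fa G' (\<alpha>' x)) (\<beta> (fo F' x))"
    using normed_nat_trans_natural[OF \<beta>, of "\<alpha>' x"] facts by simp
  then have "cmp Z (cmp Z (\<beta> (fo F'' x)) (fa G (\<alpha>' x))) (fa G (\<alpha> x)) =
      cmp Z (cmp Z (fa G' (\<alpha>' x)) (\<beta> (fo F' x))) (fa G (\<alpha> x))" by simp
  then show ?thesis using facts by (simp add: category_assoc)
qed

lemma two_category_NCat: "two_category NCat"
  unfolding two_category_def
  apply (simp add: category_NCat_vert in_homset)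
  apply (intro conjI allI impI)
  \<comment> \<open>Associativity is left to a second pass, so that it does not rebracket composites
    before the interchange law has matched them.\<close>
  apply (simp_all add: interchange_NCat normed_functor_ide)
  apply (simp_all add: category_assoc)
  done

section \<open>The tensor product of normed categories\<close>

lemma mk_ncat_simps:
  "obj (mk_ncat Ob Ar s t i c n) = Ob"
  "arr (mk_ncat Ob Ar s t i c n) = Ar"
  "f \<in> Ar \<Longrightarrow> src (mk_ncat Ob Ar s t i c n) f = s f"
  "f \<in> Ar \<Longrightarrow> tgt (mk_ncat Ob Ar s t i c n) f = t f"
  "x \<in> Ob \<Longrightarrow> ide (mk_ncat Ob Ar s t i c n) x = i x"
  "f \<in> Ar \<Longrightarrow> g \<in> Ar \<Longrightarrow> t f = s g \<Longrightarrow> cmp (mk_ncat Ob Ar s t i c n) g f = c g f"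
  "f \<in> Ar \<Longrightarrow> nrm (mk_ncat Ob Ar s t i c n) f = n f"
  by (simp_all add: mk_ncat_def)

text \<open>The axioms are asked of the raw maps on the carriers, since \<open>mk_ncat\<close> makes
  them extensional itself. Bounded quantifiers let the simplifier split members of products into
  pairs.\<close>

lemma normed_cat_mk_ncatI:
  assumes "small Ob" "small Ar"
    and "\<forall>f\<in>Ar. s f \<in> Ob \<and> t f \<in> Ob \<and> c f (i (s f)) = f \<and> c (i (t f)) f = f"
    and "\<forall>x\<in>Ob. i x \<in> Ar \<and> s (i x) = x \<and> t (i x) = x \<and> 1 \<le> n (i x)"
    and "\<forall>f\<in>Ar. \<forall>g\<in>Ar. t f = s g \<longrightarrow>
      c g f \<in> Ar \<and> s (c g f) = s f \<and> t (c g f) = t g \<and> n f * n g \<le> n (c g f)"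
    and "\<forall>f\<in>Ar. \<forall>g\<in>Ar. \<forall>h\<in>Ar. t f = s g \<longrightarrow> t g = s h \<longrightarrow> c h (c g f) = c (c h g) f"
  shows "normed_cat (mk_ncat Ob Ar s t i c n)"
proof -
  let ?C = "mk_ncat Ob Ar s t i c n"
  have "category ?C"
    by (rule categoryI) (simp_all add: mk_ncat_simps assms)
  moreover have "extensional_cat ?C"
    unfolding extensional_cat_def mk_ncat_def by auto
  ultimately show ?thesis
    unfolding normed_cat_def small_cat_def
    by (simp add: mk_ncat_simps assms) (simp add: mk_ncat_def)
qed

text \<open>Variant of \<open>normed_functor_mk_ftrI\<close> with bounded quantifiers, which rules
  such as \<open>ball_utimes\<close> and \<open>ball_arr_nhom\<close> unfold into pairs and
  codes.\<close>

lemma normed_functor_mk_ftr_ballI: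
  assumes "category X" "category Y" "\<forall>x\<in>obj X. f x \<in> obj Y"
    and "\<forall>a\<in>arr X. g a \<in> arr Y \<and> src Y (g a) = f (src X a) \<and> tgt Y (g a) = f (tgt X a) \<and>
      nrm X a \<le> nrm Y (g a)"
    and "\<forall>x\<in>obj X. g (ide X x) = ide Y (f x)"
    and "\<forall>a\<in>arr X. \<forall>b\<in>arr X. tgt X a = src X b \<longrightarrow> g (cmp X b a) = cmp Y (g b) (g a)"
  shows "normed_functor X Y (mk_ftr X f g)"
  by (rule normed_functor_mk_ftrI) (use assms in simp_all)

lemma ntensor_simps [simp]:
  "obj (ntensor X Y) = utimes (obj X) (obj Y)"
  "arr (ntensor X Y) = utimes (arr X) (arr Y)"
  "f \<in> arr X \<Longrightarrow> g \<in> arr Y \<Longrightarrow> src (ntensor X Y) (upair f g) = upair (src X f) (src Y g)"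
  "f \<in> arr X \<Longrightarrow> g \<in> arr Y \<Longrightarrow> tgt (ntensor X Y) (upair f g) = upair (tgt X f) (tgt Y g)"
  "x \<in> obj X \<Longrightarrow> y \<in> obj Y \<Longrightarrow> ide (ntensor X Y) (upair x y) = upair (ide X x) (ide Y y)"
  "f \<in> arr X \<Longrightarrow> f' \<in> arr X \<Longrightarrow> tgt X f = src X f' \<Longrightarrow>
    g \<in> arr Y \<Longrightarrow> g' \<in> arr Y \<Longrightarrow> tgt Y g = src Y g' \<Longrightarrow>
    cmp (ntensor X Y) (upair f' g') (upair f g) = upair (cmp X f' f) (cmp Y g' g)"
  "f \<in> arr X \<Longrightarrow> g \<in> arr Y \<Longrightarrow> nrm (ntensor X Y) (upair f g) = nrm X f * nrm Y g"
  by (simp_all add: ntensor_def mk_ncat_simps)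

text \<open>Commutativity of the quantale lets the product of the norms of two pairs be regrouped by
  coordinates, before the composition inequality is applied in each factor.\<close>

lemma normed_cat_ntensor [simp]:
  assumes "normed_cat X" "normed_cat Y"
  shows "normed_cat (ntensor X Y)"
proof -
  have "nrm X f * nrm Y g * (nrm X f' * nrm Y g') \<le> nrm X (cmp X f' f) * nrm Y (cmp Y g' g)"
    if "f \<in> arr X" "f' \<in> arr X" "tgt X f = src X f'" "g \<in> arr Y" "g' \<in> arr Y" "tgt Y g = src Y g'"
    for f f' g g'
    using quantale_mult_mono[OF nrm_cmp[of X f f'] nrm_cmp[of Y g g']] assms that
    by (simp add: mult_ac)
  then show ?thesis
    unfolding ntensor_def
    by (intro normed_cat_mk_ncatI small_utimes)
      (use assms in \<open>simp_all add: category_assoc quantale_one_le_mult nrm_ide\<close>)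
qed

lemma nunit_simps [simp]:
  "obj nunit = {upoint}" "arr nunit = {upoint}" "src nunit upoint = upoint" "tgt nunit upoint = upoint"
  "ide nunit upoint = upoint" "cmp nunit upoint upoint = upoint" "nrm nunit upoint = 1"
  by (simp_all add: nunit_def mk_ncat_simps)

lemma normed_cat_nunit [simp]: "normed_cat nunit"
  unfolding nunit_def by (rule normed_cat_mk_ncatI) (simp_all add: small_singleton)

lemma normed_functor_ntensor [simp]:
  "normed_cat X \<Longrightarrow> normed_cat Y \<Longrightarrow> normed_cat X' \<Longrightarrow> normed_cat Y' \<Longrightarrow>
    normed_functor X X' F \<Longrightarrow> normed_functor Y Y' G \<Longrightarrow>
    normed_functor (ntensor X Y) (ntensor X' Y')
      (mk_ftr (ntensor X Y) (umap (fo F) (fo G)) (umap (fa F) (fa G)))"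
  by (rule normed_functor_mk_ftr_ballI) (simp_all add: normed_functor_ide quantale_mult_mono)

lemma normed_functor_reassoc [simp]:
  "normed_cat X \<Longrightarrow> normed_cat Y \<Longrightarrow> normed_cat Z \<Longrightarrow>
    normed_functor (ntensor (ntensor X Y) Z) (ntensor X (ntensor Y Z))
      (mk_ftr (ntensor (ntensor X Y) Z) reassoc reassoc)"
  by (rule normed_functor_mk_ftr_ballI) (simp_all add: mult.assoc)

lemma normed_functor_usnd [simp]:
  "normed_cat X \<Longrightarrow> normed_functor (ntensor nunit X) X (mk_ftr (ntensor nunit X) usnd usnd)"
  by (rule normed_functor_mk_ftr_ballI) simp_all

lemma normed_functor_ufst [simp]:
  "normed_cat X \<Longrightarrow> normed_functor (ntensor X nunit) X (mk_ftr (ntensor X nunit) ufst ufst)"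
  by (rule normed_functor_mk_ftr_ballI) simp_all

lemma normed_functor_uswap [simp]:
  "normed_cat X \<Longrightarrow> normed_cat Y \<Longrightarrow>
    normed_functor (ntensor X Y) (ntensor Y X) (mk_ftr (ntensor X Y) uswap uswap)"
  by (rule normed_functor_mk_ftr_ballI) (simp_all add: mult.commute)

lemma ntensor_mor_Mor [simp]:
  "ntensor_mor (Mor X F X') (Mor Y G Y') =
    Mor (ntensor X Y) (mk_ftr (ntensor X Y) (umap (fo F) (fo G)) (umap (fa F) (fa G))) (ntensor X' Y')"
  by (simp add: ntensor_mor_def mk_nmor_def)

lemma NCat_smc_sel [simp]:
  "tenO NCat_smc = ntensor" "tenA NCat_smc = ntensor_mor" "unitO NCat_smc = nunit"
  "assoc NCat_smc X Y Z = Mor (ntensor (ntensor X Y) Z)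
    (mk_ftr (ntensor (ntensor X Y) Z) reassoc reassoc) (ntensor X (ntensor Y Z))"
  "lunit NCat_smc X = Mor (ntensor nunit X) (mk_ftr (ntensor nunit X) usnd usnd) X"
  "runit NCat_smc X = Mor (ntensor X nunit) (mk_ftr (ntensor X nunit) ufst ufst) X"
  "braid NCat_smc X Y = Mor (ntensor X Y) (mk_ftr (ntensor X Y) uswap uswap) (ntensor Y X)"
  "ihom NCat_smc = nhom" "evalA NCat_smc = neval" "tenC NCat_smc = ntensor_cell"
  by (simp_all add: NCat_smc_def mk_nmor_def)

lemma iso_NCatI:
  assumes "normed_cat X" "normed_cat Y" "normed_functor X Y F" "normed_functor Y X G"
    and "\<forall>x\<in>obj X. fo G (fo F x) = x" "\<forall>a\<in>arr X. fa G (fa F a) = a"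
    and "\<forall>y\<in>obj Y. fo F (fo G y) = y" "\<forall>b\<in>arr Y. fa F (fa G b) = b"
  shows "iso NCat (Mor X F Y)"
  unfolding iso_def using assms by (auto intro!: bexI[of _ "Mor Y G X"])

lemma tensor_functor_NCat: "tensor_functor NCat NCat_smc"
  unfolding tensor_functor_def by (simp add: in_homset) clarsimp

lemma constraints_iso_NCat:
  "constraints_iso (NCat :: ('u::universe, 'v::quantale) ncat_2cat) NCat_smc"
proof -
  have assoc: "iso NCat (assoc NCat_smc X Y Z)"
    if "normed_cat X" "normed_cat Y" "normed_cat Z" for X Y Z :: "('u, 'v) ncat"
  proof -
    \<comment> \<open>The inverse of \<open>reassoc\<close>; associativity of the tensor gives both
      bracketings the same norm, so this direction is normed too.\<close>
    let ?r = "\<lambda>p :: 'u. upair (upair (ufst p) (ufst (usnd p))) (usnd (usnd p))"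
    have "normed_functor (ntensor X (ntensor Y Z)) (ntensor (ntensor X Y) Z)
        (mk_ftr (ntensor X (ntensor Y Z)) ?r ?r)"
      by (rule normed_functor_mk_ftr_ballI) (use that in \<open>simp_all add: mult.assoc\<close>)
    then show ?thesis using that by (simp add: iso_NCatI)
  qed
  have lunit: "iso NCat (lunit NCat_smc X)" if "normed_cat X" for X :: "('u, 'v) ncat"
  proof -
    have "normed_functor X (ntensor nunit X) (mk_ftr X (upair upoint) (upair upoint))"
      by (rule normed_functor_mk_ftr_ballI) (use that in simp_all)
    then show ?thesis using that by (simp add: iso_NCatI)
  qed
  have runit: "iso NCat (runit NCat_smc X)" if "normed_cat X" for X :: "('u, 'v) ncat"
  proof -
    have "normed_functor X (ntensor X nunit) (mk_ftr X (\<lambda>x. upair x upoint) (\<lambda>x. upair x upoint))"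
      by (rule normed_functor_mk_ftr_ballI) (use that in simp_all)
    then show ?thesis using that by (simp add: iso_NCatI)
  qed
  have braid: "iso NCat (braid NCat_smc X Y)" if "normed_cat X" "normed_cat Y"
    for X Y :: "('u, 'v) ncat"
    using that iso_NCatI[of "ntensor X Y" "ntensor Y X" "mk_ftr (ntensor X Y) uswap uswap"
        "mk_ftr (ntensor Y X) uswap uswap"] by simp
  show ?thesis
    unfolding constraints_iso_def using assoc lunit runit braid by simp
qed

lemma constraints_natural_NCat: "constraints_natural NCat NCat_smc"
  unfolding constraints_natural_def by simp

text \<open>Both sides of each axiom are functors that rearrange nested pairs, so after
  extensionality every equation is an identity between pairs.\<close>

lemma constraints_coherent_NCat: "constraints_coherent NCat NCat_smc"
  unfolding constraints_coherent_def by simp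

section \<open>The tensor product on 2-cells\<close>

lemma ntensor_cell_Mor [simp]:
  "ntensor_cell (Mor (Mor X F X') \<alpha> (Mor X2 G X2')) (Mor (Mor Y H Y') \<beta> (Mor Y2 K Y2')) =
    Mor (ntensor_mor (Mor X F X') (Mor Y H Y'))
      (restrict (umap \<alpha> \<beta>) (obj (ntensor X Y)))
      (ntensor_mor (Mor X2 G X2') (Mor Y2 K Y2'))"
  by (simp add: ntensor_cell_def del: ntensor_mor_Mor ntensor_simps)

lemma normed_nat_trans_ntensor [simp]:
  assumes "normed_cat X" "normed_cat Y" "normed_cat X'" "normed_cat Y'"
    and \<alpha>: "normed_nat_trans X X' F G \<alpha>" and \<beta>: "normed_nat_trans Y Y' H K \<beta>"
  shows "normed_nat_trans (ntensor X Y) (ntensor X' Y')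
    (mk_ftr (ntensor X Y) (umap (fo F) (fo H)) (umap (fa F) (fa H)))
    (mk_ftr (ntensor X Y) (umap (fo G) (fo K)) (umap (fa G) (fa K)))
    (restrict (umap \<alpha> \<beta>) (utimes (obj X) (obj Y)))"
proof -
  note facts = assms normed_nat_trans_functors[OF \<alpha>] normed_nat_trans_functors[OF \<beta>]
  have "normed_nat_trans (ntensor X Y) (ntensor X' Y')
    (mk_ftr (ntensor X Y) (umap (fo F) (fo H)) (umap (fa F) (fa H)))
    (mk_ftr (ntensor X Y) (umap (fo G) (fo K)) (umap (fa G) (fa K)))
    (restrict (umap \<alpha> \<beta>) (obj (ntensor X Y)))"
    by (rule normed_nat_transI)
      (use facts in \<open>auto elim!: utimesE simp: normed_nat_trans_natural intro!: quantale_one_le_mult\<close>)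
  then show ?thesis by simp
qed

lemma tensor_2functor_NCat: "tensor_2functor NCat NCat_smc"
  unfolding tensor_2functor_def by (simp add: in_homset) (intro conjI allI impI; clarsimp)

lemma constraints_2natural_NCat: "constraints_2natural NCat NCat_smc"
  unfolding constraints_2natural_def by (simp add: normed_functor_ide)

section \<open>The internal hom of normed categories\<close>

text \<open>Arrows of the internal hom are all natural transformations, so no bound on the norms of
  the components is imposed, in contrast to \<open>normed_nat_trans\<close>. Off the objects
  \<alpha> is arbitrary, as the code of a transformation records only its values on
  \<open>obj X\<close>.\<close>

definition transformation ::
    "('u::universe, 'v::quantale) ncat \<Rightarrow> ('u, 'v) ncat \<Rightarrow> 'u smallftr \<Rightarrow> 'u smallftr \<Rightarrow> ('u \<Rightarrow> 'u) \<Rightarrow> bool"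
  where "transformation X Y F G \<alpha> \<longleftrightarrow>
    normed_functor X Y F \<and> normed_functor X Y G \<and> nat_trans X Y F G \<alpha>"

lemma transformation_simps [simp]:
  assumes "transformation X Y F G \<alpha>"
  shows "x \<in> obj X \<Longrightarrow> \<alpha> x \<in> arr Y"
    and "x \<in> obj X \<Longrightarrow> src Y (\<alpha> x) = fo F x"
    and "x \<in> obj X \<Longrightarrow> tgt Y (\<alpha> x) = fo G x"
  using assms unfolding transformation_def nat_trans_def homset_def by auto

lemma transformation_functors:
  assumes "transformation X Y F G \<alpha>"
  shows "normed_functor X Y F" "normed_functor X Y G"
  using assms unfolding transformation_def by auto

lemma transformation_natural:
  "transformation X Y F G \<alpha> \<Longrightarrow> f \<in> arr X \<Longrightarrow>
    cmp Y (\<alpha> (tgt X f)) (fa F f) = cmp Y (fa G f) (\<alpha> (src X f))"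
  unfolding transformation_def nat_trans_def by simp

lemma transformationI:
  assumes "normed_functor X Y F" "normed_functor X Y G"
    and "\<forall>x\<in>obj X. \<alpha> x \<in> arr Y \<and> src Y (\<alpha> x) = fo F x \<and> tgt Y (\<alpha> x) = fo G x"
    and "\<forall>f\<in>arr X. cmp Y (\<alpha> (tgt X f)) (fa F f) = cmp Y (fa G f) (\<alpha> (src X f))"
  shows "transformation X Y F G \<alpha>"
  using assms unfolding transformation_def nat_trans_def homset_def
  by (simp add: normed_functor_is_functor)

lemma transformation_id:
  "normed_cat X \<Longrightarrow> normed_cat Y \<Longrightarrow> normed_functor X Y F \<Longrightarrow>
    transformation X Y F F (\<lambda>x. ide Y (fo F x))"
  by (rule transformationI) simp_all

lemma transformation_comp:
  assumes "normed_cat X" "normed_cat Y" "transformation X Y F G \<alpha>" "transformation X Y G H \<beta>"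
  shows "transformation X Y F H (\<lambda>x. cmp Y (\<beta> x) (\<alpha> x))"
proof (rule transformationI)
  note facts = assms transformation_functors[OF assms(3)] transformation_functors[OF assms(4)]
  show "normed_functor X Y F" "normed_functor X Y H" using facts by simp_all
  show "\<forall>x\<in>obj X. cmp Y (\<beta> x) (\<alpha> x) \<in> arr Y \<and> src Y (cmp Y (\<beta> x) (\<alpha> x)) = fo F x \<and>
      tgt Y (cmp Y (\<beta> x) (\<alpha> x)) = fo H x"
    using facts by simp
  show "\<forall>f\<in>arr X. cmp Y (cmp Y (\<beta> (tgt X f)) (\<alpha> (tgt X f))) (fa F f) =
      cmp Y (fa H f) (cmp Y (\<beta> (src X f)) (\<alpha> (src X f)))"
  proof
    fix f assume f: "f \<in> arr X"
    have "cmp Y (cmp Y (\<beta> (tgt X f)) (\<alpha> (tgt X f))) (fa F f) =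
        cmp Y (\<beta> (tgt X f)) (cmp Y (fa G f) (\<alpha> (src X f)))"
      using facts f by (simp add: category_assoc transformation_natural[OF assms(3)])
    also have "\<dots> = cmp Y (cmp Y (\<beta> (tgt X f)) (fa G f)) (\<alpha> (src X f))"
      using facts f by (simp add: category_assoc)
    also have "\<dots> = cmp Y (fa H f) (cmp Y (\<beta> (src X f)) (\<alpha> (src X f)))"
      using facts f by (simp add: category_assoc transformation_natural[OF assms(4)])
    finally show "cmp Y (cmp Y (\<beta> (tgt X f)) (\<alpha> (tgt X f))) (fa F f) =
        cmp Y (fa H f) (cmp Y (\<beta> (src X f)) (\<alpha> (src X f)))" .
  qed
qed

lemma code_ftr_simps [simp]:
  "normed_cat X \<Longrightarrow> x \<in> obj X \<Longrightarrow> uapp (ufst (code_ftr X F)) x = fo F x"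
  "normed_cat X \<Longrightarrow> a \<in> arr X \<Longrightarrow> uapp (usnd (code_ftr X F)) a = fa F a"
  by (simp_all add: code_ftr_def)

lemma code_ftr_eq_iff:
  "normed_cat X \<Longrightarrow> code_ftr X F = code_ftr X G \<longleftrightarrow>
    (\<forall>x\<in>obj X. fo F x = fo G x) \<and> (\<forall>a\<in>arr X. fa F a = fa G a)"
  by (simp add: code_ftr_def ulam_eq_iff)

text \<open>Extensional functors are determined by their values on the carriers; composable codes
  therefore share literally the same functor in the middle.\<close>

lemma code_ftr_inject:
  "normed_cat X \<Longrightarrow> normed_functor X Y F \<Longrightarrow> normed_functor X Y G \<Longrightarrow>
    code_ftr X F = code_ftr X G \<longleftrightarrow> F = G"
  using normed_functor_ext[of X Y F Y G] code_ftr_eq_iff[of X F G] by blast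

lemma code_nat_simps [simp]:
  "ufst (ufst (code_nat X F G \<alpha>)) = code_ftr X F"
  "usnd (ufst (code_nat X F G \<alpha>)) = code_ftr X G"
  "normed_cat X \<Longrightarrow> x \<in> obj X \<Longrightarrow> uapp (usnd (code_nat X F G \<alpha>)) x = \<alpha> x"
  by (simp_all add: code_nat_def)

lemma code_nat_eq_iff:
  "normed_cat X \<Longrightarrow> code_nat X F G \<alpha> = code_nat X F' G' \<alpha>' \<longleftrightarrow>
    code_ftr X F = code_ftr X F' \<and> code_ftr X G = code_ftr X G' \<and> (\<forall>x\<in>obj X. \<alpha> x = \<alpha>' x)"
  by (auto simp add: code_nat_def ulam_eq_iff)

lemma nhom_raw:
  "nhom X Y = mk_ncat {code_ftr X F | F. normed_functor X Y F}
     {code_nat X F G \<alpha> | F G \<alpha>. transformation X Y F G \<alpha>}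
     (\<lambda>a. ufst (ufst a)) (\<lambda>a. usnd (ufst a))
     (\<lambda>F. upair (upair F F) (ulam (obj X) (\<lambda>x. ide Y (uapp (ufst F) x))))
     (\<lambda>b a. upair (upair (ufst (ufst a)) (usnd (ufst b)))
              (ulam (obj X) (\<lambda>x. cmp Y (uapp (usnd b) x) (uapp (usnd a) x))))
     (\<lambda>a. INF x\<in>obj X. nrm Y (uapp (usnd a) x))"
  unfolding nhom_def transformation_def by (rule refl)

text \<open>Together with \<open>code_composite\<close>, this rewrites the raw operations of
  \<open>nhom\<close> into codes, so that the axioms can be checked on transformations instead of
  graphs.\<close>

lemma code_identity:
  "normed_cat X \<Longrightarrow>
    upair (upair (code_ftr X F) (code_ftr X F)) (ulam (obj X) (\<lambda>x. ide Y (uapp (ufst (code_ftr X F)) x))) =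
    code_nat X F F (\<lambda>x. ide Y (fo F x))"
  by (simp add: code_nat_def ulam_eq_iff)

lemma code_composite:
  "normed_cat X \<Longrightarrow>
    upair (upair (ufst (ufst (code_nat X F G \<alpha>))) (usnd (ufst (code_nat X G' H \<beta>))))
      (ulam (obj X) (\<lambda>x. cmp Y (uapp (usnd (code_nat X G' H \<beta>)) x) (uapp (usnd (code_nat X F G \<alpha>)) x))) =
    code_nat X F H (\<lambda>x. cmp Y (\<beta> x) (\<alpha> x))"
  by (simp add: code_nat_def ulam_eq_iff)

lemma obj_nhom: "obj (nhom X Y) = {code_ftr X F | F. normed_functor X Y F}"
  and arr_nhom: "arr (nhom X Y) = {code_nat X F G \<alpha> | F G \<alpha>. transformation X Y F G \<alpha>}"
  by (simp_all add: nhom_raw mk_ncat_simps)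

lemma code_ftr_in_nhom [simp]: "normed_functor X Y F \<Longrightarrow> code_ftr X F \<in> obj (nhom X Y)"
  by (auto simp: obj_nhom)

lemma code_nat_in_nhom [simp]: "transformation X Y F G \<alpha> \<Longrightarrow> code_nat X F G \<alpha> \<in> arr (nhom X Y)"
  by (auto simp: arr_nhom)

lemma obj_nhomE:
  assumes "p \<in> obj (nhom X Y)"
  obtains F where "p = code_ftr X F" "normed_functor X Y F"
  using assms by (auto simp: obj_nhom)

lemma arr_nhomE:
  assumes "p \<in> arr (nhom X Y)"
  obtains F G \<alpha> where "p = code_nat X F G \<alpha>" "normed_functor X Y F" "normed_functor X Y G"
    "transformation X Y F G \<alpha>"
  using assms by (auto simp: arr_nhom transformation_def)

lemma ball_obj_nhom [simp]:
  "(\<forall>p\<in>obj (nhom X Y). P p) \<longleftrightarrow> (\<forall>F. normed_functor X Y F \<longrightarrow> P (code_ftr X F))"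
  by (auto simp: obj_nhom)

lemma ball_arr_nhom [simp]:
  "(\<forall>p\<in>arr (nhom X Y). P p) \<longleftrightarrow>
    (\<forall>F G \<alpha>. normed_functor X Y F \<longrightarrow> normed_functor X Y G \<longrightarrow> transformation X Y F G \<alpha> \<longrightarrow>
      P (code_nat X F G \<alpha>))"
  by (auto simp: arr_nhom transformation_def)

text \<open>Composability in the fourth rule is stated for the codes of the middle functors, since
  this is the form in which \<open>src\<close> and \<open>tgt\<close> of \<open>nhom\<close> provide
  it.\<close>

lemma nhom_simps [simp]:
  assumes "normed_cat X"
  shows "transformation X Y F G \<alpha> \<Longrightarrow> src (nhom X Y) (code_nat X F G \<alpha>) = code_ftr X F"
    and "transformation X Y F G \<alpha> \<Longrightarrow> tgt (nhom X Y) (code_nat X F G \<alpha>) = code_ftr X G"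
    and "normed_functor X Y F \<Longrightarrow> ide (nhom X Y) (code_ftr X F) = code_nat X F F (\<lambda>x. ide Y (fo F x))"
    and "transformation X Y F G \<alpha> \<Longrightarrow> transformation X Y G' H \<beta> \<Longrightarrow> code_ftr X G = code_ftr X G' \<Longrightarrow>
      cmp (nhom X Y) (code_nat X G' H \<beta>) (code_nat X F G \<alpha>) = code_nat X F H (\<lambda>x. cmp Y (\<beta> x) (\<alpha> x))"
    and "transformation X Y F G \<alpha> \<Longrightarrow> nrm (nhom X Y) (code_nat X F G \<alpha>) = (INF x\<in>obj X. nrm Y (\<alpha> x))"
proof -
  show "src (nhom X Y) (code_nat X F G \<alpha>) = code_ftr X F" if "transformation X Y F G \<alpha>"
    unfolding nhom_raw by (subst mk_ncat_simps) (use that in auto)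
  show "tgt (nhom X Y) (code_nat X F G \<alpha>) = code_ftr X G" if "transformation X Y F G \<alpha>"
    unfolding nhom_raw by (subst mk_ncat_simps) (use that in auto)
  show "ide (nhom X Y) (code_ftr X F) = code_nat X F F (\<lambda>x. ide Y (fo F x))" if "normed_functor X Y F"
    unfolding nhom_raw by (subst mk_ncat_simps) (use that code_identity[OF assms] in auto)
  show "cmp (nhom X Y) (code_nat X G' H \<beta>) (code_nat X F G \<alpha>) = code_nat X F H (\<lambda>x. cmp Y (\<beta> x) (\<alpha> x))"
    if "transformation X Y F G \<alpha>" "transformation X Y G' H \<beta>" "code_ftr X G = code_ftr X G'"
  proof -
    have "cmp (nhom X Y) (code_nat X G' H \<beta>) (code_nat X F G \<alpha>) =
      upair (upair (ufst (ufst (code_nat X F G \<alpha>))) (usnd (ufst (code_nat X G' H \<beta>))))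
      (ulam (obj X) (\<lambda>x. cmp Y (uapp (usnd (code_nat X G' H \<beta>)) x) (uapp (usnd (code_nat X F G \<alpha>)) x)))"
      unfolding nhom_raw by (rule mk_ncat_simps(6)) (use that in auto)
    then show ?thesis by (simp only: code_composite[OF assms])
  qed
  show "nrm (nhom X Y) (code_nat X F G \<alpha>) = (INF x\<in>obj X. nrm Y (\<alpha> x))" if "transformation X Y F G \<alpha>"
    unfolding nhom_raw by (subst mk_ncat_simps) (use that assms in \<open>auto intro!: INF_cong\<close>)
qed

text \<open>Functor codes are pairs of graphs between small sets and transformation codes add a
  graph of components, so both carriers are small. The laws hold pointwise in \<open>Y\<close>, and
  the norm inequalities pass to infima.\<close>

lemma normed_cat_nhom [simp]:
  assumes X: "normed_cat X" and Y: "normed_cat Y"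
  shows "normed_cat (nhom X Y)"
proof -
  let ?O = "{code_ftr X F | F. normed_functor X Y F}"
  let ?A = "{code_nat X F G \<alpha> | F G \<alpha>. transformation X Y F G \<alpha>}"
  let ?i = "\<lambda>F. upair (upair F F) (ulam (obj X) (\<lambda>x. ide Y (uapp (ufst F) x)))"
  let ?c = "\<lambda>b a. upair (upair (ufst (ufst a)) (usnd (ufst b)))
    (ulam (obj X) (\<lambda>x. cmp Y (uapp (usnd b) x) (uapp (usnd a) x)))"
  let ?n = "\<lambda>a. INF x\<in>obj X. nrm Y (uapp (usnd a) x)"
  have O: "(\<forall>p\<in>?O. P p) \<longleftrightarrow> (\<forall>F. normed_functor X Y F \<longrightarrow> P (code_ftr X F))" for P by auto
  have A: "(\<forall>p\<in>?A. P p) \<longleftrightarrow> (\<forall>F G \<alpha>. normed_functor X Y F \<longrightarrow> normed_functor X Y G \<longrightarrow>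
      transformation X Y F G \<alpha> \<longrightarrow> P (code_nat X F G \<alpha>))" for P
    by (auto simp: transformation_def)
  have smallO: "small ?O"
  proof (rule small_subset)
    show "small (utimes {ulam (obj X) f | f. f ` obj X \<subseteq> obj Y} {ulam (arr X) f | f. f ` arr X \<subseteq> arr Y})"
      by (intro small_utimes small_ulams normed_cat_small X Y)
    show "?O \<subseteq> utimes {ulam (obj X) f | f. f ` obj X \<subseteq> obj Y} {ulam (arr X) f | f. f ` arr X \<subseteq> arr Y}"
      by (fastforce simp: code_ftr_def)
  qed
  have smallA: "small ?A"
  proof (rule small_subset)
    show "small (utimes (utimes ?O ?O) {ulam (obj X) f | f. f ` obj X \<subseteq> arr Y})"
      by (intro small_utimes small_ulams normed_cat_small X Y smallO)
    show "?A \<subseteq> utimes (utimes ?O ?O) {ulam (obj X) f | f. f ` obj X \<subseteq> arr Y}"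
    proof
      fix p assume "p \<in> ?A"
      then obtain F G \<alpha> where p: "p = code_nat X F G \<alpha>" and t: "transformation X Y F G \<alpha>" by blast
      have "\<alpha> ` obj X \<subseteq> arr Y" using t by auto
      then show "p \<in> utimes (utimes ?O ?O) {ulam (obj X) f | f. f ` obj X \<subseteq> arr Y}"
        using transformation_functors[OF t] unfolding p code_nat_def by auto
    qed
  qed
  show ?thesis
    unfolding nhom_raw
  proof (rule normed_cat_mk_ncatI[OF smallO smallA])
    show "\<forall>f\<in>?A. ufst (ufst f) \<in> ?O \<and> usnd (ufst f) \<in> ?O \<and>
        ?c f (?i (ufst (ufst f))) = f \<and> ?c (?i (usnd (ufst f))) f = f"
      unfolding A
    proof (intro allI impI)
      fix F G \<alpha> assume FG: "normed_functor X Y F" "normed_functor X Y G" and t: "transformation X Y F G \<alpha>"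
      let ?a = "code_nat X F G \<alpha>"
      have "?c ?a (?i (ufst (ufst ?a))) = ?a" "?c (?i (usnd (ufst ?a))) ?a = ?a"
        unfolding code_nat_simps(1,2) code_identity[OF X] code_composite[OF X]
        using X Y FG t by (simp_all add: code_nat_def ulam_eq_iff)
      then show "ufst (ufst ?a) \<in> ?O \<and> usnd (ufst ?a) \<in> ?O \<and>
          ?c ?a (?i (ufst (ufst ?a))) = ?a \<and> ?c (?i (usnd (ufst ?a))) ?a = ?a"
        using FG by auto
    qed
    show "\<forall>x\<in>?O. ?i x \<in> ?A \<and> ufst (ufst (?i x)) = x \<and> usnd (ufst (?i x)) = x \<and> 1 \<le> ?n (?i x)"
      unfolding O
    proof (intro allI impI)
      fix F assume F: "normed_functor X Y F"
      have "1 \<le> ?n (code_nat X F F (\<lambda>x. ide Y (fo F x)))"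
        using X Y F by (auto intro!: INF_greatest simp: nrm_ide)
      then show "?i (code_ftr X F) \<in> ?A \<and> ufst (ufst (?i (code_ftr X F))) = code_ftr X F \<and>
          usnd (ufst (?i (code_ftr X F))) = code_ftr X F \<and> 1 \<le> ?n (?i (code_ftr X F))"
        unfolding code_identity[OF X] using transformation_id[OF X Y F] by auto
    qed
    show "\<forall>f\<in>?A. \<forall>g\<in>?A. usnd (ufst f) = ufst (ufst g) \<longrightarrow>
        ?c g f \<in> ?A \<and> ufst (ufst (?c g f)) = ufst (ufst f) \<and> usnd (ufst (?c g f)) = usnd (ufst g) \<and>
        ?n f * ?n g \<le> ?n (?c g f)"
      unfolding A
    proof (intro allI impI)
      fix F G \<alpha> G' H \<beta>
      assume nf: "normed_functor X Y F" "normed_functor X Y G" "normed_functor X Y G'" "normed_functor X Y H"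
        and \<alpha>: "transformation X Y F G \<alpha>" and \<beta>: "transformation X Y G' H \<beta>"
        and eq: "usnd (ufst (code_nat X F G \<alpha>)) = ufst (ufst (code_nat X G' H \<beta>))"
      \<comment> \<open>Equal codes in the middle mean equal functors, so the two transformations
        compose.\<close>
      then have [simp]: "G' = G" using X by (simp add: code_ftr_inject)
      have "?n (code_nat X F G \<alpha>) * ?n (code_nat X G' H \<beta>) \<le> ?n (code_nat X F H (\<lambda>x. cmp Y (\<beta> x) (\<alpha> x)))"
        by (rule INF_mult_INF_le) (use X Y \<alpha> \<beta> in \<open>simp add: nrm_cmp\<close>)
      then show "?c (code_nat X G' H \<beta>) (code_nat X F G \<alpha>) \<in> ?A \<and>
          ufst (ufst (?c (code_nat X G' H \<beta>) (code_nat X F G \<alpha>))) = ufst (ufst (code_nat X F G \<alpha>)) \<and>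
          usnd (ufst (?c (code_nat X G' H \<beta>) (code_nat X F G \<alpha>))) = usnd (ufst (code_nat X G' H \<beta>)) \<and>
          ?n (code_nat X F G \<alpha>) * ?n (code_nat X G' H \<beta>) \<le> ?n (?c (code_nat X G' H \<beta>) (code_nat X F G \<alpha>))"
        unfolding code_composite[OF X] using transformation_comp[OF X Y \<alpha> \<beta>[simplified]] by auto
    qed
    show "\<forall>f\<in>?A. \<forall>g\<in>?A. \<forall>h\<in>?A. usnd (ufst f) = ufst (ufst g) \<longrightarrow> usnd (ufst g) = ufst (ufst h) \<longrightarrow>
        ?c h (?c g f) = ?c (?c h g) f"
      unfolding A
    proof (intro allI impI)
      fix F G \<alpha> G' H \<beta> H' K \<gamma>
      assume nf: "normed_functor X Y F" "normed_functor X Y G" "normed_functor X Y G'"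
          "normed_functor X Y H" "normed_functor X Y H'"
        and t: "transformation X Y F G \<alpha>" "transformation X Y G' H \<beta>" "transformation X Y H' K \<gamma>"
        and "usnd (ufst (code_nat X F G \<alpha>)) = ufst (ufst (code_nat X G' H \<beta>))"
        and "usnd (ufst (code_nat X G' H \<beta>)) = ufst (ufst (code_nat X H' K \<gamma>))"
      then have [simp]: "G' = G" "H' = H" using X by (simp_all add: code_ftr_inject)
      show "?c (code_nat X H' K \<gamma>) (?c (code_nat X G' H \<beta>) (code_nat X F G \<alpha>)) =
          ?c (?c (code_nat X H' K \<gamma>) (code_nat X G' H \<beta>)) (code_nat X F G \<alpha>)"
        unfolding code_composite[OF X]
        using X Y t by (simp add: code_nat_eq_iff category_assoc)
    qed
  qed
qed

section \<open>Evaluation\<close>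

definition eval_obj :: "'u::universe \<Rightarrow> 'u" where
  "eval_obj p = uapp (ufst (ufst p)) (usnd p)"

definition eval_arr :: "('u::universe, 'v::quantale) ncat \<Rightarrow> ('u, 'v) ncat \<Rightarrow> 'u \<Rightarrow> 'u" where
  "eval_arr X Y p = cmp Y (uapp (usnd (ufst p)) (tgt X (usnd p)))
                       (uapp (usnd (ufst (ufst (ufst p)))) (usnd p))"

lemma eval_simps [simp]:
  "normed_cat X \<Longrightarrow> x \<in> obj X \<Longrightarrow> eval_obj (upair (code_ftr X F) x) = fo F x"
  "normed_cat X \<Longrightarrow> f \<in> arr X \<Longrightarrow>
    eval_arr X Y (upair (code_nat X F G \<alpha>) f) = cmp Y (\<alpha> (tgt X f)) (fa F f)"
  by (simp_all add: eval_obj_def eval_arr_def)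

lemma neval_Mor [simp]:
  "neval X Y = Mor (ntensor (nhom X Y) X) (mk_ftr (ntensor (nhom X Y) X) eval_obj (eval_arr X Y)) Y"
  by (simp add: neval_def mk_nmor_def eval_obj_def [abs_def] eval_arr_def [abs_def])

text \<open>The norm of a transformation, being an infimum, lies below the norm of its component at
  the target of \<open>f\<close>, and \<open>F\<close> does not lower the norm of \<open>f\<close>;
  the composition inequality joins the two. Functoriality is naturality of the first transformation
  at the second arrow.\<close>

lemma normed_functor_eval [simp]:
  assumes X: "normed_cat X" and Y: "normed_cat Y"
  shows "normed_functor (ntensor (nhom X Y) X) Y
    (mk_ftr (ntensor (nhom X Y) X) eval_obj (eval_arr X Y))"
proof (rule normed_functor_mk_ftr_ballI)
  let ?T = "ntensor (nhom X Y) X"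
  show "category ?T" "category Y" using X Y by simp_all
  show "\<forall>p\<in>obj ?T. eval_obj p \<in> obj Y" using X Y by simp
  show "\<forall>p\<in>obj ?T. eval_arr X Y (ide ?T p) = ide Y (eval_obj p)"
    using X Y by (simp add: transformation_id normed_functor_ide)
  show "\<forall>a\<in>arr ?T. eval_arr X Y a \<in> arr Y \<and> src Y (eval_arr X Y a) = eval_obj (src ?T a) \<and>
      tgt Y (eval_arr X Y a) = eval_obj (tgt ?T a) \<and> nrm ?T a \<le> nrm Y (eval_arr X Y a)"
  proof -
    have "(INF x\<in>obj X. nrm Y (\<alpha> x)) * nrm X f \<le> nrm Y (cmp Y (\<alpha> (tgt X f)) (fa F f))"
      if "normed_functor X Y F" "transformation X Y F G \<alpha>" "f \<in> arr X" for F G \<alpha> f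
    proof -
      have "(INF x\<in>obj X. nrm Y (\<alpha> x)) * nrm X f \<le> nrm Y (\<alpha> (tgt X f)) * nrm Y (fa F f)"
        by (rule quantale_mult_mono) (use X that in \<open>auto intro!: INF_lower\<close>)
      \<comment> \<open>The composition inequality takes norms in the order in which the arrows are
        traversed, and \<open>fa F f\<close> comes first.\<close>
      also have "\<dots> = nrm Y (fa F f) * nrm Y (\<alpha> (tgt X f))" by (rule mult.commute)
      also have "\<dots> \<le> nrm Y (cmp Y (\<alpha> (tgt X f)) (fa F f))"
        by (rule nrm_cmp) (use X Y that in simp_all)
      finally show ?thesis .
    qed
    then show ?thesis using X Y by simp
  qed
  show "\<forall>a\<in>arr ?T. \<forall>b\<in>arr ?T. tgt ?T a = src ?T b \<longrightarrow>
      eval_arr X Y (cmp ?T b a) = cmp Y (eval_arr X Y b) (eval_arr X Y a)"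
  proof -
    have "cmp Y (cmp Y (\<beta> (tgt X g)) (\<alpha> (tgt X g))) (cmp Y (fa F g) (fa F f)) =
        cmp Y (cmp Y (\<beta> (tgt X g)) (fa G g)) (cmp Y (\<alpha> (tgt X f)) (fa F f))"
      if nf: "normed_functor X Y F" "normed_functor X Y G" "normed_functor X Y H"
        and \<alpha>: "transformation X Y F G \<alpha>" and \<beta>: "transformation X Y G H \<beta>"
        and fg: "f \<in> arr X" "g \<in> arr X" "tgt X f = src X g" for F G H \<alpha> \<beta> f g
    proof -
      have "cmp Y (\<alpha> (tgt X g)) (cmp Y (fa F g) (fa F f)) = cmp Y (cmp Y (\<alpha> (tgt X g)) (fa F g)) (fa F f)"
        using X Y nf \<alpha> \<beta> fg by (simp add: category_assoc)
      also have "\<dots> = cmp Y (fa G g) (cmp Y (\<alpha> (tgt X f)) (fa F f))"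
        using X Y nf \<alpha> \<beta> fg by (simp add: category_assoc transformation_natural[OF \<alpha>])
      finally show ?thesis using X Y nf \<alpha> \<beta> fg by (simp add: category_assoc)
    qed
    then show ?thesis
      using X Y by (auto simp: code_ftr_inject transformation_comp)
  qed
qed

section \<open>Currying functors\<close>

definition slice :: "('u::universe, 'v::quantale) ncat \<Rightarrow> ('u, 'v) ncat \<Rightarrow> 'u smallftr \<Rightarrow> 'u \<Rightarrow> 'u smallftr"
  where "slice X Y H x = mk_ftr Y (\<lambda>y. fo H (upair x y)) (\<lambda>g. fa H (upair (ide X x) g))"

lemma slice_simps [simp]:
  "y \<in> obj Y \<Longrightarrow> fo (slice X Y H x) y = fo H (upair x y)"
  "g \<in> arr Y \<Longrightarrow> fa (slice X Y H x) g = fa H (upair (ide X x) g)"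
  by (simp_all add: slice_def)

definition curry_ftr ::
    "('u::universe, 'v::quantale) ncat \<Rightarrow> ('u, 'v) ncat \<Rightarrow> 'u smallftr \<Rightarrow> 'u smallftr" where
  "curry_ftr X Y H = mk_ftr X (\<lambda>x. code_ftr Y (slice X Y H x))
     (\<lambda>f. code_nat Y (slice X Y H (src X f)) (slice X Y H (tgt X f)) (\<lambda>y. fa H (upair f (ide Y y))))"

text \<open>Used from left to right, this fuses a composite of images into the image of one pair, so
  that the laws for slices and curried functors follow from the unit laws of \<open>X\<close> and
  \<open>Y\<close>.\<close>

lemma tensor_functor_comp:
  assumes "normed_functor (ntensor X Y) Z H"
    and "f \<in> arr X" "f' \<in> arr X" "tgt X f = src X f'" "g \<in> arr Y" "g' \<in> arr Y" "tgt Y g = src Y g'"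
  shows "cmp Z (fa H (upair f' g')) (fa H (upair f g)) = fa H (upair (cmp X f' f) (cmp Y g' g))"
  using normed_functor_simps(5)[OF assms(1), of "upair f g" "upair f' g'"] assms by simp

lemma tensor_functor_simps:
  assumes "normed_functor (ntensor X Y) Z H"
  shows "x \<in> obj X \<Longrightarrow> y \<in> obj Y \<Longrightarrow> fo H (upair x y) \<in> obj Z"
    and "f \<in> arr X \<Longrightarrow> g \<in> arr Y \<Longrightarrow> fa H (upair f g) \<in> arr Z"
    and "f \<in> arr X \<Longrightarrow> g \<in> arr Y \<Longrightarrow> src Z (fa H (upair f g)) = fo H (upair (src X f) (src Y g))"
    and "f \<in> arr X \<Longrightarrow> g \<in> arr Y \<Longrightarrow> tgt Z (fa H (upair f g)) = fo H (upair (tgt X f) (tgt Y g))"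
    and "x \<in> obj X \<Longrightarrow> y \<in> obj Y \<Longrightarrow> fa H (upair (ide X x) (ide Y y)) = ide Z (fo H (upair x y))"
    and "f \<in> arr X \<Longrightarrow> g \<in> arr Y \<Longrightarrow> nrm X f * nrm Y g \<le> nrm Z (fa H (upair f g))"
  using assms normed_functor_ide[OF assms, of "upair x y"] normed_functor_simps(6)[OF assms, of "upair f g"]
  by simp_all

lemma normed_functor_slice [simp]:
  assumes "normed_cat X" "normed_cat Y" "normed_cat Z" "normed_functor (ntensor X Y) Z H" "x \<in> obj X"
  shows "normed_functor Y Z (slice X Y H x)"
proof -
  have "nrm Y g \<le> nrm Z (fa H (upair (ide X x) g))" if "g \<in> arr Y" for g
  proof -
    have "nrm Y g \<le> nrm X (ide X x) * nrm Y g"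
      by (rule quantale_le_one_mult) (use assms nrm_ide in blast)
    also have "\<dots> \<le> nrm Z (fa H (upair (ide X x) g))"
      using assms that tensor_functor_simps(6)[OF assms(4), of "ide X x" g] by simp
    finally show ?thesis .
  qed
  then show ?thesis
    unfolding slice_def
    by (intro normed_functor_mk_ftr_ballI)
      (use assms in \<open>simp_all add: tensor_functor_simps[OF assms(4)] tensor_functor_comp[OF assms(4)]\<close>)
qed

text \<open>Both paths of the naturality square at \<open>g\<close> fuse to \<open>H\<close> at the
  pair of \<open>f\<close> and \<open>g\<close>.\<close>

lemma transformation_slice:
  assumes "normed_cat X" "normed_cat Y" "normed_cat Z" "normed_functor (ntensor X Y) Z H" "f \<in> arr X"
  shows "transformation Y Z (slice X Y H (src X f)) (slice X Y H (tgt X f)) (\<lambda>y. fa H (upair f (ide Y y)))"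
  by (rule transformationI)
    (use assms in \<open>simp_all add: tensor_functor_simps[OF assms(4)] tensor_functor_comp[OF assms(4)]\<close>)

lemma normed_functor_curry [simp]:
  assumes "normed_cat X" "normed_cat Y" "normed_cat Z" "normed_functor (ntensor X Y) Z H"
  shows "normed_functor X (nhom Y Z) (curry_ftr X Y H)"
proof -
  note t = transformation_slice[OF assms]
  have nrm: "nrm X f \<le> (INF y\<in>obj Y. nrm Z (fa H (upair f (ide Y y))))" if "f \<in> arr X" for f
  proof (rule INF_greatest)
    fix y assume "y \<in> obj Y"
    then have "nrm X f \<le> nrm X f * nrm Y (ide Y y)"
      by (intro quantale_le_mult_one nrm_ide assms)
    also have "\<dots> \<le> nrm Z (fa H (upair f (ide Y y)))"
      using assms that \<open>y \<in> obj Y\<close> tensor_functor_simps(6)[OF assms(4), of f "ide Y y"] by simp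
    finally show "nrm X f \<le> nrm Z (fa H (upair f (ide Y y)))" .
  qed
  have id: "code_nat Y (slice X Y H x) (slice X Y H x) (\<lambda>y. fa H (upair (ide X x) (ide Y y))) =
      ide (nhom Y Z) (code_ftr Y (slice X Y H x))" if "x \<in> obj X" for x
    using assms that by (simp add: code_nat_eq_iff tensor_functor_simps[OF assms(4)])
  have comp: "cmp (nhom Y Z)
        (code_nat Y (slice X Y H (src X g)) (slice X Y H (tgt X g)) (\<lambda>y. fa H (upair g (ide Y y))))
        (code_nat Y (slice X Y H (src X f)) (slice X Y H (tgt X f)) (\<lambda>y. fa H (upair f (ide Y y)))) =
      code_nat Y (slice X Y H (src X f)) (slice X Y H (tgt X g)) (\<lambda>y. fa H (upair (cmp X g f) (ide Y y)))"
    if "f \<in> arr X" "g \<in> arr X" "tgt X f = src X g" for f g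
    using nhom_simps(4)[OF assms(2) t[OF that(1)] t[OF that(2)]] that assms
    by (simp add: code_nat_eq_iff tensor_functor_comp[OF assms(4)])
  show ?thesis
    unfolding curry_ftr_def
  proof (rule normed_functor_mk_ftr_ballI)
    show "\<forall>f\<in>arr X.
        code_nat Y (slice X Y H (src X f)) (slice X Y H (tgt X f)) (\<lambda>y. fa H (upair f (ide Y y))) \<in> arr (nhom Y Z) \<and>
        src (nhom Y Z) (code_nat Y (slice X Y H (src X f)) (slice X Y H (tgt X f)) (\<lambda>y. fa H (upair f (ide Y y)))) =
        code_ftr Y (slice X Y H (src X f)) \<and>
        tgt (nhom Y Z) (code_nat Y (slice X Y H (src X f)) (slice X Y H (tgt X f)) (\<lambda>y. fa H (upair f (ide Y y)))) =
        code_ftr Y (slice X Y H (tgt X f)) \<and>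
        nrm X f \<le> nrm (nhom Y Z) (code_nat Y (slice X Y H (src X f)) (slice X Y H (tgt X f)) (\<lambda>y. fa H (upair f (ide Y y))))"
      using t nrm assms by simp
  qed (use assms id comp in simp_all)
qed

text \<open>On arrows, evaluation composes \<open>H\<close> at \<open>f\<close> and an identity with
  \<open>H\<close> at an identity and \<open>g\<close>, and these fuse to \<open>H\<close> at the
  pair.\<close>

lemma eval_curry:
  assumes "normed_cat X" "normed_cat Y" "normed_cat Z" "normed_functor (ntensor X Y) Z H"
  shows "x \<in> obj X \<Longrightarrow> y \<in> obj Y \<Longrightarrow> eval_obj (upair (fo (curry_ftr X Y H) x) y) = fo H (upair x y)"
    and "f \<in> arr X \<Longrightarrow> g \<in> arr Y \<Longrightarrow> eval_arr Y Z (upair (fa (curry_ftr X Y H) f) g) = fa H (upair f g)"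
  using assms by (simp_all add: curry_ftr_def tensor_functor_comp[OF assms(4)])

text \<open>Evaluating at identity arrows of \<open>X\<close> reveals the functor coded by
  \<open>fo G x\<close>, and evaluating at identity arrows of \<open>Y\<close> reveals the
  components coded by \<open>fa G f\<close>; both are prescribed by \<open>H\<close>.\<close>

lemma curry_unique:
  assumes XYZ: "normed_cat X" "normed_cat Y" "normed_cat Z"
    and H: "normed_functor (ntensor X Y) Z H" and G: "normed_functor X (nhom Y Z) G"
    and obj: "\<And>x y. x \<in> obj X \<Longrightarrow> y \<in> obj Y \<Longrightarrow> eval_obj (upair (fo G x) y) = fo H (upair x y)"
    and arr: "\<And>f g. f \<in> arr X \<Longrightarrow> g \<in> arr Y \<Longrightarrow> eval_arr Y Z (upair (fa G f) g) = fa H (upair f g)"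
  shows "G = curry_ftr X Y H"
proof -
  have o: "fo G x = code_ftr Y (slice X Y H x)" if x: "x \<in> obj X" for x
  proof -
    obtain K where K: "fo G x = code_ftr Y K" "normed_functor Y Z K"
      using normed_functor_simps(1)[OF G x] by (rule obj_nhomE)
    have "fo K y = fo H (upair x y)" if "y \<in> obj Y" for y
      using obj[OF x that] K XYZ that by simp
    moreover have "fa K g = fa H (upair (ide X x) g)" if "g \<in> arr Y" for g
    proof -
      \<comment> \<open>\<open>G\<close> preserves identities, so at \<open>ide X x\<close> the
        coded transformation is the identity and evaluation returns \<open>fa K g\<close>.\<close>
      have "fa G (ide X x) = code_nat Y K K (\<lambda>y. ide Z (fo K y))"
        using normed_functor_ide[OF G x] K XYZ by simp
      then show ?thesis using arr[of "ide X x" g] x that K XYZ by simp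
    qed
    ultimately show ?thesis using K XYZ by (simp add: code_ftr_eq_iff)
  qed
  have a: "fa G f = code_nat Y (slice X Y H (src X f)) (slice X Y H (tgt X f)) (\<lambda>y. fa H (upair f (ide Y y)))"
    if f: "f \<in> arr X" for f
  proof -
    obtain K L \<alpha> where K: "fa G f = code_nat Y K L \<alpha>" "normed_functor Y Z K" "normed_functor Y Z L"
      "transformation Y Z K L \<alpha>"
      using normed_functor_simps(2)[OF G f] by (rule arr_nhomE)
    have "code_ftr Y K = code_ftr Y (slice X Y H (src X f))" "code_ftr Y L = code_ftr Y (slice X Y H (tgt X f))"
      using normed_functor_simps(3,4)[OF G f] K XYZ f by (simp_all add: o)
    moreover have "\<alpha> y = fa H (upair f (ide Y y))" if "y \<in> obj Y" for y
      using arr[OF f, of "ide Y y"] K XYZ that by (simp add: normed_functor_ide[OF K(2)])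
    ultimately show ?thesis using K XYZ by (simp add: code_nat_eq_iff)
  qed
  show ?thesis
    by (rule normed_functor_ext[OF G normed_functor_curry[OF XYZ H]]) (simp_all add: curry_ftr_def o a)
qed

lemma closed_NCat: "closed (NCat :: ('u::universe, 'v::quantale) ncat_2cat) NCat_smc"
proof -
  have "\<exists>!g. g \<in> homset NCat X (nhom Y Z) \<and>
      ncomp (neval Y Z) (ntensor_mor g (ide NCat Y)) = Mor (ntensor X Y) H Z"
    if XYZ: "normed_cat X" "normed_cat Y" "normed_cat Z" and H: "normed_functor (ntensor X Y) Z H"
    for X Y Z :: "('u, 'v) ncat" and H
  proof (rule ex1I[of _ "Mor X (curry_ftr X Y H) (nhom Y Z)"])
    show "Mor X (curry_ftr X Y H) (nhom Y Z) \<in> homset NCat X (nhom Y Z) \<and>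
        ncomp (neval Y Z) (ntensor_mor (Mor X (curry_ftr X Y H) (nhom Y Z)) (ide NCat Y)) = Mor (ntensor X Y) H Z"
      using normed_functor_simps(1,2)[OF normed_functor_curry[OF XYZ H]] XYZ H by (simp add: eval_curry)
    fix g assume g: "g \<in> homset NCat X (nhom Y Z) \<and>
        ncomp (neval Y Z) (ntensor_mor g (ide NCat Y)) = Mor (ntensor X Y) H Z"
    then obtain G where G: "g = Mor X G (nhom Y Z)" "normed_functor X (nhom Y Z) G"
      by (auto elim: homset_NCatE)
    have "G = curry_ftr X Y H"
      by (rule curry_unique[OF XYZ H G(2)]) (use g G XYZ H in simp_all)
    then show "g = Mor X (curry_ftr X Y H) (nhom Y Z)" using G by simp
  qed
  \<comment> \<open>\<open>neval\<close> and the identity stay folded so that the goal keeps the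
    shape of the fact just proved.\<close>
  then show ?thesis unfolding closed_def by (simp del: neval_Mor NCat_sel(4)) simp
qed

section \<open>Currying 2-cells\<close>

lemma tensor_nat_trans_simps:
  assumes "normed_nat_trans (ntensor X Y) Z F F' \<theta>"
  shows "x \<in> obj X \<Longrightarrow> y \<in> obj Y \<Longrightarrow> \<theta> (upair x y) \<in> arr Z"
    and "x \<in> obj X \<Longrightarrow> y \<in> obj Y \<Longrightarrow> src Z (\<theta> (upair x y)) = fo F (upair x y)"
    and "x \<in> obj X \<Longrightarrow> y \<in> obj Y \<Longrightarrow> tgt Z (\<theta> (upair x y)) = fo F' (upair x y)"
    and "x \<in> obj X \<Longrightarrow> y \<in> obj Y \<Longrightarrow> 1 \<le> nrm Z (\<theta> (upair x y))"
    and "f \<in> arr X \<Longrightarrow> g \<in> arr Y \<Longrightarrow>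
      cmp Z (\<theta> (upair (tgt X f) (tgt Y g))) (fa F (upair f g)) =
      cmp Z (fa F' (upair f g)) (\<theta> (upair (src X f) (src Y g)))"
  using assms normed_nat_trans_natural[OF assms, of "upair f g"] by simp_all

definition curry_cell ::
    "('u::universe, 'v::quantale) ncat \<Rightarrow> ('u, 'v) ncat \<Rightarrow> 'u smallftr \<Rightarrow> 'u smallftr \<Rightarrow> ('u \<Rightarrow> 'u) \<Rightarrow> 'u \<Rightarrow> 'u"
  where "curry_cell X Y F F' \<theta> =
    restrict (\<lambda>x. code_nat Y (slice X Y F x) (slice X Y F' x) (\<lambda>y. \<theta> (upair x y))) (obj X)"

text \<open>Naturality in \<open>y\<close> is naturality of \<theta> at pairs whose first member is
  an identity.\<close>

lemma transformation_cell_slice: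
  assumes "normed_cat X" "normed_cat Y" "normed_cat Z" "normed_nat_trans (ntensor X Y) Z F F' \<theta>" "x \<in> obj X"
  shows "transformation Y Z (slice X Y F x) (slice X Y F' x) (\<lambda>y. \<theta> (upair x y))"
  using assms normed_nat_trans_functors[OF assms(4)] tensor_nat_trans_simps(5)[OF assms(4), of "ide X x"]
  by (intro transformationI) (simp_all add: tensor_nat_trans_simps[OF assms(4)])

text \<open>Naturality in \<open>x\<close> is naturality of \<theta> at pairs with an identity in
  second place; the norm condition holds because \<open>1\<close> is below the norm of every
  component of \<theta>, hence below their infimum.\<close>

lemma normed_nat_trans_curry_cell:
  assumes XYZ: "normed_cat X" "normed_cat Y" "normed_cat Z"
    and \<theta>: "normed_nat_trans (ntensor X Y) Z F F' \<theta>"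
  shows "normed_nat_trans X (nhom Y Z) (curry_ftr X Y F) (curry_ftr X Y F') (curry_cell X Y F F' \<theta>)"
  unfolding curry_cell_def
proof (rule normed_nat_transI)
  note FF = normed_nat_trans_functors[OF \<theta>]
  note t = transformation_cell_slice[OF XYZ \<theta>]
  show "normed_functor X (nhom Y Z) (curry_ftr X Y F)" "normed_functor X (nhom Y Z) (curry_ftr X Y F')"
    using XYZ FF by simp_all
  let ?s = "\<lambda>x. code_nat Y (slice X Y F x) (slice X Y F' x) (\<lambda>y. \<theta> (upair x y))"
  fix x assume x: "x \<in> obj X"
  show "?s x \<in> arr (nhom Y Z)" "src (nhom Y Z) (?s x) = fo (curry_ftr X Y F) x"
      "tgt (nhom Y Z) (?s x) = fo (curry_ftr X Y F') x"
    using t[OF x] XYZ x by (simp_all add: curry_ftr_def)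
  show "1 \<le> nrm (nhom Y Z) (?s x)"
    using t[OF x] XYZ x by (auto intro!: INF_greatest simp: tensor_nat_trans_simps[OF \<theta>])
next
  note FF = normed_nat_trans_functors[OF \<theta>]
  note t = transformation_cell_slice[OF XYZ \<theta>]
  fix f assume f: "f \<in> arr X"
  then have x: "src X f \<in> obj X" "tgt X f \<in> obj X" using XYZ by simp_all
  have n: "cmp Z (\<theta> (upair (tgt X f) y)) (fa F (upair f (ide Y y))) =
      cmp Z (fa F' (upair f (ide Y y))) (\<theta> (upair (src X f) y))" if "y \<in> obj Y" for y
    using tensor_nat_trans_simps(5)[OF \<theta> f, of "ide Y y"] XYZ that by simp
  show "cmp (nhom Y Z) (code_nat Y (slice X Y F (tgt X f)) (slice X Y F' (tgt X f)) (\<lambda>y. \<theta> (upair (tgt X f) y)))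
      (fa (curry_ftr X Y F) f) =
    cmp (nhom Y Z) (fa (curry_ftr X Y F') f)
      (code_nat Y (slice X Y F (src X f)) (slice X Y F' (src X f)) (\<lambda>y. \<theta> (upair (src X f) y)))"
    using nhom_simps(4)[OF XYZ(2) transformation_slice[OF XYZ FF(1) f] t[OF x(2)] refl]
      nhom_simps(4)[OF XYZ(2) t[OF x(1)] transformation_slice[OF XYZ FF(2) f] refl] f XYZ
      n by (simp add: curry_ftr_def code_nat_eq_iff)
qed

text \<open>An arrow of the internal hom is determined by its source, its target and its evaluations
  at identities, which are its components.\<close>

lemma hom_cell_unique:
  assumes XYZ: "normed_cat X" "normed_cat Y" "normed_cat Z"
    and \<sigma>: "normed_nat_trans X (nhom Y Z) G G' \<sigma>"
    and F: "\<And>x. x \<in> obj X \<Longrightarrow> normed_functor Y Z (F x)" "\<And>x. x \<in> obj X \<Longrightarrow> normed_functor Y Z (F' x)"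
    and G: "\<And>x. x \<in> obj X \<Longrightarrow> fo G x = code_ftr Y (F x)" "\<And>x. x \<in> obj X \<Longrightarrow> fo G' x = code_ftr Y (F' x)"
    and ev: "\<And>x y. x \<in> obj X \<Longrightarrow> y \<in> obj Y \<Longrightarrow> eval_arr Y Z (upair (\<sigma> x) (ide Y y)) = \<theta> x y"
    and x: "x \<in> obj X"
  shows "\<sigma> x = code_nat Y (F x) (F' x) (\<theta> x)"
proof -
  obtain K L \<alpha> where K: "\<sigma> x = code_nat Y K L \<alpha>" "normed_functor Y Z K" "normed_functor Y Z L"
      "transformation Y Z K L \<alpha>"
    using normed_nat_trans_simps(1)[OF \<sigma> x] by (rule arr_nhomE)
  have "code_ftr Y K = code_ftr Y (F x)" "code_ftr Y L = code_ftr Y (F' x)"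
    using normed_nat_trans_simps(2,3)[OF \<sigma> x] K XYZ G x by simp_all
  moreover have "\<alpha> y = \<theta> x y" if "y \<in> obj Y" for y
    using ev[OF x that] K XYZ that by (simp add: normed_functor_ide[OF K(2)])
  ultimately show ?thesis using K XYZ by (simp add: code_nat_eq_iff)
qed

text \<open>The 1-dimensional uniqueness settles the source and target functors of the transposed
  cell, and \<open>hom_cell_unique\<close> then settles its components.\<close>

lemma closed_2dim_NCat:
  "closed_2dim (NCat :: ('u::universe, 'v::quantale) ncat_2cat) NCat_smc"
proof -
  have unique: "\<exists>!\<sigma>. \<sigma> \<in> arr NCat_vert \<and> src0 NCat \<sigma> = X \<and> tgt0 NCat \<sigma> = nhom Y Z \<and>
      hcmp NCat (ide NCat_vert (neval Y Z)) (ntensor_cell \<sigma> (ide NCat_vert (ide NCat Y))) =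
      Mor (Mor (ntensor X Y) F Z) \<theta> (Mor (ntensor X Y) F' Z)"
    (is "\<exists>!\<sigma>. ?P \<sigma>")
    if XYZ: "normed_cat X" "normed_cat Y" "normed_cat Z"
      and \<theta>: "normed_nat_trans (ntensor X Y) Z F F' \<theta>"
    for X Y Z :: "('u, 'v) ncat" and F F' \<theta>
  proof (rule ex1I)
    note FF = normed_nat_trans_functors[OF \<theta>]
    let ?s = "Mor (Mor X (curry_ftr X Y F) (nhom Y Z)) (curry_cell X Y F F' \<theta>) (Mor X (curry_ftr X Y F') (nhom Y Z))"
    note c = normed_nat_trans_curry_cell[OF XYZ \<theta>]
    show "?P ?s"
      using XYZ FF c \<theta> normed_functor_simps(1,2)[OF normed_functor_curry[OF XYZ FF(1)]]
        normed_functor_simps(1,2)[OF normed_functor_curry[OF XYZ FF(2)]]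
        normed_nat_trans_simps[OF c]
      by (simp add: eval_curry curry_cell_def tensor_nat_trans_simps[OF \<theta>] normed_functor_ide
          tensor_functor_simps(5)[OF FF(1)]
          normed_nat_trans_eq_iff(1)[OF \<theta>, unfolded ntensor_simps(1)])
    fix \<sigma> assume P: "?P \<sigma>"
    then obtain G G' s where s: "\<sigma> = Mor (Mor X G (nhom Y Z)) s (Mor X G' (nhom Y Z))"
        "normed_functor X (nhom Y Z) G" "normed_functor X (nhom Y Z) G'"
        "normed_nat_trans X (nhom Y Z) G G' s"
      by (auto elim!: arr_NCat_vertE)
    have "G = curry_ftr X Y F"
      by (rule curry_unique[OF XYZ FF(1) s(2)]) (use P s XYZ FF in simp_all)
    moreover have "G' = curry_ftr X Y F'"
      by (rule curry_unique[OF XYZ FF(2) s(3)]) (use P s XYZ FF in simp_all)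
    moreover have "s x = code_nat Y (slice X Y F x) (slice X Y F' x) (\<lambda>y. \<theta> (upair x y))" if x: "x \<in> obj X" for x
    proof (rule hom_cell_unique[OF XYZ s(4) _ _ _ _ _ x])
      fix x y assume xy: "x \<in> obj X" "y \<in> obj Y"
      \<comment> \<open>Whiskering with \<open>neval\<close> composes with an identity of
        \<open>Z\<close>; the component equation is first read off in that form, and the identity is
        removed afterwards.\<close>
      have "cmp Z (ide Z (eval_obj (upair (fo G' x) y))) (eval_arr Y Z (upair (s x) (ide Y y))) = \<theta> (upair x y)"
        using P s XYZ FF \<theta> xy
        by (simp add: normed_nat_trans_eq_iff(1)[OF \<theta>, unfolded ntensor_simps(1)]) metis
      then show "eval_arr Y Z (upair (s x) (ide Y y)) = \<theta> (upair x y)"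
        using s XYZ xy normed_functor_simps[OF normed_functor_eval[OF XYZ(2,3)], of "upair (s x) (ide Y y)"] by simp
    qed (use XYZ FF calculation in \<open>simp_all add: curry_ftr_def\<close>)
    ultimately show "\<sigma> = ?s"
      using s by (simp add: curry_cell_def)
  qed
  show ?thesis
    unfolding closed_2dim_def
    by (simp del: neval_Mor NCat_sel(4) NCat_vert_sel(4)) (intro allI impI, simp only:, rule unique)
qed

theorem symmetric_monoidal_closed_2cat_NCat:
  "symmetric_monoidal_closed_2cat (NCat :: ('u::universe, 'v::quantale) ncat_2cat) NCat_smc"
  unfolding symmetric_monoidal_closed_2cat_def symmetric_monoidal_closed_def
  by (intro conjI two_category_NCat category_NCat tensor_functor_NCat constraints_iso_NCat
      constraints_natural_NCat constraints_coherent_NCat closed_NCat tensor_2functor_NCat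
      constraints_2natural_NCat closed_2dim_NCat)

section \<open>Topological functors\<close>

lemma faithfulD:
  "faithful C D U \<Longrightarrow> x \<in> obj C \<Longrightarrow> y \<in> obj C \<Longrightarrow> f \<in> homset C x y \<Longrightarrow> g \<in> homset C x y \<Longrightarrow>
    fa U f = fa U g \<Longrightarrow> f = g"
  unfolding faithful_def inj_on_def by blast

lemma homset_comp:
  "category C \<Longrightarrow> f \<in> homset C x y \<Longrightarrow> g \<in> homset C y z \<Longrightarrow> cmp C g f \<in> homset C x z"
  unfolding in_homset by simp

lemma homset_obj: "category C \<Longrightarrow> f \<in> homset C x y \<Longrightarrow> x \<in> obj C \<and> y \<in> obj C"
  unfolding in_homset by auto

lemma functor_homset: "is_functor C D F \<Longrightarrow> f \<in> homset C x y \<Longrightarrow> fa F f \<in> homset D (fo F x) (fo F y)"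
  unfolding in_homset by (auto simp: is_functor_simps)

lemma functor_comp:
  "is_functor C D F \<Longrightarrow> f \<in> homset C x y \<Longrightarrow> g \<in> homset C y z \<Longrightarrow>
    fa F (cmp C g f) = cmp D (fa F g) (fa F f)"
  unfolding in_homset by (simp add: is_functor_simps)

lemma ide_homset: "category C \<Longrightarrow> x \<in> obj C \<Longrightarrow> ide C x \<in> homset C x x"
  unfolding in_homset by simp

text \<open>The hom bijection is the arrow map of \<open>U\<close> itself: faithfulness makes it
  injective and the lifting property surjective. Chosen lifts define the left adjoint on arrows, and
  faithfulness forces functoriality.\<close>

lemma has_left_adjoint_if_discrete_lifts:
  assumes U: "is_functor C D U" and ff: "faithful C D U"
    and lifts: "\<forall>x\<in>obj D. \<exists>a\<in>obj C. fo U a = x \<and>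
      (\<forall>z\<in>obj C. \<forall>h\<in>homset D x (fo U z). \<exists>g\<in>homset C a z. fa U g = h)"
  shows "has_left_adjoint C D U"
proof -
  have C: "category C" and D: "category D" using U by (simp_all add: is_functor_simps)
  obtain l where l: "\<And>x. x \<in> obj D \<Longrightarrow> l x \<in> obj C \<and> fo U (l x) = x \<and>
      (\<forall>z\<in>obj C. \<forall>h\<in>homset D x (fo U z). \<exists>g\<in>homset C (l x) z. fa U g = h)"
    using lifts by metis
  define m where "m h = (SOME g. g \<in> homset C (l (src D h)) (l (tgt D h)) \<and> fa U g = h)" for h
  have m: "m h \<in> homset C (l (src D h)) (l (tgt D h)) \<and> fa U (m h) = h" if "h \<in> arr D" for h
    unfolding m_def
  proof (rule someI_ex)
    have "h \<in> homset D (src D h) (fo U (l (tgt D h)))" using that l D by (simp add: in_homset)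
    then show "\<exists>g. g \<in> homset C (l (src D h)) (l (tgt D h)) \<and> fa U g = h" 
      using l[of "src D h"] l[of "tgt D h"] category_simps(1,2)[OF D that] by blast
  qed
  let ?L = "\<lparr>fo = l, fa = m\<rparr>"
  have eq: "f = g" if "f \<in> homset C (l x) (l y)" "g \<in> homset C (l x) (l y)" "fa U f = fa U g" for f g x y
    using faithfulD[OF ff _ _ that] homset_obj[OF C that(1)] by blast
  have L: "is_functor D C ?L"
  proof (rule is_functorI[OF D C])
    fix h assume h: "h \<in> arr D"
    show "fa ?L h \<in> arr C" "src C (fa ?L h) = fo ?L (src D h)" "tgt C (fa ?L h) = fo ?L (tgt D h)"
      using m[OF h] by (simp_all add: in_homset)
  next
    fix x assume x: "x \<in> obj D"
    show "fo ?L x \<in> obj C" using l x by simp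
    show "fa ?L (ide D x) = ide C (fo ?L x)"
      using eq[of "m (ide D x)" x x "ide C (l x)"] m[of "ide D x"] x D C l is_functor_simps(7)[OF U, of "l x"]
      by (simp add: ide_homset)
  next
    fix f g assume fg: "f \<in> arr D" "g \<in> arr D" "tgt D f = src D g"
    have mf: "m f \<in> homset C (l (src D f)) (l (tgt D f))" and mg: "m g \<in> homset C (l (tgt D f)) (l (tgt D g))"
      using m[OF fg(1)] m[OF fg(2)] unfolding fg(3) by blast+
    show "fa ?L (cmp D g f) = cmp C (fa ?L g) (fa ?L f)"
      using eq[of "m (cmp D g f)" "src D f" "tgt D g" "cmp C (m g) (m f)"] m[of "cmp D g f"] fg D
        homset_comp[OF C mf mg] functor_comp[OF U mf mg] m[OF fg(1)] m[OF fg(2)] by simp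
  qed
  have "adjunction C D ?L U"
    unfolding adjunction_def
  proof (intro conjI L U exI[of _ "\<lambda>x a. fa U"] ballI)
    fix x a assume x: "x \<in> obj D" and a: "a \<in> obj C"
    show "bij_betw (fa U) (homset C (fo ?L x) a) (homset D x (fo U a))"
      unfolding bij_betw_def
    proof
      show "inj_on (fa U) (homset C (fo ?L x) a)"
        using ff l[OF x] a unfolding faithful_def by simp
      show "fa U ` homset C (fo ?L x) a = homset D x (fo U a)"
        using l[OF x] a functor_homset[OF U, of _ "l x" a] by (auto simp: image_iff) metis
    qed
  next
    fix h g f assume h: "h \<in> arr D" and g: "g \<in> arr C" and f: "f \<in> homset C (fo ?L (tgt D h)) (src C g)"
    have g': "g \<in> homset C (src C g) (tgt C g)" using g by (simp add: in_homset)
    have f': "f \<in> homset C (l (tgt D h)) (src C g)" using f by simp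
    have mh: "m h \<in> homset C (l (src D h)) (l (tgt D h))" "fa U (m h) = h" using m[OF h] by auto
    show "fa U (cmp C g (cmp C f (fa ?L h))) = cmp D (fa U g) (cmp D (fa U f) h)"
      using functor_comp[OF U homset_comp[OF C mh(1) f'] g'] functor_comp[OF U mh(1) f'] mh(2) by simp
  qed
  then show ?thesis unfolding has_left_adjoint_def by blast
qed

text \<open>Dual to the previous result, except that the hom bijection now runs from the base to
  \<open>C\<close>: it is the choice \<phi> of lifts, inverse to the arrow map of \<open>U\<close>,
  and its naturality is checked after applying \<open>U\<close>.\<close>

lemma has_right_adjoint_if_indiscrete_lifts:
  assumes U: "is_functor C D U" and ff: "faithful C D U"
    and lifts: "\<forall>x\<in>obj D. \<exists>a\<in>obj C. fo U a = x \<and>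
      (\<forall>z\<in>obj C. \<forall>h\<in>homset D (fo U z) x. \<exists>g\<in>homset C z a. fa U g = h)"
  shows "has_right_adjoint C D U"
proof -
  have C: "category C" and D: "category D" using U by (simp_all add: is_functor_simps)
  obtain r where r: "\<And>x. x \<in> obj D \<Longrightarrow> r x \<in> obj C \<and> fo U (r x) = x \<and>
      (\<forall>z\<in>obj C. \<forall>h\<in>homset D (fo U z) x. \<exists>g\<in>homset C z (r x). fa U g = h)"
    using lifts by metis
  define \<phi> where "\<phi> z a h = (SOME g. g \<in> homset C z (r a) \<and> fa U g = h)" for z a h
  have \<phi>: "\<phi> z a h \<in> homset C z (r a) \<and> fa U (\<phi> z a h) = h"
    if "z \<in> obj C" "a \<in> obj D" "h \<in> homset D (fo U z) a" for z a h
    unfolding \<phi>_def by (rule someI_ex) (use r that in blast)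
  let ?m = "\<lambda>h. \<phi> (r (src D h)) (tgt D h) h"
  have m: "?m h \<in> homset C (r (src D h)) (r (tgt D h)) \<and> fa U (?m h) = h" if "h \<in> arr D" for h
    by (rule \<phi>) (use that r D in \<open>simp_all add: in_homset\<close>)
  let ?R = "\<lparr>fo = r, fa = ?m\<rparr>"
  have eq: "f = g" if "f \<in> homset C x y" "g \<in> homset C x y" "fa U f = fa U g" for f g x y
    using faithfulD[OF ff _ _ that] homset_obj[OF C that(1)] by blast
  have R: "is_functor D C ?R"
  proof (rule is_functorI[OF D C])
    fix h assume h: "h \<in> arr D"
    show "fa ?R h \<in> arr C" "src C (fa ?R h) = fo ?R (src D h)" "tgt C (fa ?R h) = fo ?R (tgt D h)"
      using m[OF h] by (simp_all add: in_homset)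
  next
    fix x assume x: "x \<in> obj D"
    show "fo ?R x \<in> obj C" using r x by simp
    show "fa ?R (ide D x) = ide C (fo ?R x)"
      using eq[of "?m (ide D x)" "r x" "r x" "ide C (r x)"] m[of "ide D x"] x D C r
        is_functor_simps(7)[OF U, of "r x"]
      by (simp add: ide_homset)
  next
    fix f g assume fg: "f \<in> arr D" "g \<in> arr D" "tgt D f = src D g"
    have mf: "?m f \<in> homset C (r (src D f)) (r (tgt D f))" and mg: "?m g \<in> homset C (r (tgt D f)) (r (tgt D g))"
      using m[OF fg(1)] m[OF fg(2)] unfolding fg(3) by blast+
    show "fa ?R (cmp D g f) = cmp C (fa ?R g) (fa ?R f)"
      using eq[of "?m (cmp D g f)" "r (src D f)" "r (tgt D g)" "cmp C (?m g) (?m f)"] m[of "cmp D g f"] fg D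
        homset_comp[OF C mf mg] functor_comp[OF U mf mg] m[OF fg(1)] m[OF fg(2)] by simp
  qed
  have "adjunction D C U ?R"
    unfolding adjunction_def
  proof (intro conjI R U exI[of _ \<phi>] ballI)
    fix x a assume x: "x \<in> obj C" and a: "a \<in> obj D"
    show "bij_betw (\<phi> x a) (homset D (fo U x) a) (homset C x (fo ?R a))"
    proof (rule bij_betw_byWitness[where f' = "fa U"])
      show "\<forall>h\<in>homset D (fo U x) a. fa U (\<phi> x a h) = h" using \<phi>[OF x a] by blast
      have U': "fa U g \<in> homset D (fo U x) a" if "g \<in> homset C x (r a)" for g
        using functor_homset[OF U that] r[OF a] by simp
      show "\<forall>g\<in>homset C x (fo ?R a). \<phi> x a (fa U g) = g"
        using eq[of "\<phi> x a (fa U _)" x "r a"] \<phi>[OF x a] U' by auto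
      show "\<phi> x a ` homset D (fo U x) a \<subseteq> homset C x (fo ?R a)" using \<phi>[OF x a] by auto
      show "fa U ` homset C x (fo ?R a) \<subseteq> homset D (fo U x) a" using U' by auto
    qed
  next
    fix h g f assume h: "h \<in> arr C" and g: "g \<in> arr D" and f: "f \<in> homset D (fo U (tgt C h)) (src D g)"
    have h': "h \<in> homset C (src C h) (tgt C h)" and g': "g \<in> homset D (src D g) (tgt D g)"
      using h g by (simp_all add: in_homset)
    have objs: "src C h \<in> obj C" "tgt C h \<in> obj C" "src D g \<in> obj D" "tgt D g \<in> obj D"
      using h g C D by simp_all
    note Uh = functor_homset[OF U h']
    note fU = homset_comp[OF D homset_comp[OF D Uh f] g']
    have 1: "\<phi> (tgt C h) (src D g) f \<in> homset C (tgt C h) (r (src D g))"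
        "fa U (\<phi> (tgt C h) (src D g) f) = f"
      using \<phi>[OF objs(2,3) f] by auto
    have 2: "cmp C (\<phi> (tgt C h) (src D g) f) h \<in> homset C (src C h) (r (src D g))"
      by (rule homset_comp[OF C h' 1(1)])
    have 3: "?m g \<in> homset C (r (src D g)) (r (tgt D g))" using m[OF g] by blast
    show "\<phi> (src C h) (tgt D g) (cmp D g (cmp D f (fa U h))) =
        cmp C (fa ?R g) (cmp C (\<phi> (tgt C h) (src D g) f) h)"
    proof (rule eq)
      show "\<phi> (src C h) (tgt D g) (cmp D g (cmp D f (fa U h))) \<in> homset C (src C h) (r (tgt D g))"
        using \<phi>[OF objs(1,4) fU] by blast
      show "cmp C (fa ?R g) (cmp C (\<phi> (tgt C h) (src D g) f) h) \<in> homset C (src C h) (r (tgt D g))"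
        using homset_comp[OF C 2 3] by simp
      show "fa U (\<phi> (src C h) (tgt D g) (cmp D g (cmp D f (fa U h)))) =
          fa U (cmp C (fa ?R g) (cmp C (\<phi> (tgt C h) (src D g) f) h))"
        using \<phi>[OF objs(1,4) fU] functor_comp[OF U 2 3] functor_comp[OF U h' 1(1)] 1(2) m[OF g] by simp
    qed
  qed
  then show ?thesis unfolding has_right_adjoint_def by blast
qed

lemma topological_has_right_adjoint:
  assumes "topological TYPE('i) C D U"
  shows "has_right_adjoint C D U"
proof (rule has_right_adjoint_if_indiscrete_lifts)
  show U: "is_functor C D U" and "faithful C D U" using assms unfolding topological_def by auto
  show "\<forall>x\<in>obj D. \<exists>a\<in>obj C. fo U a = x \<and>
      (\<forall>z\<in>obj C. \<forall>h\<in>homset D (fo U z) x. \<exists>g\<in>homset C z a. fa U g = h)"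
  proof
    fix x assume "x \<in> obj D"
    \<comment> \<open>For the empty source the lifting condition is vacuous, so every morphism into
      \<open>x\<close> lifts to its initial lift. The components are arbitrary.\<close>
    then have "structured_source C D U ({} :: 'i set) x undefined undefined"
      unfolding structured_source_def by simp
    then obtain a where "initial_lift C D U ({} :: 'i set) x undefined undefined a"
      using assms unfolding topological_def by blast
    then show "\<exists>a\<in>obj C. fo U a = x \<and> (\<forall>z\<in>obj C. \<forall>h\<in>homset D (fo U z) x. \<exists>g\<in>homset C z a. fa U g = h)"
      unfolding initial_lift_def by blast
  qed
qed

text \<open>The discrete structure on \<open>x\<close> is the initial lift of the source of all \<open>x \<rightarrow> U z\<close>, which is
  where large sources are needed.\<close>

lemma topological_has_left_adjoint:
  fixes C :: "('o, 'a, 'm) cat_scheme" and D :: "('p, 'b, 'n) cat_scheme"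
  assumes "topological TYPE('o \<times> 'b) C D U"
  shows "has_left_adjoint C D U"
proof (rule has_left_adjoint_if_discrete_lifts)
  show U: "is_functor C D U" and "faithful C D U" using assms unfolding topological_def by auto
  show "\<forall>x\<in>obj D. \<exists>a\<in>obj C. fo U a = x \<and>
      (\<forall>z\<in>obj C. \<forall>h\<in>homset D x (fo U z). \<exists>g\<in>homset C a z. fa U g = h)"
  proof
    fix x assume x: "x \<in> obj D"
    \<comment> \<open>The object \<open>z\<close> is kept beside \<open>h\<close>, because an arrow
      into \<open>fo U z\<close> does not determine \<open>z\<close>.\<close>
    let ?I = "{(z, h). z \<in> obj C \<and> h \<in> homset D x (fo U z)}"
    have "structured_source C D U ?I x fst snd"
      unfolding structured_source_def using x by auto
    then obtain a where "initial_lift C D U ?I x fst snd a"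
      using assms unfolding topological_def by blast
    then have "a \<in> obj C" "fo U a = x" "\<forall>i\<in>?I. \<exists>g\<in>homset C a (fst i). fa U g = snd i"
      unfolding initial_lift_def by blast+
    then show "\<exists>a\<in>obj C. fo U a = x \<and> (\<forall>z\<in>obj C. \<forall>h\<in>homset D x (fo U z). \<exists>g\<in>homset C a z. fa U g = h)"
      by fastforce
  qed
qed


section \<open>Initial norms\<close>

lemma truncate_sel [simp]:
  "obj (cat.truncate X) = obj X" "arr (cat.truncate X) = arr X" "src (cat.truncate X) = src X"
  "tgt (cat.truncate X) = tgt X" "ide (cat.truncate X) = ide X" "cmp (cat.truncate X) = cmp X"
  by (simp_all add: cat.defs)

lemma category_truncate [simp]: "category (cat.truncate X) \<longleftrightarrow> category X"
  unfolding category_def homset_def truncate_sel by (rule refl)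

lemma small_cat_truncate [simp]: "small_cat (cat.truncate X) \<longleftrightarrow> small_cat X"
  unfolding small_cat_def extensional_cat_def truncate_sel category_truncate by (rule refl)

lemma small_functor_truncate [simp]:
  "small_functor (cat.truncate X) (cat.truncate Y) F \<longleftrightarrow> small_functor X Y F"
  "small_functor X' (cat.truncate Y) F \<longleftrightarrow> small_functor X' Y F"
  "small_functor (cat.truncate X) Y' F \<longleftrightarrow> small_functor X Y' F"
  unfolding small_functor_def is_functor_def homset_def truncate_sel category_truncate by (rule refl)+

lemma mk_ftr_truncate [simp]: "mk_ftr (cat.truncate X) f g = mk_ftr X f g"
  by (simp add: mk_ftr_def)

lemma small_functor_simps [simp]:
  assumes "small_functor X Y F"
  shows "x \<in> obj X \<Longrightarrow> fo F x \<in> obj Y"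
    and "f \<in> arr X \<Longrightarrow> fa F f \<in> arr Y"
    and "f \<in> arr X \<Longrightarrow> src Y (fa F f) = fo F (src X f)"
    and "f \<in> arr X \<Longrightarrow> tgt Y (fa F f) = fo F (tgt X f)"
    and "f \<in> arr X \<Longrightarrow> g \<in> arr X \<Longrightarrow> tgt X f = src X g \<Longrightarrow> fa F (cmp X g f) = cmp Y (fa F g) (fa F f)"
  using is_functor_simps[OF small_functorD[OF assms]] by auto

lemma small_functor_ide:
  "small_functor X Y F \<Longrightarrow> x \<in> obj X \<Longrightarrow> fa F (ide X x) = ide Y (fo F x)"
  using is_functor_simps(7)[OF small_functorD] .

lemma small_cat_category [simp]: "small_cat X \<Longrightarrow> category X"
  by (simp add: small_cat_def)

lemma normed_cat_small_cat [simp]: "normed_cat X \<Longrightarrow> small_cat X"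
  by (simp add: normed_cat_def)

lemma small_functor_comp:
  assumes "small_functor X Y F" "small_functor Y Z G"
  shows "small_functor X Z (mk_ftr X (\<lambda>x. fo G (fo F x)) (\<lambda>f. fa G (fa F f)))"
  using assms is_functor_simps(1,2)[OF small_functorD[OF assms(1)]]
    is_functor_simps(1,2)[OF small_functorD[OF assms(2)]]
  by (intro small_functor_mk_ftrI) (simp_all add: small_functor_ide)

section \<open>The category of small categories and the functor that forgets norms\<close>

lemma CatC_sel [simp]:
  "obj CatC = {X. small_cat X}" "src CatC = msrc" "tgt CatC = mtgt"
  "ide CatC X = Mor X (mk_ftr X (\<lambda>x. x) (\<lambda>f. f)) X"
  "cmp CatC (Mor Y G Z) (Mor X F Y') = Mor X (mk_ftr X (\<lambda>x. fo G (fo F x)) (\<lambda>f. fa G (fa F f))) Z"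
  by (simp_all add: CatC_def)

lemma arr_CatC [simp]:
  "Mor X F Y \<in> arr CatC \<longleftrightarrow> small_cat X \<and> small_cat Y \<and> small_functor X Y F"
  by (simp add: CatC_def)

lemma arr_CatCE:
  assumes "h \<in> arr CatC"
  obtains X F Y where "h = Mor X F Y" "small_cat X" "small_cat Y" "small_functor X Y F"
  using assms by (auto simp: CatC_def)

lemma homset_CatCE:
  assumes "h \<in> homset CatC X Y"
  obtains F where "h = Mor X F Y" "small_cat X" "small_cat Y" "small_functor X Y F"
  using assms by (auto simp: in_homset elim: arr_CatCE)

lemma category_CatC: "category CatC"
proof (rule categoryI)
  fix X :: "'a smallcat" assume "X \<in> obj CatC"
  then have X: "small_cat X" by simp
  then show "ide CatC X \<in> arr CatC" by (simp add: small_functor_mk_ftrI)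
next
  fix f g :: "('a smallcat, 'a smallftr) mor"
  assume "f \<in> arr CatC" "g \<in> arr CatC" "tgt CatC f = src CatC g"
  then show "cmp CatC g f \<in> arr CatC" "src CatC (cmp CatC g f) = src CatC f"
      "tgt CatC (cmp CatC g f) = tgt CatC g"
    by (auto elim!: arr_CatCE intro: small_functor_comp)
next
  fix f g h :: "('a smallcat, 'a smallftr) mor"
  assume "f \<in> arr CatC" "g \<in> arr CatC" "h \<in> arr CatC" "tgt CatC f = src CatC g" "tgt CatC g = src CatC h"
  then show "cmp CatC h (cmp CatC g f) = cmp CatC (cmp CatC h g) f"
    by (auto elim!: arr_CatCE)
qed (auto elim!: arr_CatCE simp: small_functor_eq_iff)

lemma forget_norm_sel [simp]:
  "fo forget_norm X = cat.truncate X"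
  "fa forget_norm (Mor X F Y) = Mor (cat.truncate X) F (cat.truncate Y)"
  by (simp_all add: forget_norm_def)

lemma normed_functor_small_functor: "normed_functor X Y F \<Longrightarrow> small_functor X Y F"
  by (simp add: normed_functor_def)

lemma is_functor_forget_norm: "is_functor NCat CatC forget_norm"
  by (rule is_functorI) (auto simp: category_CatC normed_functor_small_functor elim!: arr_NCatE)

lemma faithful_forget_norm: "faithful NCat CatC forget_norm"
  unfolding faithful_def inj_on_def by (auto elim!: homset_NCatE)

lemma add_norm_sel [simp]:
  "obj (add_norm X n) = obj X" "arr (add_norm X n) = arr X" "src (add_norm X n) = src X"
  "tgt (add_norm X n) = tgt X" "ide (add_norm X n) = ide X" "cmp (add_norm X n) = cmp X"
  "f \<in> arr X \<Longrightarrow> nrm (add_norm X n) f = n f" "cat.truncate (add_norm X n) = X"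
  by (simp_all add: add_norm_def cat.defs)

lemma normed_cat_add_norm:
  assumes "small_cat X" "\<And>x. x \<in> obj X \<Longrightarrow> 1 \<le> n (ide X x)"
    and "\<And>f g. f \<in> arr X \<Longrightarrow> g \<in> arr X \<Longrightarrow> tgt X f = src X g \<Longrightarrow> n f * n g \<le> n (cmp X g f)"
  shows "normed_cat (add_norm X n)"
proof -
  have "small_cat (add_norm X n)" using small_cat_truncate[of "add_norm X n"] assms(1) by simp
  then show ?thesis
    unfolding normed_cat_def using assms by simp (simp add: add_norm_def)
qed

text \<open>For a functor \<open>H\<close> into \<open>X\<close>, the norm of \<open>f\<close> lies
  below the norms of all its images under \<open>F i\<close> after \<open>H\<close> exactly if it
  lies below their infimum, which is the universal property. The empty family yields the norm that
  is constantly \<open>top\<close>.\<close>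

lemma initial_lift_NCat:
  fixes Y :: "'i \<Rightarrow> ('u::universe, 'v::quantale) ncat"
  assumes "structured_source NCat CatC forget_norm I X Y F"
  shows "initial_lift NCat CatC forget_norm I X Y F (initial_norm I X Y F)"
proof -
  let ?n = "\<lambda>f. INF i\<in>I. nrm (Y i) (fa (mmap (F i)) f)"
  let ?A = "add_norm X ?n"
  have X: "small_cat X" and Y: "\<And>i. i \<in> I \<Longrightarrow> normed_cat (Y i)"
    and "\<And>i. i \<in> I \<Longrightarrow> F i \<in> homset CatC X (cat.truncate (Y i))"
    using assms unfolding structured_source_def by auto
  then have F: "F i = Mor X (mmap (F i)) (cat.truncate (Y i))" "small_functor X (Y i) (mmap (F i))"
    if "i \<in> I" for i
    using that by (metis homset_CatCE mor.sel(2), metis homset_CatCE mor.sel(2) small_functor_truncate(2))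
  have A: "normed_cat ?A"
  proof (rule normed_cat_add_norm[OF X])
    fix x assume x: "x \<in> obj X"
    show "1 \<le> ?n (ide X x)"
    proof (rule INF_greatest)
      fix i assume i: "i \<in> I"
      show "1 \<le> nrm (Y i) (fa (mmap (F i)) (ide X x))"
        using x small_functor_ide[OF F(2)[OF i] x] F(2)[OF i] nrm_ide[OF Y[OF i]] by simp
    qed
  next
    fix f g assume fg: "f \<in> arr X" "g \<in> arr X" "tgt X f = src X g"
    show "?n f * ?n g \<le> ?n (cmp X g f)"
    proof (rule INF_mult_INF_le)
      fix i assume i: "i \<in> I"
      show "nrm (Y i) (fa (mmap (F i)) f) * nrm (Y i) (fa (mmap (F i)) g) \<le> nrm (Y i) (fa (mmap (F i)) (cmp X g f))"
        using fg F(2)[OF i] nrm_cmp[OF Y[OF i]] by simp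
    qed
  qed
  \<comment> \<open>Being a functor does not involve the norm, so \<open>X\<close> and
    \<open>?A\<close> admit the same functors.\<close>
  have A_functor: "small_functor ?A Z G \<longleftrightarrow> small_functor X Z G" "small_functor Z ?A G \<longleftrightarrow> small_functor Z X G"
    for Z :: "('u, 'v) ncat" and G
    using small_functor_truncate(3)[of ?A Z G] small_functor_truncate(2)[of Z ?A G] by simp_all
  show ?thesis
    unfolding initial_lift_def initial_norm_def
  proof (intro conjI ballI impI)
    show "?A \<in> obj NCat" "fo forget_norm ?A = X" using A by simp_all
    fix i assume i: "i \<in> I"
    have "normed_functor ?A (Y i) (mmap (F i))"
      unfolding normed_functor_def using F(2)[OF i] A_functor i by (auto intro: INF_lower)
    then have "Mor ?A (mmap (F i)) (Y i) \<in> homset NCat ?A (Y i)" using A Y[OF i] by simp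
    moreover have "fa forget_norm (Mor ?A (mmap (F i)) (Y i)) = F i"
      unfolding forget_norm_sel add_norm_sel F(1)[OF i, symmetric] by (rule refl)
    ultimately show "\<exists>g\<in>homset NCat ?A (Y i). fa forget_norm g = F i" by blast
  next
    fix Z h assume Z: "Z \<in> obj NCat" and h: "h \<in> homset CatC (fo forget_norm Z) X"
      and lifts: "\<forall>i\<in>I. \<exists>g\<in>homset NCat Z (Y i). fa forget_norm g = cmp CatC (F i) h"
    obtain H where H: "h = Mor (cat.truncate Z) H X" "small_functor Z X H"
      using h by (auto elim!: homset_CatCE)
    have "nrm Z f \<le> nrm (Y i) (fa (mmap (F i)) (fa H f))" if i: "i \<in> I" and f: "f \<in> arr Z" for i f
    proof -
      \<comment> \<open>Forgetting norms keeps the underlying functor, so the lift \<open>G\<close>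
        is the composite of \<open>mmap (F i)\<close> with \<open>H\<close>.\<close>
      obtain G where "normed_functor Z (Y i) G"
          "fa forget_norm (Mor Z G (Y i)) = cmp CatC (Mor X (mmap (F i)) (cat.truncate (Y i))) h"
        using lifts i F(1)[OF i] by (metis homset_NCatE)
      then show ?thesis using normed_functor_simps(6)[of Z "Y i" G f] f by (simp add: H)
    qed
    then have "normed_functor Z ?A H"
      unfolding normed_functor_def using H(2) A_functor by (auto intro: INF_greatest)
    then have "Mor Z H ?A \<in> homset NCat Z ?A" using A Z by simp
    moreover have "fa forget_norm (Mor Z H ?A) = h" by (simp add: H)
    ultimately show "\<exists>g\<in>homset NCat Z ?A. fa forget_norm g = h" by blast
  qed
qed

text \<open>The index type is left arbitrary, since the left adjoint needs families indexed by pairs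
  of an object and an arrow.\<close>

lemma topological_NCat: "topological TYPE('i) NCat CatC forget_norm"
  unfolding topological_def using is_functor_forget_norm faithful_forget_norm initial_lift_NCat by blast

section \<open>Limits and colimits in concrete categories\<close>

text \<open>The elements of a normed category are taken to be its arrows.\<close>

definition concrete ::
    "('o, 'a, 'm) cat_scheme \<Rightarrow> ('o \<Rightarrow> 'e set) \<Rightarrow> ('a \<Rightarrow> 'e \<Rightarrow> 'e) \<Rightarrow> bool" where
  "concrete C elt act \<longleftrightarrow> category C \<and>
    (\<forall>x y. \<forall>f\<in>homset C x y. \<forall>e\<in>elt x. act f e \<in> elt y) \<and>
    (\<forall>x y z. \<forall>f\<in>homset C x y. \<forall>g\<in>homset C y z. \<forall>e\<in>elt x. act (cmp C g f) e = act g (act f e)) \<and>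
    (\<forall>x y. \<forall>f\<in>homset C x y. \<forall>g\<in>homset C x y. (\<forall>e\<in>elt x. act f e = act g e) \<longrightarrow> f = g)"

lemma concreteD:
  assumes "concrete C elt act"
  shows "category C"
    and "f \<in> homset C x y \<Longrightarrow> e \<in> elt x \<Longrightarrow> act f e \<in> elt y"
    and "f \<in> homset C x y \<Longrightarrow> g \<in> homset C y z \<Longrightarrow> e \<in> elt x \<Longrightarrow> act (cmp C g f) e = act g (act f e)"
    and "f \<in> homset C x y \<Longrightarrow> g \<in> homset C x y \<Longrightarrow> (\<And>e. e \<in> elt x \<Longrightarrow> act f e = act g e) \<Longrightarrow> f = g"
  using assms unfolding concrete_def by blast+

text \<open>An embedding of \<open>X\<close> into the product of the \<open>Y k\<close>: the
  projections are jointly injective on elements, and a family out of \<open>Z\<close> factors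
  through \<open>X\<close> as soon as it does so element by element. That the elementwise values fit
  together to a morphism is part of what the embedding guarantees.\<close>

definition embedded_source ::
    "('o, 'a, 'm) cat_scheme \<Rightarrow> ('o \<Rightarrow> 'e set) \<Rightarrow> ('a \<Rightarrow> 'e \<Rightarrow> 'e) \<Rightarrow>
     'k set \<Rightarrow> ('k \<Rightarrow> 'o) \<Rightarrow> 'o \<Rightarrow> ('k \<Rightarrow> 'a) \<Rightarrow> bool" where
  "embedded_source C elt act K Y X p \<longleftrightarrow> X \<in> obj C \<and> (\<forall>k\<in>K. p k \<in> homset C X (Y k)) \<and>
    (\<forall>d\<in>elt X. \<forall>d'\<in>elt X. (\<forall>k\<in>K. act (p k) d = act (p k) d') \<longrightarrow> d = d') \<and>
    (\<forall>Z\<in>obj C. \<forall>f. (\<forall>k\<in>K. f k \<in> homset C Z (Y k)) \<longrightarrow>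
      (\<forall>e\<in>elt Z. \<exists>d\<in>elt X. \<forall>k\<in>K. act (p k) d = act (f k) e) \<longrightarrow>
      (\<exists>h\<in>homset C Z X. \<forall>k\<in>K. \<forall>e\<in>elt Z. act (p k) (act h e) = act (f k) e))"

lemma embedded_sourceD:
  assumes "embedded_source C elt act K Y X p"
  shows "X \<in> obj C"
    and "k \<in> K \<Longrightarrow> p k \<in> homset C X (Y k)"
    and "d \<in> elt X \<Longrightarrow> d' \<in> elt X \<Longrightarrow> (\<And>k. k \<in> K \<Longrightarrow> act (p k) d = act (p k) d') \<Longrightarrow> d = d'"
    and "Z \<in> obj C \<Longrightarrow> (\<And>k. k \<in> K \<Longrightarrow> f k \<in> homset C Z (Y k)) \<Longrightarrow>
      (\<And>e. e \<in> elt Z \<Longrightarrow> \<exists>d\<in>elt X. \<forall>k\<in>K. act (p k) d = act (f k) e) \<Longrightarrow>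
      \<exists>h\<in>homset C Z X. \<forall>k\<in>K. \<forall>e\<in>elt Z. act (p k) (act h e) = act (f k) e"
  using assms unfolding embedded_source_def by blast+

definition tuples :: "('o \<Rightarrow> 'e set) \<Rightarrow> ('a \<Rightarrow> 'e \<Rightarrow> 'e) \<Rightarrow> 'k set \<Rightarrow> ('k \<Rightarrow> 'a) \<Rightarrow> 'o \<Rightarrow> ('k \<Rightarrow> 'e) set"
  where "tuples elt act K f X = (\<lambda>e. \<lambda>k\<in>K. act (f k) e) ` elt X"

lemma tuples_mem: "t \<in> tuples elt act K f X \<Longrightarrow> \<exists>e\<in>elt X. \<forall>k\<in>K. act (f k) e = t k"
  unfolding tuples_def by auto

text \<open>If the embedded tuples are exactly the compatible ones, every cone factors elementwise
  and hence by a morphism; joint injectivity gives uniqueness.\<close>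

lemma limit_cone_if_compatible_tuples:
  assumes C: "concrete C elt act" and J: "small_cat J" and D: "is_functor J C D"
    and p: "embedded_source C elt act (obj J) (fo D) X p"
    and S: "tuples elt act (obj J) p X =
      {t \<in> PiE (obj J) (\<lambda>j. elt (fo D j)). \<forall>u\<in>arr J. act (fa D u) (t (src J u)) = t (tgt J u)}"
  shows "limit_cone J C D X p"
  unfolding limit_cone_def cone_def
proof (intro conjI allI impI ballI)
  note C = concreteD[OF C] and P = embedded_sourceD[OF p]
  have D': "fa D u \<in> homset C (fo D (src J u)) (fo D (tgt J u))" if "u \<in> arr J" for u
    using is_functor_simps[OF D] that by (simp add: in_homset)
  have Jst: "u \<in> arr J \<Longrightarrow> src J u \<in> obj J" "u \<in> arr J \<Longrightarrow> tgt J u \<in> obj J" for u using J by simp_all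
  show "X \<in> obj C" by (rule P)
  show "p j \<in> homset C X (fo D j)" if "j \<in> obj J" for j using P(2) that .
  show "cmp C (fa D u) (p (src J u)) = p (tgt J u)" if u: "u \<in> arr J" for u
  proof (rule C(4)[OF homset_comp[OF C(1) P(2)[OF Jst(1)[OF u]] D'[OF u]] P(2)[OF Jst(2)[OF u]]])
    fix e assume e: "e \<in> elt X"
    then have "(\<lambda>j\<in>obj J. act (p j) e) \<in> tuples elt act (obj J) p X" unfolding tuples_def by blast
    then show "act (cmp C (fa D u) (p (src J u))) e = act (p (tgt J u)) e"
      unfolding S using C(3)[OF P(2)[OF Jst(1)[OF u]] D'[OF u] e] Jst u by auto
  qed
  fix Z \<zeta> assume cone: "Z \<in> obj C \<and> (\<forall>j\<in>obj J. \<zeta> j \<in> homset C Z (fo D j)) \<and>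
      (\<forall>u\<in>arr J. cmp C (fa D u) (\<zeta> (src J u)) = \<zeta> (tgt J u))"
  then have \<zeta>: "\<And>j. j \<in> obj J \<Longrightarrow> \<zeta> j \<in> homset C Z (fo D j)" by blast
  have "\<exists>h\<in>homset C Z X. \<forall>j\<in>obj J. \<forall>e\<in>elt Z. act (p j) (act h e) = act (\<zeta> j) e"
  proof (rule P(4))
    fix e assume e: "e \<in> elt Z"
    have "act (fa D u) (act (\<zeta> (src J u)) e) = act (\<zeta> (tgt J u)) e" if "u \<in> arr J" for u
      using C(3)[OF \<zeta>[OF Jst(1)[OF that]] D'[OF that] e] cone that by simp
    then have "(\<lambda>j\<in>obj J. act (\<zeta> j) e) \<in> tuples elt act (obj J) p X"
      unfolding S using C(2)[OF \<zeta> e] Jst by auto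
    from tuples_mem[OF this] show "\<exists>d\<in>elt X. \<forall>j\<in>obj J. act (p j) d = act (\<zeta> j) e" by simp
  qed (use cone \<zeta> in blast)+
  then obtain h where h: "h \<in> homset C Z X"
    and ph: "\<And>j e. j \<in> obj J \<Longrightarrow> e \<in> elt Z \<Longrightarrow> act (p j) (act h e) = act (\<zeta> j) e" by blast
  show "\<exists>!h. h \<in> homset C Z X \<and> (\<forall>j\<in>obj J. cmp C (p j) h = \<zeta> j)"
  proof (rule ex1I[of _ h], intro conjI ballI h)
    fix j assume j: "j \<in> obj J"
    show "cmp C (p j) h = \<zeta> j"
      by (rule C(4)[OF homset_comp[OF C(1) h P(2)[OF j]] \<zeta>[OF j]]) (simp add: C(3)[OF h P(2)[OF j]] ph j)
  next
    fix h' assume h': "h' \<in> homset C Z X \<and> (\<forall>j\<in>obj J. cmp C (p j) h' = \<zeta> j)"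
    show "h' = h"
    proof (rule C(4)[OF conjunct1[OF h'] h], rule P(3))
      fix e j assume "e \<in> elt Z" "j \<in> obj J"
      then show "act (p j) (act h' e) = act (p j) (act h e)"
        using C(3)[OF conjunct1[OF h'] P(2), of j e] h' ph by simp
    qed (use C(2) h h' in blast)+
  qed
qed

lemma category_opcat: "category C \<Longrightarrow> category (opcat C)"
  by (rule categoryI) (simp_all add: opcat_def category_assoc)

lemma opcat_sel [simp]:
  "obj (opcat C) = obj C" "arr (opcat C) = arr C" "src (opcat C) = tgt C" "tgt (opcat C) = src C"
  "cmp (opcat C) f g = cmp C g f"
  by (simp_all add: opcat_def)

lemma homset_opcat [simp]: "homset (opcat C) x y = homset C y x"
  by (auto simp: homset_def)

text \<open>The index set consists of all cocones, so the comparison with a cocone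
  \<open>(Z, \<zeta>)\<close> is simply the projection at this index. Each leg
  \<open>\<iota> j\<close> is the joint factorization of the legs at \<open>j\<close> of all
  cocones, and the hypothesis that images of the legs determine morphisms gives uniqueness.\<close>

lemma colimit_if_generated_tuples:
  assumes C: "concrete C elt act" and J: "small_cat J" and D: "is_functor J (opcat C) D"
    and K: "K = {c. cone J (opcat C) D (fst c) (snd c)}"
    and p: "embedded_source C elt act K fst X p"
    and legs: "\<And>j e. j \<in> obj J \<Longrightarrow> e \<in> elt (fo D j) \<Longrightarrow> \<exists>d\<in>elt X. \<forall>k\<in>K. act (p k) d = act (snd k j) e"
    and generated: "\<And>Z h h'. h \<in> homset C X Z \<Longrightarrow> h' \<in> homset C X Z \<Longrightarrow>
      (\<And>d j e. d \<in> elt X \<Longrightarrow> j \<in> obj J \<Longrightarrow> e \<in> elt (fo D j) \<Longrightarrow>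
        \<forall>k\<in>K. act (p k) d = act (snd k j) e \<Longrightarrow> act h d = act h' d) \<Longrightarrow> h = h'"
  shows "\<exists>\<iota>. limit_cone J (opcat C) D X \<iota>"
proof -
  note C = concreteD[OF C] and P = embedded_sourceD[OF p]
  \<comment> \<open>\<open>D\<close> lands in the opposite category, so in \<open>C\<close> the
    arrow \<open>fa D u\<close> runs from the object at \<open>tgt J u\<close> to the object at
    \<open>src J u\<close>.\<close>
  have D': "fa D u \<in> homset C (fo D (tgt J u)) (fo D (src J u))" if "u \<in> arr J" for u
    using is_functor_simps[OF D] that by (simp add: in_homset)
  have Dj: "fo D j \<in> obj C" if "j \<in> obj J" for j using is_functor_simps(3)[OF D that] by simp
  have Jst: "u \<in> arr J \<Longrightarrow> src J u \<in> obj J" "u \<in> arr J \<Longrightarrow> tgt J u \<in> obj J" for u using J by simp_all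
  have leg: "snd k j \<in> homset C (fo D j) (fst k)" if "k \<in> K" "j \<in> obj J" for k j
    using that unfolding K cone_def by auto
  have cocone: "act (snd k (src J u)) (act (fa D u) e) = act (snd k (tgt J u)) e"
    if "k \<in> K" "u \<in> arr J" "e \<in> elt (fo D (tgt J u))" for k u e
    using C(3)[OF D'[OF that(2)] leg[OF that(1) Jst(1)[OF that(2)]] that(3)] that(1,2)
    unfolding K cone_def by simp
  have "\<forall>j\<in>obj J. \<exists>h. h \<in> homset C (fo D j) X \<and> (\<forall>k\<in>K. \<forall>e\<in>elt (fo D j). act (p k) (act h e) = act (snd k j) e)"
    using P(4)[OF Dj leg legs] by blast
  from bchoice[OF this] obtain \<iota> where \<iota>: "\<And>j. j \<in> obj J \<Longrightarrow> \<iota> j \<in> homset C (fo D j) X"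
    and p\<iota>: "\<And>j k e. j \<in> obj J \<Longrightarrow> k \<in> K \<Longrightarrow> e \<in> elt (fo D j) \<Longrightarrow> act (p k) (act (\<iota> j) e) = act (snd k j) e"
    by blast
  have "limit_cone J (opcat C) D X \<iota>"
    unfolding limit_cone_def
  proof (intro conjI allI impI)
    have "cmp C (\<iota> (src J u)) (fa D u) = \<iota> (tgt J u)" if u: "u \<in> arr J" for u
    proof (rule C(4)[OF homset_comp[OF C(1) D'[OF u] \<iota>[OF Jst(1)[OF u]]] \<iota>[OF Jst(2)[OF u]]])
      fix e assume e: "e \<in> elt (fo D (tgt J u))"
      note st = Jst[OF u] and De = C(2)[OF D'[OF u] e]
      have "act (\<iota> (src J u)) (act (fa D u) e) = act (\<iota> (tgt J u)) e"
        by (rule P(3)[OF C(2)[OF \<iota>[OF st(1)] De] C(2)[OF \<iota>[OF st(2)] e]])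
          (simp add: p\<iota> st De e cocone u)
      then show "act (cmp C (\<iota> (src J u)) (fa D u)) e = act (\<iota> (tgt J u)) e"
        using C(3)[OF D'[OF u] \<iota>[OF st(1)] e] by simp
    qed
    then show "cone J (opcat C) D X \<iota>" unfolding cone_def using P(1) \<iota> by simp
    fix Z \<zeta> assume "cone J (opcat C) D Z \<zeta>"
    then have k: "(Z, \<zeta>) \<in> K" unfolding K by simp
    have p: "p (Z, \<zeta>) \<in> homset C X Z" and \<zeta>: "\<zeta> j \<in> homset C (fo D j) Z" if "j \<in> obj J" for j
      using P(2)[OF k] leg[OF k that] by simp_all
    note p = P(2)[OF k, simplified]
    show "\<exists>!h. h \<in> homset (opcat C) Z X \<and> (\<forall>j\<in>obj J. cmp (opcat C) (\<iota> j) h = \<zeta> j)"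
      unfolding homset_opcat opcat_sel
    proof (rule ex1I[of _ "p (Z, \<zeta>)"], intro conjI ballI p)
      fix j assume j: "j \<in> obj J"
      show "cmp C (p (Z, \<zeta>)) (\<iota> j) = \<zeta> j"
        by (rule C(4)[OF homset_comp[OF C(1) \<iota>[OF j] p] \<zeta>[OF j]])
          (simp add: C(3)[OF \<iota>[OF j] p] p\<iota>[OF j k])
    next
      fix h assume h: "h \<in> homset C X Z \<and> (\<forall>j\<in>obj J. cmp C h (\<iota> j) = \<zeta> j)"
      show "h = p (Z, \<zeta>)"
      proof (rule generated[OF conjunct1[OF h] p])
        fix d j e assume d: "d \<in> elt X" and j: "j \<in> obj J" and e: "e \<in> elt (fo D j)"
          and eq: "\<forall>k\<in>K. act (p k) d = act (snd k j) e"
        \<comment> \<open>\<open>d\<close> and the image of \<open>e\<close> under the leg have the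
          same tuple of projections, so joint injectivity identifies them.\<close>
        have "d = act (\<iota> j) e" by (rule P(3)[OF d C(2)[OF \<iota>[OF j] e]]) (simp add: eq p\<iota> j e)
        then show "act h d = act (p (Z, \<zeta>)) d"
          using C(3)[OF \<iota>[OF j] conjunct1[OF h] e] h j p\<iota>[OF j k e] by simp
      qed
    qed
  qed
  then show ?thesis by blast
qed


section \<open>Limits and colimits of normed categories\<close>

lemma homset_NCatD:
  assumes "h \<in> homset NCat X Y"
  shows "normed_functor X Y (mmap h)" "normed_cat X" "normed_cat Y" "msrc h = X" "mtgt h = Y"
  using assms by (auto elim: homset_NCatE)

abbreviation arr_map :: "('u, 'v) nmor \<Rightarrow> 'u \<Rightarrow> 'u" where
  "arr_map F \<equiv> fa (mmap F)"

text \<open>An object is the source of its identity, so the arrow map of a functor determines its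
  object map.\<close>

lemma concrete_NCat: "concrete NCat arr arr_map"
  unfolding concrete_def
proof (intro conjI allI ballI impI)
  fix X Y :: "('a, 'b) ncat" and f g
  assume "f \<in> homset NCat X Y" "g \<in> homset NCat X Y" and eq: "\<forall>e\<in>arr X. arr_map f e = arr_map g e"
  then obtain F G where fg: "f = Mor X F Y" "g = Mor X G Y" "normed_cat X" "normed_cat Y"
    and F: "normed_functor X Y F" and G: "normed_functor X Y G"
    by (auto elim!: homset_NCatE)
  have "fo F x = fo G x" if "x \<in> obj X" for x
    using normed_functor_simps(3)[OF F, of "ide X x"] normed_functor_simps(3)[OF G, of "ide X x"] eq fg that
    by simp
  then show "f = g" using normed_functor_ext[OF F G] eq fg by simp
qed (auto elim!: homset_NCatE)

text \<open>A set of tuples of arrows that contains the identities at its ends and is closed under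
  composition is a subcategory of the product, and the infimum of the coordinate norms is a norm on
  it. The injection \<open>c\<close> transports it into the universe, however large \<open>K\<close>
  is.\<close>

lemma NCat_subproduct:
  fixes Y :: "'k \<Rightarrow> ('u::universe, 'v::quantale) ncat"
  assumes Y: "\<And>k. k \<in> K \<Longrightarrow> normed_cat (Y k)" and covered: "covered TYPE('u) S"
    and S: "\<And>t. t \<in> S \<Longrightarrow> t \<in> extensional K \<and> (\<forall>k\<in>K. t k \<in> arr (Y k)) \<and>
      (\<lambda>k\<in>K. ide (Y k) (src (Y k) (t k))) \<in> S \<and> (\<lambda>k\<in>K. ide (Y k) (tgt (Y k) (t k))) \<in> S"
    and cmp: "\<And>s t. s \<in> S \<Longrightarrow> t \<in> S \<Longrightarrow> (\<And>k. k \<in> K \<Longrightarrow> tgt (Y k) (s k) = src (Y k) (t k)) \<Longrightarrow>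
      (\<lambda>k\<in>K. cmp (Y k) (t k) (s k)) \<in> S"
  shows "\<exists>X p. embedded_source NCat arr arr_map K Y X p \<and> tuples arr arr_map K p X = S"
proof -
  obtain c where c: "inj_on c S" "small (c ` S :: 'u set)" using covered_injection[OF covered] by blast
  define d where "d = inv_into S c"
  have d: "d (c t) = t" if "t \<in> S" for t unfolding d_def using c(1) that by simp
  have mem: "t k \<in> arr (Y k)" if "t \<in> S" "k \<in> K" for t k using S that by blast
  have ext: "c s = c t" if "s \<in> extensional K" "t \<in> extensional K" "\<And>k. k \<in> K \<Longrightarrow> s k = t k" for s t
    using extensionalityI[OF that] by simp
  define s where "s t = (\<lambda>k\<in>K. ide (Y k) (src (Y k) (t k)))" for t
  define r where "r t = (\<lambda>k\<in>K. ide (Y k) (tgt (Y k) (t k)))" for t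
  define m where "m t' t = (\<lambda>k\<in>K. cmp (Y k) (t' k) (t k))" for t' t
  have st: "s t \<in> S" "r t \<in> S" if "t \<in> S" for t using S[OF that] by (simp_all add: s_def r_def)
  have s_app: "s t k = ide (Y k) (src (Y k) (t k))" and r_app: "r t k = ide (Y k) (tgt (Y k) (t k))"
    and m_app: "m t' t k = cmp (Y k) (t' k) (t k)" if "k \<in> K" for t t' k
    using that by (simp_all add: s_def r_def m_def)
  note app = s_app r_app m_app
  have e: "t \<in> extensional K" if "t \<in> S" for t using S[OF that] by blast
  have e': "s t \<in> extensional K" "r t \<in> extensional K" "m t' t \<in> extensional K" for t t'
    by (simp_all add: s_def r_def m_def)
  \<comment> \<open>Equal codes of target and source mean equal identity tuples; taking sources of
    these identities gives composability at each index.\<close>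
  have match: "tgt (Y k) (t k) = src (Y k) (t' k)"
    if t: "t \<in> S" "t' \<in> S" and eq: "c (r t) = c (s t')" and k: "k \<in> K" for t t' k
  proof -
    have "r t = s t'" using inj_on_eq_iff[OF c(1)] eq st t by simp
    then have "src (Y k) (r t k) = src (Y k) (s t' k)" by simp
    then show ?thesis using Y[OF k] mem[OF t(1) k] mem[OF t(2) k] by (simp add: app k)
  qed
  have mS: "m t' t \<in> S" if "t \<in> S" "t' \<in> S" "c (r t) = c (s t')" for t t'
    unfolding m_def by (rule cmp[OF that(1,2) match[OF that]])
  \<comment> \<open>Objects are represented by the codes of their identity tuples, so
    \<open>ide\<close> is the identity map and every law can be tested coordinatewise.\<close>
  define X where "X = mk_ncat (c ` s ` S) (c ` S) (\<lambda>a. c (s (d a))) (\<lambda>a. c (r (d a))) (\<lambda>x. x)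
    (\<lambda>b a. c (m (d b) (d a))) (\<lambda>a. INF k\<in>K. nrm (Y k) (d a k))"
  have sr: "c (s (r t)) = c (r t)" "c (s (s t)) = c (s t)" "c (r (s t)) = c (s t)" if "t \<in> S" for t
    by (rule ext; simp add: e' app Y mem[OF that])+
  have X: "normed_cat X"
    unfolding X_def
  proof (rule normed_cat_mk_ncatI, unfold ball_simps, safe)
    show "small (c ` S)" by (rule c)
    show "small (c ` s ` S)" by (rule small_subset[OF c(2)]) (use st in blast)
  next
    fix t assume t: "t \<in> S"
    note [simp] = d t st[OF t]
    show "c (s (d (c t))) \<in> c ` s ` S" by simp
    have "c (s (r t)) \<in> c ` s ` S" by simp
    then show "c (r (d (c t))) \<in> c ` s ` S" by (simp add: sr[OF t])
    show "c (m (d (c t)) (d (c (s (d (c t)))))) = c t" "c (m (d (c (r (d (c t))))) (d (c t))) = c t"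
      by (simp_all, (rule ext; simp add: e' e[OF t] app Y mem[OF t])+)
    show "c (s t) \<in> c ` S" by simp
    show "c (s (d (c (s t)))) = c (s t)" "c (r (d (c (s t)))) = c (s t)" using sr[OF t] by simp_all
    show "1 \<le> (INF k\<in>K. nrm (Y k) (d (c (s t)) k))"
      by (rule INF_greatest) (simp add: app nrm_ide Y mem[OF t])
  next
    fix t t' assume t: "t \<in> S" and t': "t' \<in> S" and "c (r (d (c t))) = c (s (d (c t')))"
    then have eq: "c (r t) = c (s t')" by (simp add: d)
    note mt = match[OF t t' eq] and [simp] = d t t' mS[OF t t' eq]
    show "c (m (d (c t')) (d (c t))) \<in> c ` S" by simp
    show "c (s (d (c (m (d (c t')) (d (c t)))))) = c (s (d (c t)))"
        "c (r (d (c (m (d (c t')) (d (c t)))))) = c (r (d (c t')))"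
      by (simp_all, (rule ext; simp add: e' app Y mem[OF t] mem[OF t'] mt)+)
    show "(INF k\<in>K. nrm (Y k) (d (c t) k)) * (INF k\<in>K. nrm (Y k) (d (c t') k)) \<le>
        (INF k\<in>K. nrm (Y k) (d (c (m (d (c t')) (d (c t)))) k))"
      by (rule INF_mult_INF_le) (simp add: app nrm_cmp Y mem[OF t] mem[OF t'] mt)
  next
    fix t t' t'' assume t: "t \<in> S" and t': "t' \<in> S" and t'': "t'' \<in> S"
      and "c (r (d (c t))) = c (s (d (c t')))" "c (r (d (c t'))) = c (s (d (c t'')))"
    then have eq: "c (r t) = c (s t')" "c (r t') = c (s t'')" by (simp_all add: d)
    show "c (m (d (c t'')) (d (c (m (d (c t')) (d (c t)))))) = c (m (d (c (m (d (c t'')) (d (c t'))))) (d (c t)))"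
      unfolding d[OF t] d[OF t'] d[OF t''] d[OF mS[OF t t' eq(1)]] d[OF mS[OF t' t'' eq(2)]]
      by (rule ext; simp add: e' app category_assoc Y mem[OF t] mem[OF t'] mem[OF t''] match[OF t t' eq(1)] match[OF t' t'' eq(2)])
  qed
  have objX: "obj X = c ` s ` S" and arrX: "arr X = c ` S" by (simp_all add: X_def mk_ncat_simps)
  have X_simps: "src X (c t) = c (s t)" "tgt X (c t) = c (r t)"
      "nrm X (c t) = (INF k\<in>K. nrm (Y k) (t k))" "ide X (c (s t)) = c (s t)" if "t \<in> S" for t
    using that by (simp_all add: X_def mk_ncat_simps d)
  have X_cmp: "cmp X (c t') (c t) = c (m t' t)" if "t \<in> S" "t' \<in> S" "c (r t) = c (s t')" for t t'
    using that unfolding X_def by (subst mk_ncat_simps) (simp_all add: d)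
  \<comment> \<open>An object is an identity tuple, whose coordinate at \<open>k\<close> is an
    identity arrow; the source of that arrow is the projected object.\<close>
  define P where "P k = mk_ftr X (\<lambda>x. src (Y k) (d x k)) (\<lambda>a. d a k)" for k
  have P: "normed_functor X (Y k) (P k)" if k: "k \<in> K" for k
    unfolding P_def
  proof (rule normed_functor_mk_ftr_ballI, unfold arrX objX ball_simps, safe)
    fix t assume t: "t \<in> S"
    note [simp] = d st t X_simps app[OF k] mem[OF t k] Y[OF k]
    show "src (Y k) (d (c (s t)) k) \<in> obj (Y k)" "d (c t) k \<in> arr (Y k)"
      "src (Y k) (d (c t) k) = src (Y k) (d (src X (c t)) k)"
      "tgt (Y k) (d (c t) k) = src (Y k) (d (tgt X (c t)) k)"
      "d (ide X (c (s t))) k = ide (Y k) (src (Y k) (d (c (s t)) k))" by simp_all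
    show "nrm X (c t) \<le> nrm (Y k) (d (c t) k)" using INF_lower[OF k, of "\<lambda>k. nrm (Y k) (t k)"] by simp
  next
    fix t t' assume t: "t \<in> S" "t' \<in> S" "tgt X (c t) = src X (c t')"
    then have "c (r t) = c (s t')" by (simp add: X_simps)
    then show "d (cmp X (c t') (c t)) k = cmp (Y k) (d (c t') k) (d (c t) k)"
      using t mS[OF t(1,2)] by (simp add: X_cmp d app[OF k])
  qed (use X Y k in simp_all)
  have PA: "fa (P k) (c t) = t k" if "t \<in> S" for t k using that by (simp add: P_def arrX d)
  let ?p = "\<lambda>k. Mor X (P k) (Y k)"
  have monic: "a = b" if "a \<in> arr X" "b \<in> arr X" "\<And>k. k \<in> K \<Longrightarrow> fa (P k) a = fa (P k) b" for a b
    using that unfolding arrX by (auto simp: PA intro!: ext e)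
  have nrm: "nrm X a = (INF k\<in>K. nrm (Y k) (fa (P k) a))" if "a \<in> arr X" for a
    using that by (auto simp: arrX X_simps PA)
  have lift: "\<exists>h\<in>homset NCat Z X. \<forall>k\<in>K. \<forall>b\<in>arr Z. arr_map (?p k) (arr_map h b) = arr_map (f k) b"
    if Z: "normed_cat Z" and f: "\<And>k. k \<in> K \<Longrightarrow> f k \<in> homset NCat Z (Y k)"
      and ex: "\<forall>b\<in>arr Z. \<exists>a\<in>arr X. \<forall>k\<in>K. arr_map (?p k) a = arr_map (f k) b" for Z f
  proof -
    note f = homset_NCatD(1)[OF f]
    obtain g where g: "\<And>b. b \<in> arr Z \<Longrightarrow> g b \<in> arr X"
        "\<And>b k. b \<in> arr Z \<Longrightarrow> k \<in> K \<Longrightarrow> fa (P k) (g b) = arr_map (f k) b"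
      using bchoice[OF ex[unfolded Bex_def]] by auto
    \<comment> \<open>The map \<open>g\<close> was chosen arrow by arrow; it preserves identities
      because its projections do and the projections are jointly injective.\<close>
    have g_ide: "ide X (src X (g b)) = g (ide Z (src Z b))" "ide X (tgt X (g b)) = g (ide Z (tgt Z b))"
      if b: "b \<in> arr Z" for b
    proof -
      have "fa (P k) (ide X (src X (g b))) = fa (P k) (g (ide Z (src Z b)))"
          "fa (P k) (ide X (tgt X (g b))) = fa (P k) (g (ide Z (tgt Z b)))" if k: "k \<in> K" for k
        using X Z b g k normed_functor_simps(3,4)[OF P[OF k] g(1)[OF b]] normed_functor_simps(3,4)[OF f[OF k] b]
        by (simp_all add: normed_functor_ide[OF P[OF k]] normed_functor_ide[OF f[OF k]])
      then show "ide X (src X (g b)) = g (ide Z (src Z b))" "ide X (tgt X (g b)) = g (ide Z (tgt Z b))"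
        using X Z b g by (simp_all add: monic)
    qed
    have o: "src X (g b) = src X (g (ide Z (src Z b)))" "tgt X (g b) = src X (g (ide Z (tgt Z b)))"
      if b: "b \<in> arr Z" for b
      using arg_cong[OF g_ide(1)[OF b], of "src X"] arg_cong[OF g_ide(2)[OF b], of "src X"] X g b by simp_all
    \<comment> \<open>The object map is forced by the arrow map: \<open>z\<close> goes to the source
      of the image of its identity.\<close>
    have "normed_functor Z X (mk_ftr Z (\<lambda>z. src X (g (ide Z z))) g)"
    proof (rule normed_functor_mk_ftr_ballI, safe)
      fix z assume z: "z \<in> obj Z"
      show "g (ide Z z) = ide X (src X (g (ide Z z)))" using g_ide(1)[of "ide Z z"] z Z by simp
    next
      fix a b assume ab: "a \<in> arr Z" "b \<in> arr Z" "tgt Z a = src Z b"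
      then have "tgt X (g a) = src X (g b)" using o(2)[OF ab(1)] o(1)[OF ab(2)] by simp
      note c = g(1)[OF ab(1)] g(1)[OF ab(2)] this
      show "g (cmp Z b a) = cmp X (g b) (g a)"
        by (rule monic) (use c ab g X Z in \<open>simp_all add: normed_functor_simps(5)[OF P _ _ c(3)] normed_functor_simps(5)[OF f]\<close>)
    next
      fix a assume a: "a \<in> arr Z"
      show "nrm Z a \<le> nrm X (g a)" unfolding nrm[OF g(1)[OF a]]
        by (rule INF_greatest) (use a g normed_functor_simps(6)[OF f] in simp)
    qed (use X Z g o[symmetric] in simp_all)
    then show ?thesis
      using X Z g by (intro bexI[of _ "Mor Z (mk_ftr Z (\<lambda>z. src X (g (ide Z z))) g) X"]) simp_all
  qed
  have "embedded_source NCat arr arr_map K Y X ?p"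
    unfolding embedded_source_def using X Y P monic lift by simp
  moreover have "tuples arr arr_map K ?p X = S"
  proof -
    have "(\<lambda>k\<in>K. fa (P k) (c t)) = t" if "t \<in> S" for t
      by (rule extensionalityI[of _ K]) (use e that PA in auto)
    then show ?thesis unfolding tuples_def arrX image_image by simp
  qed
  ultimately show ?thesis by blast
qed

text \<open>The tuples compatible with the diagram form a subcategory of the product because the
  functors \<open>fa D u\<close> preserve identities and composition; over a small index category
  they are covered by graphs.\<close>

theorem small_complete_NCat: "small_complete TYPE('u) (NCat :: ('u::universe, 'v::quantale) ncat_2cat)"
  unfolding small_complete_def
proof (intro conjI allI impI category_NCat)
  fix J :: "('u, 'u) cat" and D :: "('u, 'u, ('u, 'v) ncat, ('u, 'v) nmor) ftr"
  assume J: "small_cat J" and D: "is_functor J NCat D"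
  let ?K = "obj J" and ?Y = "fo D"
  have u: "fa D u \<in> homset NCat (?Y (src J u)) (?Y (tgt J u))" if "u \<in> arr J" for u
    using is_functor_simps[OF D] that by (simp add: in_homset del: NCat_sel)
  note Du = homset_NCatD(1)[OF u]
  have Y: "normed_cat (?Y k)" if "k \<in> ?K" for k using is_functor_simps(3)[OF D that] by simp
  have Jst: "u \<in> arr J \<Longrightarrow> src J u \<in> ?K" "u \<in> arr J \<Longrightarrow> tgt J u \<in> ?K" for u using J by simp_all
  let ?S = "{t \<in> PiE ?K (\<lambda>k. arr (?Y k)). \<forall>u\<in>arr J. arr_map (fa D u) (t (src J u)) = t (tgt J u)}"
  have S: "arr_map (fa D u) (t (src J u)) = t (tgt J u)" "t (src J u) \<in> arr (?Y (src J u))"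
    if "t \<in> ?S" "u \<in> arr J" for t u
    using that Jst by auto
  have "\<exists>X p. embedded_source NCat arr arr_map ?K ?Y X p \<and> tuples arr arr_map ?K p X = ?S"
  proof (rule NCat_subproduct[OF Y])
    have "small ?K" using J by (simp add: small_cat_def)
    then show "covered TYPE('u) ?S"
      using covered_subset[OF covered_PiE[of ?K "\<lambda>k. arr (?Y k)"]] Y by simp
  next
    fix t assume t: "t \<in> ?S"
    have "arr_map (fa D u) (ide (?Y (src J u)) (src (?Y (src J u)) (t (src J u)))) =
          ide (?Y (tgt J u)) (src (?Y (tgt J u)) (t (tgt J u)))"
        "arr_map (fa D u) (ide (?Y (src J u)) (tgt (?Y (src J u)) (t (src J u)))) =
          ide (?Y (tgt J u)) (tgt (?Y (tgt J u)) (t (tgt J u)))"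
      if u: "u \<in> arr J" for u
      using S[OF t u] normed_functor_ide[OF Du[OF u]] normed_functor_simps(3,4)[OF Du[OF u] S(2)[OF t u]]
        Y[OF Jst(1)[OF u]] by simp_all
    then show "t \<in> extensional ?K \<and> (\<forall>k\<in>?K. t k \<in> arr (?Y k)) \<and>
        (\<lambda>k\<in>?K. ide (?Y k) (src (?Y k) (t k))) \<in> ?S \<and> (\<lambda>k\<in>?K. ide (?Y k) (tgt (?Y k) (t k))) \<in> ?S"
      using t Y Jst by (auto simp: PiE_iff)
  next
    fix s t assume "s \<in> ?S" "t \<in> ?S" "\<And>k. k \<in> ?K \<Longrightarrow> tgt (?Y k) (s k) = src (?Y k) (t k)"
    then show "(\<lambda>k\<in>?K. cmp (?Y k) (t k) (s k)) \<in> ?S"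
      using Y Jst normed_functor_simps(5)[OF Du] by (auto simp: PiE_iff)
  qed
  then show "\<exists>l \<pi>. limit_cone J NCat D l \<pi>"
    using limit_cone_if_compatible_tuples[OF concrete_NCat J D] by blast
qed

text \<open>The generators to be used are images of arrows under functors, so with each of them the
  identities at its ends are generators too, and closure under composition gives a subcategory of
  the product.\<close>

inductive_set composites ::
    "'k set \<Rightarrow> ('k \<Rightarrow> ('u::universe, 'v::quantale) ncat) \<Rightarrow> ('k \<Rightarrow> 'u) set \<Rightarrow> ('k \<Rightarrow> 'u) set"
  for K Y G where
    generator: "a \<in> G \<Longrightarrow> a \<in> composites K Y G"
  | composite: "a \<in> composites K Y G \<Longrightarrow> b \<in> composites K Y G \<Longrightarrow>
      (\<And>k. k \<in> K \<Longrightarrow> tgt (Y k) (a k) = src (Y k) (b k)) \<Longrightarrow>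
      (\<lambda>k\<in>K. cmp (Y k) (b k) (a k)) \<in> composites K Y G"

text \<open>Coordinatewise composition is taken as a total operation on tuples; disregarding
  composability only enlarges the closure.\<close>

lemma covered_composites:
  assumes "covered TYPE('u::universe) G"
  shows "covered TYPE('u) (composites K Y G)"
proof (rule covered_closure[OF assms])
  fix P t
  assume "t \<in> composites K Y G" and G: "\<And>g. g \<in> G \<Longrightarrow> P g"
    and comp: "\<And>f g. P f \<Longrightarrow> P g \<Longrightarrow> P (\<lambda>k\<in>K. cmp (Y k) (g k) (f k))"
  then show "P t" by (induction rule: composites.induct) blast+
qed

theorem small_cocomplete_NCat: "small_cocomplete TYPE('u) (NCat :: ('u::universe, 'v::quantale) ncat_2cat)"
  unfolding small_cocomplete_def small_complete_def
proof (intro conjI allI impI category_opcat category_NCat)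
  fix J :: "('u, 'u) cat" and D :: "('u, 'u, ('u, 'v) ncat, ('u, 'v) nmor) ftr"
  assume J: "small_cat J" and D: "is_functor J (opcat (NCat :: ('u, 'v) ncat_2cat)) D"
  let ?C = "opcat (NCat :: ('u, 'v) ncat_2cat)"
  define K where "K = {c. cone J ?C D (fst c) (snd c)}"
  have normed_D: "normed_cat (fo D j)" if "j \<in> obj J" for j using is_functor_simps(3)[OF D that] by simp
  have normed_K: "normed_cat (fst k)" if "k \<in> K" for k
    using that unfolding K_def cone_def by simp
  have leg: "normed_functor (fo D j) (fst k) (mmap (snd k j))" if "k \<in> K" "j \<in> obj J" for k j
    by (rule homset_NCatD(1)) (use that in \<open>auto simp: K_def cone_def\<close>)
  define g where "g j a = (\<lambda>k\<in>K. arr_map (snd k j) a)" for j a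
  define G where "G = (\<Union>j\<in>obj J. g j ` arr (fo D j))"
  let ?S = "composites K fst G"
  have g: "g j a \<in> G" if "j \<in> obj J" "a \<in> arr (fo D j)" for j a using that unfolding G_def by blast
  \<comment> \<open>The identities at the ends of a composite are those of its first and last
    factor, so the induction comes down to the generators, where the legs preserve
    identities.\<close>
  have S: "t \<in> extensional K \<and> (\<forall>k\<in>K. t k \<in> arr (fst k)) \<and>
      (\<lambda>k\<in>K. ide (fst k) (src (fst k) (t k))) \<in> ?S \<and> (\<lambda>k\<in>K. ide (fst k) (tgt (fst k) (t k))) \<in> ?S"
    if "t \<in> ?S" for t
    using that
  proof (induction rule: composites.induct)
    case (generator t)
    then obtain j a where j: "j \<in> obj J" "a \<in> arr (fo D j)" and t: "t = g j a" unfolding G_def by blast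
    have eq: "(\<lambda>k\<in>K. ide (fst k) (src (fst k) (t k))) = g j (ide (fo D j) (src (fo D j) a))"
        "(\<lambda>k\<in>K. ide (fst k) (tgt (fst k) (t k))) = g j (ide (fo D j) (tgt (fo D j) a))"
      unfolding t g_def restrict_eq_restrict_iff
      using j normed_D[OF j(1)] normed_functor_ide[OF leg[OF _ j(1)]]
        normed_functor_simps(3,4)[OF leg[OF _ j(1)] j(2)] by simp_all
    have "g j (ide (fo D j) (src (fo D j) a)) \<in> ?S" "g j (ide (fo D j) (tgt (fo D j) a)) \<in> ?S"
      using normed_D[OF j(1)] j by (auto intro!: composites.generator g)
    moreover have "t \<in> extensional K" "\<forall>k\<in>K. t k \<in> arr (fst k)"
      using normed_functor_simps(2)[OF leg[OF _ j(1)] j(2)] by (simp_all add: t g_def)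
    ultimately show ?case unfolding eq by blast
  next
    case (composite s t)
    have eq: "(\<lambda>k\<in>K. ide (fst k) (src (fst k) ((\<lambda>k\<in>K. cmp (fst k) (t k) (s k)) k))) =
          (\<lambda>k\<in>K. ide (fst k) (src (fst k) (s k)))"
        "(\<lambda>k\<in>K. ide (fst k) (tgt (fst k) ((\<lambda>k\<in>K. cmp (fst k) (t k) (s k)) k))) =
          (\<lambda>k\<in>K. ide (fst k) (tgt (fst k) (t k)))"
      unfolding restrict_eq_restrict_iff using composite normed_K by simp_all
    show ?case unfolding eq using composite normed_K by (simp add: extensional_def)
  qed
  have "\<exists>X p. embedded_source NCat arr arr_map K fst X p \<and> tuples arr arr_map K p X = ?S"
  proof (rule NCat_subproduct[OF normed_K _ S])
    have "small (obj J)" using J by (simp add: small_cat_def)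
    \<comment> \<open>Only the number of tuples matters: the generators are indexed by the arrows in
      a small diagram, although each tuple has an entry for every cocone.\<close>
    then show "covered TYPE('u) ?S"
      unfolding G_def
      by (intro covered_composites covered_UN[OF covered_small] covered_image covered_small) (simp_all add: normed_D)
  qed (auto intro: composites.composite)
  then obtain X p where P: "embedded_source NCat arr arr_map K fst X p" and T: "tuples arr arr_map K p X = ?S"
    by blast
  note P' = embedded_sourceD[OF P]
  have mem: "\<exists>d\<in>arr X. \<forall>k\<in>K. arr_map (p k) d = t k" if "t \<in> ?S" for t
    by (rule tuples_mem) (use T that in simp)
  have "\<exists>\<iota>. limit_cone J ?C D X \<iota>"
  proof (rule colimit_if_generated_tuples[OF concrete_NCat J D K_def P])
    fix j e assume "j \<in> obj J" "e \<in> arr (fo D j)"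
    from mem[OF composites.generator[OF g[OF this]]]
    show "\<exists>d\<in>arr X. \<forall>k\<in>K. arr_map (p k) d = arr_map (snd k j) e" by (simp add: g_def)
  next
    fix Z h h' assume h: "h \<in> homset NCat X Z" "h' \<in> homset NCat X Z"
      and eq: "\<And>d j e. d \<in> arr X \<Longrightarrow> j \<in> obj J \<Longrightarrow> e \<in> arr (fo D j) \<Longrightarrow>
        \<forall>k\<in>K. arr_map (p k) d = arr_map (snd k j) e \<Longrightarrow> arr_map h d = arr_map h' d"
    note hf = homset_NCatD(1)[OF h(1)] homset_NCatD(1)[OF h(2)]
    have X: "normed_cat X" using P'(1) by simp
    note pf = homset_NCatD(1)[OF P'(2)]
    \<comment> \<open>Agreement on the images of the legs spreads along the generation. Since tuples
      rather than arrows are generated, the claim concerns every arrow of \<open>X\<close> with the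
      given tuple.\<close>
    have agree: "\<forall>d\<in>arr X. (\<forall>k\<in>K. arr_map (p k) d = t k) \<longrightarrow> arr_map h d = arr_map h' d" if "t \<in> ?S" for t
      using that
    proof (induction rule: composites.induct)
      case (generator t)
      then show ?case using eq unfolding G_def g_def by auto
    next
      case (composite s t)
      obtain a where a: "a \<in> arr X" "\<forall>k\<in>K. arr_map (p k) a = s k" using mem[OF composite.hyps(1)] by blast
      obtain b where b: "b \<in> arr X" "\<forall>k\<in>K. arr_map (p k) b = t k" using mem[OF composite.hyps(2)] by blast
      \<comment> \<open>Composability in \<open>X\<close> has to be derived from that of the tuples.
        Joint injectivity concerns arrows, so the two objects are compared through their
        identities.\<close>
      have "ide X (tgt X a) = ide X (src X b)"
        by (rule P'(3)) (use X a b composite.hyps(3) normed_functor_simps(3)[OF pf b(1)]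
            normed_functor_simps(4)[OF pf a(1)] in \<open>simp_all add: normed_functor_ide[OF pf]\<close>)
      from arg_cong[OF this, of "src X"] have ab: "tgt X a = src X b" using X a b by simp
      show ?case
      proof (intro ballI impI)
        fix d assume d: "d \<in> arr X" and dt: "\<forall>k\<in>K. arr_map (p k) d = (\<lambda>k\<in>K. cmp (fst k) (t k) (s k)) k"
        have "d = cmp X b a"
          by (rule P'(3)) (use X a b ab d dt normed_functor_simps(5)[OF pf a(1) b(1) ab] in simp_all)
        then show "arr_map h d = arr_map h' d"
          using composite.IH a b normed_functor_simps(5)[OF hf(1) a(1) b(1) ab]
            normed_functor_simps(5)[OF hf(2) a(1) b(1) ab] by simp
      qed
    qed
    show "h = h'"
    proof (rule concreteD(4)[OF concrete_NCat h])
      fix d assume d: "d \<in> arr X"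
      then have "(\<lambda>k\<in>K. arr_map (p k) d) \<in> ?S" unfolding T[symmetric] tuples_def by blast
      from agree[OF this] show "arr_map h d = arr_map h' d" using d by simp
    qed
  qed
  then show "\<exists>l \<pi>. limit_cone J ?C D l \<pi>" by blast
qed

section \<open>The symmetric monoidal closed category of quantale-enriched categories\<close>

lemma mk_vcat_simps [simp]:
  "pts (mk_vcat A d) = A"
  "x \<in> A \<Longrightarrow> y \<in> A \<Longrightarrow> vhm (mk_vcat A d) x y = d x y"
  by (simp_all add: mk_vcat_def)

lemma v_category_mk_vcatI:
  assumes "small A" "\<forall>x\<in>A. 1 \<le> d x x" "\<forall>x\<in>A. \<forall>y\<in>A. \<forall>z\<in>A. d x y * d y z \<le> d x z"
  shows "v_category (mk_vcat A d)"
  unfolding v_category_def using assms by (auto simp: mk_vcat_def)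

lemma v_category_small [simp]: "v_category X \<Longrightarrow> small (pts X)"
  by (simp add: v_category_def)

lemma vhm_refl: "v_category X \<Longrightarrow> x \<in> pts X \<Longrightarrow> 1 \<le> vhm X x x"
  by (simp add: v_category_def)

lemma vhm_trans:
  "v_category X \<Longrightarrow> x \<in> pts X \<Longrightarrow> y \<in> pts X \<Longrightarrow> z \<in> pts X \<Longrightarrow> vhm X x y * vhm X y z \<le> vhm X x z"
  by (simp add: v_category_def)

lemma v_functor_simps [simp]:
  assumes "v_functor X Y f"
  shows "x \<in> pts X \<Longrightarrow> f x \<in> pts Y"
    and "x \<in> pts X \<Longrightarrow> x' \<in> pts X \<Longrightarrow> vhm X x x' \<le> vhm Y (f x) (f x')"
  using assms unfolding v_functor_def by auto

lemma v_functor_restrictI: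
  assumes "\<forall>x\<in>pts X. f x \<in> pts Y" "\<forall>x\<in>pts X. \<forall>x'\<in>pts X. vhm X x x' \<le> vhm Y (f x) (f x')"
  shows "v_functor X Y (restrict f (pts X))"
  unfolding v_functor_def using assms by auto

lemma v_functor_eq_iff [simp]:
  assumes "v_functor X Y f"
  shows "restrict g (pts X) = f \<longleftrightarrow> (\<forall>x\<in>pts X. g x = f x)"
    and "f = restrict g (pts X) \<longleftrightarrow> (\<forall>x\<in>pts X. f x = g x)"
  using assms unfolding v_functor_def by (auto simp: fun_eq_iff PiE_def extensional_def)

lemma v_functor_ext:
  "v_functor X Y f \<Longrightarrow> v_functor X Y' g \<Longrightarrow> (\<And>x. x \<in> pts X \<Longrightarrow> f x = g x) \<Longrightarrow> f = g"
  unfolding v_functor_def PiE_def by (auto intro: extensionalityI)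

lemma v_functor_id [simp]: "v_functor X X (restrict (\<lambda>x. x) (pts X))"
  by (rule v_functor_restrictI) simp_all

lemma v_functor_comp [simp]:
  "v_functor X Y f \<Longrightarrow> v_functor Y Z g \<Longrightarrow> v_functor X Z (restrict (\<lambda>x. g (f x)) (pts X))"
  by (rule v_functor_restrictI) (auto intro: order_trans[OF v_functor_simps(2)[of X Y f]])

lemma VCat_sel [simp]:
  "obj VCat = {X. v_category X}" "src VCat = msrc" "tgt VCat = mtgt"
  "ide VCat X = Mor X (restrict (\<lambda>x. x) (pts X)) X"
  "cmp VCat (Mor Y g Z) (Mor X f Y') = Mor X (restrict (\<lambda>x. g (f x)) (pts X)) Z"
  by (simp_all add: VCat_def compose_def)

lemma arr_VCat [simp]:
  "Mor X f Y \<in> arr VCat \<longleftrightarrow> v_category X \<and> v_category Y \<and> v_functor X Y f"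
  by (simp add: VCat_def)

lemma arr_VCatE:
  assumes "h \<in> arr VCat"
  obtains X f Y where "h = Mor X f Y" "v_category X" "v_category Y" "v_functor X Y f"
  using assms by (auto simp: VCat_def)

lemma ball_arr_VCat [simp]:
  "(\<forall>h\<in>arr VCat. P h) \<longleftrightarrow>
    (\<forall>X f Y. v_category X \<longrightarrow> v_category Y \<longrightarrow> v_functor X Y f \<longrightarrow> P (Mor X f Y))"
  by (metis arr_VCat arr_VCatE)

lemma homset_VCat [simp]:
  "Mor X' f Y' \<in> homset VCat X Y \<longleftrightarrow> X' = X \<and> Y' = Y \<and> v_category X \<and> v_category Y \<and> v_functor X Y f"
  by (auto simp: in_homset)

lemma homset_VCatE:
  assumes "h \<in> homset VCat X Y"
  obtains f where "h = Mor X f Y" "v_category X" "v_category Y" "v_functor X Y f"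
  using assms by (auto simp: in_homset elim: arr_VCatE)

lemma ball_homset_VCat [simp]:
  "(\<forall>h\<in>homset VCat X Y. P h) \<longleftrightarrow>
    (\<forall>f. v_category X \<longrightarrow> v_category Y \<longrightarrow> v_functor X Y f \<longrightarrow> P (Mor X f Y))"
  by (metis homset_VCat homset_VCatE)

lemma category_VCat [simp]: "category VCat"
  unfolding category_def by (simp add: in_homset) clarsimp

section \<open>Tensor product and constraints\<close>

lemma vtensor_simps [simp]:
  "pts (vtensor X Y) = utimes (pts X) (pts Y)"
  "x \<in> pts X \<Longrightarrow> x' \<in> pts X \<Longrightarrow> y \<in> pts Y \<Longrightarrow> y' \<in> pts Y \<Longrightarrow>
    vhm (vtensor X Y) (upair x y) (upair x' y') = vhm X x x' * vhm Y y y'"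
  by (simp_all add: vtensor_def)

lemma v_category_vtensor [simp]:
  assumes "v_category X" "v_category Y"
  shows "v_category (vtensor X Y)"
proof -
  have "vhm X x x' * vhm Y y y' * (vhm X x' x'' * vhm Y y' y'') \<le> vhm X x x'' * vhm Y y y''"
    if "x \<in> pts X" "x' \<in> pts X" "x'' \<in> pts X" "y \<in> pts Y" "y' \<in> pts Y" "y'' \<in> pts Y" for x x' x'' y y' y''
    using quantale_mult_mono[OF vhm_trans[of X x x' x''] vhm_trans[of Y y y' y'']] assms that
    by (simp add: mult_ac)
  then show ?thesis
    unfolding vtensor_def
    by (intro v_category_mk_vcatI small_utimes)
      (use assms in \<open>simp_all add: quantale_one_le_mult vhm_refl\<close>)
qed

lemma vunit_simps [simp]: "pts vunit = {upoint}" "vhm vunit upoint upoint = 1"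
  by (simp_all add: vunit_def)

lemma v_category_vunit [simp]: "v_category vunit"
  unfolding vunit_def by (rule v_category_mk_vcatI) (simp_all add: small_singleton)

lemma v_functor_vtensor [simp]:
  "v_functor X X' f \<Longrightarrow> v_functor Y Y' g \<Longrightarrow>
    v_functor (vtensor X Y) (vtensor X' Y') (restrict (umap f g) (utimes (pts X) (pts Y)))"
  using v_functor_restrictI[of "vtensor X Y" "umap f g" "vtensor X' Y'"]
  by (simp add: quantale_mult_mono)

lemma v_functor_reassoc [simp]:
  "v_functor (vtensor (vtensor X Y) Z) (vtensor X (vtensor Y Z))
    (restrict reassoc (utimes (utimes (pts X) (pts Y)) (pts Z)))"
  using v_functor_restrictI[of "vtensor (vtensor X Y) Z" reassoc "vtensor X (vtensor Y Z)"]
  by (simp add: mult.assoc)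

lemma v_functor_usnd [simp]: "v_functor (vtensor vunit X) X (restrict usnd (utimes {upoint} (pts X)))"
  using v_functor_restrictI[of "vtensor vunit X" usnd X] by simp

lemma v_functor_ufst [simp]: "v_functor (vtensor X vunit) X (restrict ufst (utimes (pts X) {upoint}))"
  using v_functor_restrictI[of "vtensor X vunit" ufst X] by simp

lemma v_functor_uswap [simp]:
  "v_functor (vtensor X Y) (vtensor Y X) (restrict uswap (utimes (pts X) (pts Y)))"
  using v_functor_restrictI[of "vtensor X Y" uswap "vtensor Y X"] by (simp add: mult.commute)

lemma vtensor_mor_Mor [simp]:
  "vtensor_mor (Mor X f X') (Mor Y g Y') =
    Mor (vtensor X Y) (restrict (umap f g) (utimes (pts X) (pts Y))) (vtensor X' Y')"
  by (simp add: vtensor_mor_def mk_vmor_def)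

lemma VCat_smc_sel [simp]:
  "tenO VCat_smc = vtensor" "tenA VCat_smc = vtensor_mor" "unitO VCat_smc = vunit"
  "assoc VCat_smc X Y Z = Mor (vtensor (vtensor X Y) Z)
    (restrict reassoc (utimes (utimes (pts X) (pts Y)) (pts Z))) (vtensor X (vtensor Y Z))"
  "lunit VCat_smc X = Mor (vtensor vunit X) (restrict usnd (utimes {upoint} (pts X))) X"
  "runit VCat_smc X = Mor (vtensor X vunit) (restrict ufst (utimes (pts X) {upoint})) X"
  "braid VCat_smc X Y = Mor (vtensor X Y) (restrict uswap (utimes (pts X) (pts Y))) (vtensor Y X)"
  "ihom VCat_smc = vhom"
  by (simp_all add: VCat_smc_def mk_vmor_def)

lemma iso_VCatI:
  assumes "v_category X" "v_category Y" "v_functor X Y f" "v_functor Y X g"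
    and "\<forall>x\<in>pts X. g (f x) = x" "\<forall>y\<in>pts Y. f (g y) = y"
  shows "iso VCat (Mor X f Y)"
  unfolding iso_def using assms by (auto intro!: bexI[of _ "Mor Y g X"])

lemma tensor_functor_VCat: "tensor_functor VCat VCat_smc"
  unfolding tensor_functor_def by (simp add: in_homset) clarsimp

lemma constraints_iso_VCat: "constraints_iso (VCat :: ('u::universe, 'v::quantale) vcat_cat) VCat_smc"
proof -
  have assoc: "iso VCat (assoc VCat_smc X Y Z)"
    if "v_category X" "v_category Y" "v_category Z" for X Y Z :: "('u, 'v) vcat"
  proof -
    let ?r = "\<lambda>p :: 'u. upair (upair (ufst p) (ufst (usnd p))) (usnd (usnd p))"
    have "v_functor (vtensor X (vtensor Y Z)) (vtensor (vtensor X Y) Z)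
        (restrict ?r (pts (vtensor X (vtensor Y Z))))"
      by (rule v_functor_restrictI) (simp_all add: mult.assoc)
    then show ?thesis using that by (simp add: iso_VCatI)
  qed
  have lunit: "iso VCat (lunit VCat_smc X)" if "v_category X" for X :: "('u, 'v) vcat"
  proof -
    have "v_functor X (vtensor vunit X) (restrict (upair upoint) (pts X))"
      by (rule v_functor_restrictI) simp_all
    then show ?thesis using that by (simp add: iso_VCatI)
  qed
  have runit: "iso VCat (runit VCat_smc X)" if "v_category X" for X :: "('u, 'v) vcat"
  proof -
    have "v_functor X (vtensor X vunit) (restrict (\<lambda>x. upair x upoint) (pts X))"
      by (rule v_functor_restrictI) simp_all
    then show ?thesis using that by (simp add: iso_VCatI)
  qed
  have braid: "iso VCat (braid VCat_smc X Y)" if "v_category X" "v_category Y"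
    for X Y :: "('u, 'v) vcat"
    using that iso_VCatI[OF _ _ v_functor_uswap v_functor_uswap, of X Y] by simp
  show ?thesis
    unfolding constraints_iso_def using assoc lunit runit braid by simp
qed

lemma constraints_natural_VCat: "constraints_natural VCat VCat_smc"
  unfolding constraints_natural_def by simp

lemma constraints_coherent_VCat: "constraints_coherent VCat VCat_smc"
  unfolding constraints_coherent_def by simp

section \<open>Internal hom, evaluation and currying\<close>

lemma pts_vhom: "pts (vhom X Y) = {ulam (pts X) f | f. v_functor X Y f}"
  by (simp add: vhom_def)

lemma ulam_in_vhom [simp]: "v_functor X Y f \<Longrightarrow> ulam (pts X) f \<in> pts (vhom X Y)"
  by (auto simp: pts_vhom)

lemma pts_vhomE:
  assumes "p \<in> pts (vhom X Y)"
  obtains f where "p = ulam (pts X) f" "v_functor X Y f"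
  using assms by (auto simp: pts_vhom)

lemma ball_pts_vhom [simp]:
  "(\<forall>p\<in>pts (vhom X Y). P p) \<longleftrightarrow> (\<forall>f. v_functor X Y f \<longrightarrow> P (ulam (pts X) f))"
  by (auto simp: pts_vhom)

lemma vhm_vhom [simp]:
  "v_category X \<Longrightarrow> v_functor X Y f \<Longrightarrow> v_functor X Y g \<Longrightarrow>
    vhm (vhom X Y) (ulam (pts X) f) (ulam (pts X) g) = (INF x\<in>pts X. vhm Y (f x) (g x))"
  unfolding vhom_def by (subst mk_vcat_simps) (auto intro!: INF_cong)

lemma v_category_vhom [simp]:
  assumes X: "v_category X" and Y: "v_category Y"
  shows "v_category (vhom X Y)"
  unfolding vhom_def
proof (rule v_category_mk_vcatI)
  show "small {ulam (pts X) f | f. v_functor X Y f}"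
    by (rule small_subset[OF small_ulams[OF v_category_small[OF X] v_category_small[OF Y]]]) auto
  have ball: "(\<forall>p\<in>{ulam (pts X) f | f. v_functor X Y f}. P p) \<longleftrightarrow> (\<forall>f. v_functor X Y f \<longrightarrow> P (ulam (pts X) f))" for P
    by auto
  show "\<forall>f\<in>{ulam (pts X) f | f. v_functor X Y f}. 1 \<le> (INF x\<in>pts X. vhm Y (uapp f x) (uapp f x))"
    unfolding ball using X Y by (auto intro!: INF_greatest simp: vhm_refl)
  show "\<forall>f\<in>{ulam (pts X) f | f. v_functor X Y f}. \<forall>g\<in>{ulam (pts X) f | f. v_functor X Y f}.
      \<forall>h\<in>{ulam (pts X) f | f. v_functor X Y f}.
      (INF x\<in>pts X. vhm Y (uapp f x) (uapp g x)) * (INF x\<in>pts X. vhm Y (uapp g x) (uapp h x)) \<le>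
      (INF x\<in>pts X. vhm Y (uapp f x) (uapp h x))"
    unfolding ball by (intro allI impI INF_mult_INF_le) (use X Y in \<open>simp add: vhm_trans\<close>)
qed

definition veval :: "('u::universe, 'v::quantale) vcat \<Rightarrow> 'u \<Rightarrow> 'u" where
  "veval Y = (\<lambda>p. uapp (ufst p) (usnd p))"

lemma veval_simps [simp]: "v_category X \<Longrightarrow> x \<in> pts X \<Longrightarrow> veval Y (upair (ulam (pts X) f) x) = f x"
  by (simp add: veval_def)

lemma evalA_VCat_smc [simp]:
  "evalA VCat_smc X Y = Mor (vtensor (vhom X Y) X) (restrict (veval Y) (utimes (pts (vhom X Y)) (pts X))) Y"
  by (simp add: VCat_smc_def mk_vmor_def veval_def)

text \<open>The passage from \<open>f x\<close> to \<open>g x'\<close> goes through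
  \<open>g x\<close>: the infimum is below the first hom, functoriality of \<open>g\<close> bounds
  the second, and transitivity joins them.\<close>

lemma v_functor_veval [simp]:
  assumes X: "v_category X" and Y: "v_category Y"
  shows "v_functor (vtensor (vhom X Y) X) Y (restrict (veval Y) (utimes (pts (vhom X Y)) (pts X)))"
proof -
  have "(INF x\<in>pts X. vhm Y (f x) (g x)) * vhm X x x' \<le> vhm Y (f x) (g x')"
    if "v_functor X Y f" "v_functor X Y g" "x \<in> pts X" "x' \<in> pts X" for f g x x'
  proof -
    have "(INF x\<in>pts X. vhm Y (f x) (g x)) * vhm X x x' \<le> vhm Y (f x) (g x) * vhm Y (g x) (g x')"
      by (rule quantale_mult_mono) (use that in \<open>auto intro!: INF_lower\<close>)
    also have "\<dots> \<le> vhm Y (f x) (g x')" by (rule vhm_trans) (use Y that in simp_all)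
    finally show ?thesis .
  qed
  then have "v_functor (vtensor (vhom X Y) X) Y (restrict (veval Y) (pts (vtensor (vhom X Y) X)))"
    by (intro v_functor_restrictI) (use X Y in simp_all)
  then show ?thesis by simp
qed

definition vcurry :: "('u::universe, 'v::quantale) vcat \<Rightarrow> ('u, 'v) vcat \<Rightarrow> ('u \<Rightarrow> 'u) \<Rightarrow> 'u \<Rightarrow> 'u" where
  "vcurry X Y h = restrict (\<lambda>x. ulam (pts Y) (restrict (\<lambda>y. h (upair x y)) (pts Y))) (pts X)"

text \<open>Reflexivity takes the place of the norms of identities: multiplying by
  \<open>vhm X x x\<close> or \<open>vhm Y y y\<close> turns a hom in one variable into a hom of the
  tensor product without lowering it.\<close>

lemma v_functor_vcurry:
  assumes X: "v_category X" and Y: "v_category Y" and h: "v_functor (vtensor X Y) Z h"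
  shows "v_functor X (vhom Y Z) (vcurry X Y h)"
    and "x \<in> pts X \<Longrightarrow> y \<in> pts Y \<Longrightarrow> veval Z (upair (vcurry X Y h x) y) = h (upair x y)"
proof -
  note h_le = v_functor_simps(2)[OF h, of "upair x y" "upair x' y'" for x y x' y', simplified]
  have h_pts: "h (upair x y) \<in> pts Z" if "x \<in> pts X" "y \<in> pts Y" for x y
    using v_functor_simps(1)[OF h, of "upair x y"] that by simp
  have slice: "v_functor Y Z (restrict (\<lambda>y. h (upair x y)) (pts Y))" if x: "x \<in> pts X" for x
  proof (rule v_functor_restrictI, safe)
    fix y y' assume y: "y \<in> pts Y" "y' \<in> pts Y"
    have "vhm Y y y' \<le> vhm X x x * vhm Y y y'" by (rule quantale_le_one_mult[OF vhm_refl[OF X x]])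
    also have "\<dots> \<le> vhm Z (h (upair x y)) (h (upair x y'))" using h_le[of x y x y'] x y by simp
    finally show "vhm Y y y' \<le> vhm Z (h (upair x y)) (h (upair x y'))" .
  qed (use h_pts x in simp)
  have le: "vhm X x x' \<le> vhm Z (h (upair x y)) (h (upair x' y))"
    if "x \<in> pts X" "x' \<in> pts X" "y \<in> pts Y" for x x' y
  proof -
    have "vhm X x x' \<le> vhm X x x' * vhm Y y y" by (rule quantale_le_mult_one[OF vhm_refl[OF Y that(3)]])
    also have "\<dots> \<le> vhm Z (h (upair x y)) (h (upair x' y))" using h_le[of x y x' y] that by simp
    finally show ?thesis .
  qed
  show "v_functor X (vhom Y Z) (vcurry X Y h)"
    unfolding vcurry_def
    by (rule v_functor_restrictI) (use slice Y le in \<open>auto intro!: INF_greatest\<close>)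
  show "veval Z (upair (vcurry X Y h x) y) = h (upair x y)" if "x \<in> pts X" "y \<in> pts Y"
    using that Y by (simp add: vcurry_def)
qed

text \<open>Graphs are determined by their values, and evaluation prescribes all of them.\<close>

lemma vcurry_unique:
  assumes Y: "v_category Y" and g: "v_functor X (vhom Y Z) g"
    and ev: "\<And>x y. x \<in> pts X \<Longrightarrow> y \<in> pts Y \<Longrightarrow> veval Z (upair (g x) y) = h (upair x y)"
  shows "g = vcurry X Y h"
proof -
  have "g x = ulam (pts Y) (restrict (\<lambda>y. h (upair x y)) (pts Y))" if x: "x \<in> pts X" for x
  proof -
    obtain k where k: "g x = ulam (pts Y) k" "v_functor Y Z k"
      using v_functor_simps(1)[OF g x] by (rule pts_vhomE)
    have "k y = h (upair x y)" if "y \<in> pts Y" for y using ev[OF x that] k Y that by simp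
    then show ?thesis using k Y by (simp add: ulam_eq_iff)
  qed
  then show ?thesis using g by (simp add: vcurry_def)
qed

lemma closed_VCat: "closed (VCat :: ('u::universe, 'v::quantale) vcat_cat) VCat_smc"
proof -
  have unique: "\<exists>!g. g \<in> homset VCat X (vhom Y Z) \<and>
      cmp VCat (evalA VCat_smc Y Z) (vtensor_mor g (ide VCat Y)) = Mor (vtensor X Y) h Z"
    if XYZ: "v_category X" "v_category Y" "v_category Z" and h: "v_functor (vtensor X Y) Z h"
    for X Y Z :: "('u, 'v) vcat" and h
  proof (rule ex1I[of _ "Mor X (vcurry X Y h) (vhom Y Z)"])
    note c = v_functor_vcurry[OF XYZ(1,2) h]
    \<comment> \<open>Simplification rewrites the carrier of the tensor product to
      \<open>utimes\<close>, so the extensionality rule is restated for that form.\<close>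
    note eq = v_functor_eq_iff(1)[OF h, unfolded vtensor_simps(1)]
    show "Mor X (vcurry X Y h) (vhom Y Z) \<in> homset VCat X (vhom Y Z) \<and>
        cmp VCat (evalA VCat_smc Y Z) (vtensor_mor (Mor X (vcurry X Y h) (vhom Y Z)) (ide VCat Y)) =
        Mor (vtensor X Y) h Z"
      using c v_functor_simps(1)[OF c(1)] XYZ h by (simp add: eq)
    fix g assume g: "g \<in> homset VCat X (vhom Y Z) \<and>
        cmp VCat (evalA VCat_smc Y Z) (vtensor_mor g (ide VCat Y)) = Mor (vtensor X Y) h Z"
    then obtain k where k: "g = Mor X k (vhom Y Z)" "v_functor X (vhom Y Z) k"
      by (auto elim: homset_VCatE)
    have "k = vcurry X Y h"
      by (rule vcurry_unique[OF XYZ(2) k(2)]) (use g k XYZ h in \<open>simp add: eq\<close>)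
    then show "g = Mor X (vcurry X Y h) (vhom Y Z)" using k by simp
  qed
  show ?thesis
    unfolding closed_def
    by (simp del: evalA_VCat_smc VCat_sel(4,5)) (intro allI impI conjI unique; simp)
qed

theorem symmetric_monoidal_closed_VCat:
  "symmetric_monoidal_closed (VCat :: ('u::universe, 'v::quantale) vcat_cat) VCat_smc"
  unfolding symmetric_monoidal_closed_def
  by (intro conjI category_VCat tensor_functor_VCat constraints_iso_VCat
      constraints_natural_VCat constraints_coherent_VCat closed_VCat)

section \<open>Initial structures, limits and colimits of quantale-enriched categories\<close>

lemma SetC_sel [simp]:
  "obj SetC = {A. small A}" "src SetC = msrc" "tgt SetC = mtgt"
  "ide SetC A = Mor A (restrict (\<lambda>x. x) A) A"
  "cmp SetC (Mor B g C) (Mor A f B') = Mor A (restrict (\<lambda>x. g (f x)) A) C"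
  by (simp_all add: SetC_def compose_def)

lemma arr_SetC [simp]: "Mor A f B \<in> arr SetC \<longleftrightarrow> small A \<and> small B \<and> f \<in> A \<rightarrow>\<^sub>E B"
  by (simp add: SetC_def)

lemma arr_SetCE:
  assumes "h \<in> arr SetC"
  obtains A f B where "h = Mor A f B" "small A" "small B" "f \<in> A \<rightarrow>\<^sub>E B"
  using assms by (auto simp: SetC_def)

lemma homset_SetCE:
  assumes "h \<in> homset SetC A B"
  obtains f where "h = Mor A f B" "small A" "small B" "f \<in> A \<rightarrow>\<^sub>E B"
  using assms by (auto simp: in_homset elim: arr_SetCE)

lemma category_SetC: "category SetC"
  by (rule categoryI) (auto elim!: arr_SetCE simp: fun_eq_iff PiE_iff extensional_def)

lemma forget_vcat_sel [simp]:
  "fo forget_vcat X = pts X" "fa forget_vcat (Mor X f Y) = Mor (pts X) f (pts Y)"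
  by (simp_all add: forget_vcat_def)

lemma v_functor_PiE: "v_functor X Y f \<Longrightarrow> f \<in> pts X \<rightarrow>\<^sub>E pts Y"
  by (simp add: v_functor_def)

lemma is_functor_forget_vcat: "is_functor VCat SetC forget_vcat"
  by (rule is_functorI) (auto simp: category_SetC dest: v_functor_PiE elim!: arr_VCatE)

lemma faithful_forget_vcat: "faithful VCat SetC forget_vcat"
  unfolding faithful_def inj_on_def by (auto elim!: homset_VCatE)

lemma initial_lift_VCat:
  fixes Y :: "'i \<Rightarrow> ('u::universe, 'v::quantale) vcat"
  assumes "structured_source VCat SetC forget_vcat I A Y f"
  shows "initial_lift VCat SetC forget_vcat I A Y f (initial_vcat I A Y f)"
proof -
  let ?d = "\<lambda>x y. INF i\<in>I. vhm (Y i) (mmap (f i) x) (mmap (f i) y)"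
  let ?A = "mk_vcat A ?d"
  have A: "small A" and Y: "\<And>i. i \<in> I \<Longrightarrow> v_category (Y i)"
    and "\<And>i. i \<in> I \<Longrightarrow> f i \<in> homset SetC A (pts (Y i))"
    using assms unfolding structured_source_def by auto
  then have f: "f i = Mor A (mmap (f i)) (pts (Y i))" "mmap (f i) \<in> A \<rightarrow>\<^sub>E pts (Y i)" if "i \<in> I" for i
    using that by (metis homset_SetCE mor.sel(2), metis homset_SetCE mor.sel(2))
  have fY: "mmap (f i) x \<in> pts (Y i)" if "i \<in> I" "x \<in> A" for i x using f(2)[OF that(1)] that(2) by auto
  have vA: "v_category ?A"
  proof (rule v_category_mk_vcatI[OF A])
    show "\<forall>x\<in>A. 1 \<le> ?d x x" by (auto intro!: INF_greatest vhm_refl Y fY)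
    show "\<forall>x\<in>A. \<forall>y\<in>A. \<forall>z\<in>A. ?d x y * ?d y z \<le> ?d x z" by (auto intro!: INF_mult_INF_le vhm_trans Y fY)
  qed
  show ?thesis
    unfolding initial_lift_def initial_vcat_def
  proof (intro conjI ballI impI)
    show "?A \<in> obj VCat" "fo forget_vcat ?A = A" using vA by simp_all
    fix i assume i: "i \<in> I"
    have "v_functor ?A (Y i) (mmap (f i))"
      unfolding v_functor_def using f(2)[OF i] i by (auto intro: INF_lower)
    then have "Mor ?A (mmap (f i)) (Y i) \<in> homset VCat ?A (Y i)" using vA Y[OF i] by simp
    moreover have "fa forget_vcat (Mor ?A (mmap (f i)) (Y i)) = f i"
      unfolding forget_vcat_sel mk_vcat_simps f(1)[OF i, symmetric] by (rule refl)
    ultimately show "\<exists>g\<in>homset VCat ?A (Y i). fa forget_vcat g = f i" by blast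
  next
    fix Z h assume Z: "Z \<in> obj VCat" and h: "h \<in> homset SetC (fo forget_vcat Z) A"
      and lifts: "\<forall>i\<in>I. \<exists>g\<in>homset VCat Z (Y i). fa forget_vcat g = cmp SetC (f i) h"
    obtain H where H: "h = Mor (pts Z) H A" "H \<in> pts Z \<rightarrow>\<^sub>E A" using h by (auto elim!: homset_SetCE)
    have "vhm Z x y \<le> vhm (Y i) (mmap (f i) (H x)) (mmap (f i) (H y))"
      if i: "i \<in> I" and xy: "x \<in> pts Z" "y \<in> pts Z" for i x y
    proof -
      obtain G where "v_functor Z (Y i) G"
          "fa forget_vcat (Mor Z G (Y i)) = cmp SetC (Mor A (mmap (f i)) (pts (Y i))) h"
        using lifts i f(1)[OF i] by (metis homset_VCatE)
      then show ?thesis using v_functor_simps(2)[of Z "Y i" G x y] xy by (simp add: H)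
    qed
    moreover have "H x \<in> A" if "x \<in> pts Z" for x using H(2) that by auto
    ultimately have "v_functor Z ?A H"
      unfolding v_functor_def using H(2) by (auto intro!: INF_greatest)
    then have "Mor Z H ?A \<in> homset VCat Z ?A" using vA Z by simp
    moreover have "fa forget_vcat (Mor Z H ?A) = h" by (simp add: H)
    ultimately show "\<exists>g\<in>homset VCat Z ?A. fa forget_vcat g = h" by blast
  qed
qed

lemma topological_VCat: "topological TYPE('i) VCat SetC forget_vcat"
  unfolding topological_def using is_functor_forget_vcat faithful_forget_vcat initial_lift_VCat by blast

section \<open>Small limits and colimits\<close>

lemma homset_VCatD:
  assumes "h \<in> homset VCat X Y"
  shows "v_functor X Y (mmap h)" "v_category X" "v_category Y" "msrc h = X" "mtgt h = Y"
  using assms by (auto elim: homset_VCatE)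

lemma concrete_VCat: "concrete VCat pts mmap"
  unfolding concrete_def by (auto elim!: homset_VCatE intro: v_functor_ext)

text \<open>A quantale-enriched category has no operations on its points, so any covered set of
  tuples of points carries the infimum structure induced from the product.\<close>

lemma VCat_subproduct:
  fixes Y :: "'k \<Rightarrow> ('u::universe, 'v::quantale) vcat"
  assumes Y: "\<And>k. k \<in> K \<Longrightarrow> v_category (Y k)"
    and covered: "covered TYPE('u) S"
    and S: "\<And>t. t \<in> S \<Longrightarrow> t \<in> extensional K \<and> (\<forall>k\<in>K. t k \<in> pts (Y k))"
  shows "\<exists>X p. embedded_source VCat pts mmap K Y X p \<and> tuples pts mmap K p X = S"
proof -
  obtain c where c: "inj_on c S" "small (c ` S :: 'u set)" using covered_injection[OF covered] by blast
  define d where "d = inv_into S c"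
  have d: "d (c t) = t" if "t \<in> S" for t unfolding d_def using c(1) that by simp
  have mem: "t k \<in> pts (Y k)" if "t \<in> S" "k \<in> K" for t k using S that by blast
  define X where "X = mk_vcat (c ` S) (\<lambda>x y. INF k\<in>K. vhm (Y k) (d x k) (d y k))"
  have pts: "pts X = c ` S" by (simp add: X_def)
  have vhm: "vhm X x y = (INF k\<in>K. vhm (Y k) (d x k) (d y k))" if "x \<in> pts X" "y \<in> pts X" for x y
    using that by (simp add: X_def)
  have X: "v_category X"
    unfolding X_def
  proof (rule v_category_mk_vcatI[OF c(2)], unfold ball_simps, safe)
    show "1 \<le> (INF k\<in>K. vhm (Y k) (d (c x) k) (d (c x) k))" if "x \<in> S" for x
      by (rule INF_greatest) (use that in \<open>simp add: d vhm_refl Y mem\<close>)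
    show "(INF k\<in>K. vhm (Y k) (d (c x) k) (d (c y) k)) * (INF k\<in>K. vhm (Y k) (d (c y) k) (d (c z) k)) \<le>
        (INF k\<in>K. vhm (Y k) (d (c x) k) (d (c z) k))" if "x \<in> S" "y \<in> S" "z \<in> S" for x y z
      by (rule INF_mult_INF_le) (use that in \<open>simp add: d vhm_trans Y mem\<close>)
  qed
  let ?p = "\<lambda>k. Mor X (restrict (\<lambda>x. d x k) (pts X)) (Y k)"
  have "v_functor X (Y k) (restrict (\<lambda>x. d x k) (pts X))" if "k \<in> K" for k
    by (rule v_functor_restrictI) (use that in \<open>auto simp: vhm pts d mem intro: INF_lower\<close>)
  then have p: "?p k \<in> homset VCat X (Y k)" if "k \<in> K" for k using X Y that by simp
  have monic: "x = y" if xy: "x \<in> pts X" "y \<in> pts X" "\<And>k. k \<in> K \<Longrightarrow> d x k = d y k" for x y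
  proof -
    obtain t u where t: "x = c t" "y = c u" "t \<in> S" "u \<in> S" using xy(1,2) unfolding pts by blast
    have "t = u" by (rule extensionalityI[of _ K]) (use t S xy(3) d in auto)
    then show ?thesis using t by simp
  qed
  have lift: "\<exists>h\<in>homset VCat Z X. \<forall>k\<in>K. \<forall>z\<in>pts Z. mmap (?p k) (mmap h z) = mmap (f k) z"
    if Z: "v_category Z" and f: "\<And>k. k \<in> K \<Longrightarrow> f k \<in> homset VCat Z (Y k)"
      and ex: "\<forall>z\<in>pts Z. \<exists>x\<in>pts X. \<forall>k\<in>K. mmap (?p k) x = mmap (f k) z" for Z f
  proof -
    from bchoice[OF ex[unfolded Bex_def]] obtain h
      where "\<forall>z\<in>pts Z. h z \<in> pts X \<and> (\<forall>k\<in>K. mmap (?p k) (h z) = mmap (f k) z)" ..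
    then have h: "h z \<in> pts X" "k \<in> K \<Longrightarrow> d (h z) k = mmap (f k) z" if "z \<in> pts Z" for z k
      using that by auto
    have "v_functor Z X (restrict h (pts Z))"
      by (rule v_functor_restrictI)
        (use h v_functor_simps(2)[OF homset_VCatD(1)[OF f]] in \<open>auto simp: vhm intro!: INF_greatest\<close>)
    then show ?thesis using X Z h by (intro bexI[of _ "Mor Z (restrict h (pts Z)) X"]) simp_all
  qed
  have "embedded_source VCat pts mmap K Y X ?p"
    unfolding embedded_source_def using X p monic lift by simp
  moreover have "tuples pts mmap K ?p X = S"
  proof -
    have "(\<lambda>k\<in>K. mmap (?p k) (c t)) = t" if "t \<in> S" for t
      by (rule extensionalityI[of _ K]) (use S[OF that] that in \<open>auto simp: d pts\<close>)
    then show ?thesis unfolding tuples_def pts image_image by simp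
  qed
  ultimately show ?thesis by blast
qed

theorem small_complete_VCat: "small_complete TYPE('u) (VCat :: ('u::universe, 'v::quantale) vcat_cat)"
  unfolding small_complete_def
proof (intro conjI allI impI category_VCat)
  fix J :: "('u, 'u) cat" and D :: "('u, 'u, ('u, 'v) vcat, ('u, 'v) vmor) ftr"
  assume J: "small_cat J" and D: "is_functor J VCat D"
  have Y: "v_category (fo D k)" if "k \<in> obj J" for k using is_functor_simps(3)[OF D that] by simp
  let ?S = "{t \<in> PiE (obj J) (\<lambda>k. pts (fo D k)). \<forall>u\<in>arr J. mmap (fa D u) (t (src J u)) = t (tgt J u)}"
  have "small (obj J)" using J by (simp add: small_cat_def)
  then have cov: "covered TYPE('u) ?S"
    using covered_subset[OF covered_PiE[of "obj J" "\<lambda>k. pts (fo D k)"]] Y by simp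
  have "\<exists>X p. embedded_source VCat pts mmap (obj J) (fo D) X p \<and> tuples pts mmap (obj J) p X = ?S"
    by (rule VCat_subproduct[OF Y cov]) (auto simp: PiE_iff)
  then show "\<exists>l \<pi>. limit_cone J VCat D l \<pi>"
    using limit_cone_if_compatible_tuples[OF concrete_VCat J D] by blast
qed

text \<open>Points cannot be composed, so the images of the legs already exhaust the carrier of the
  colimit; its homs are infima over all cocones.\<close>

theorem small_cocomplete_VCat: "small_cocomplete TYPE('u) (VCat :: ('u::universe, 'v::quantale) vcat_cat)"
  unfolding small_cocomplete_def small_complete_def
proof (intro conjI allI impI category_opcat category_VCat)
  fix J :: "('u, 'u) cat" and D :: "('u, 'u, ('u, 'v) vcat, ('u, 'v) vmor) ftr"
  assume J: "small_cat J" and D: "is_functor J (opcat (VCat :: ('u, 'v) vcat_cat)) D"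
  let ?C = "opcat (VCat :: ('u, 'v) vcat_cat)"
  define K where "K = {c. cone J ?C D (fst c) (snd c)}"
  have vD: "v_category (fo D j)" if "j \<in> obj J" for j using is_functor_simps(3)[OF D that] by simp
  have vK: "v_category (fst k)" if "k \<in> K" for k using that unfolding K_def cone_def by simp
  have leg: "v_functor (fo D j) (fst k) (mmap (snd k j))" if "k \<in> K" "j \<in> obj J" for k j
    by (rule homset_VCatD(1)) (use that in \<open>auto simp: K_def cone_def\<close>)
  define S where "S = (\<Union>j\<in>obj J. (\<lambda>x. \<lambda>k\<in>K. mmap (snd k j) x) ` pts (fo D j))"
  have "small (obj J)" using J by (simp add: small_cat_def)
  then have cov: "covered TYPE('u) S"
    unfolding S_def by (intro covered_UN[OF covered_small] covered_image covered_small) (simp_all add: vD)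
  have "\<exists>X p. embedded_source VCat pts mmap K fst X p \<and> tuples pts mmap K p X = S"
    by (rule VCat_subproduct[OF vK cov]) (use v_functor_simps(1)[OF leg] in \<open>auto simp: S_def\<close>)
  then obtain X p where P: "embedded_source VCat pts mmap K fst X p" and T: "tuples pts mmap K p X = S"
    by blast
  have "\<exists>\<iota>. limit_cone J ?C D X \<iota>"
  proof (rule colimit_if_generated_tuples[OF concrete_VCat J D K_def P])
    fix j e assume "j \<in> obj J" "e \<in> pts (fo D j)"
    then have "(\<lambda>k\<in>K. mmap (snd k j) e) \<in> tuples pts mmap K p X" unfolding T S_def by blast
    from tuples_mem[OF this] show "\<exists>d\<in>pts X. \<forall>k\<in>K. mmap (p k) d = mmap (snd k j) e" by simp
  next
    fix Z h h' assume h: "h \<in> homset VCat X Z" "h' \<in> homset VCat X Z"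
      and eq: "\<And>d j e. d \<in> pts X \<Longrightarrow> j \<in> obj J \<Longrightarrow> e \<in> pts (fo D j) \<Longrightarrow>
        \<forall>k\<in>K. mmap (p k) d = mmap (snd k j) e \<Longrightarrow> mmap h d = mmap h' d"
    show "h = h'"
    proof (rule concreteD(4)[OF concrete_VCat h])
      fix d assume d: "d \<in> pts X"
      then have "(\<lambda>k\<in>K. mmap (p k) d) \<in> S" unfolding T[symmetric] tuples_def by blast
      then obtain j e where j: "j \<in> obj J" "e \<in> pts (fo D j)"
        and "(\<lambda>k\<in>K. mmap (p k) d) = (\<lambda>k\<in>K. mmap (snd k j) e)" unfolding S_def by blast
      then show "mmap h d = mmap h' d" by (intro eq[OF d j]) simp
    qed
  qed
  then show "\<exists>l \<pi>. limit_cone J ?C D l \<pi>" by blast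
qed

section \<open>Quantale-enriched categories as indiscrete normed categories\<close>

lemma indisc_simps [simp]:
  "obj (indisc A) = A" "arr (indisc A) = utimes A A"
  "x \<in> A \<Longrightarrow> y \<in> A \<Longrightarrow> src (indisc A) (upair x y) = x"
  "x \<in> A \<Longrightarrow> y \<in> A \<Longrightarrow> tgt (indisc A) (upair x y) = y"
  "x \<in> A \<Longrightarrow> ide (indisc A) x = upair x x"
  "x \<in> A \<Longrightarrow> y \<in> A \<Longrightarrow> z \<in> A \<Longrightarrow> cmp (indisc A) (upair y z) (upair x y) = upair x z"
  by (simp_all add: indisc_def)

lemma small_cat_indisc: "small A \<Longrightarrow> small_cat (indisc A)"
proof -
  assume A: "small A"
  have "category (indisc A)" by (rule categoryI) (auto elim!: utimesE)
  moreover have "extensional_cat (indisc A)"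
    unfolding extensional_cat_def by (auto simp: indisc_def)
  ultimately show ?thesis unfolding small_cat_def using A by (simp add: small_utimes)
qed

lemma embed_simps [simp]:
  "obj (embed_vcat X) = pts X" "arr (embed_vcat X) = utimes (pts X) (pts X)"
  "x \<in> pts X \<Longrightarrow> y \<in> pts X \<Longrightarrow> src (embed_vcat X) (upair x y) = x"
  "x \<in> pts X \<Longrightarrow> y \<in> pts X \<Longrightarrow> tgt (embed_vcat X) (upair x y) = y"
  "x \<in> pts X \<Longrightarrow> ide (embed_vcat X) x = upair x x"
  "x \<in> pts X \<Longrightarrow> y \<in> pts X \<Longrightarrow> z \<in> pts X \<Longrightarrow> cmp (embed_vcat X) (upair y z) (upair x y) = upair x z"
  "x \<in> pts X \<Longrightarrow> y \<in> pts X \<Longrightarrow> nrm (embed_vcat X) (upair x y) = vhm X x y"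
  "cat.truncate (embed_vcat X) = indisc (pts X)"
  by (simp_all add: embed_vcat_def)

lemma normed_cat_embed [simp]: "v_category X \<Longrightarrow> normed_cat (embed_vcat X)"
  unfolding embed_vcat_def
  by (rule normed_cat_add_norm) (auto simp: small_cat_indisc vhm_refl vhm_trans elim!: utimesE)

lemma embed_arr_eq:
  "a \<in> arr (embed_vcat X) \<Longrightarrow> a = upair (src (embed_vcat X) a) (tgt (embed_vcat X) a)"
  by (auto elim!: utimesE)

text \<open>An arrow of an embedded category is the pair of its end points, so the object map
  determines the functor. Fullness of the embedding and the description of the internal homs rest on
  this.\<close>

lemma functor_into_embed:
  "normed_functor W (embed_vcat Y) F \<Longrightarrow> a \<in> arr W \<Longrightarrow> fa F a = upair (fo F (src W a)) (fo F (tgt W a))"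
  using embed_arr_eq[of "fa F a" Y] normed_functor_simps(2-4)[of W "embed_vcat Y" F a] by simp

lemma normed_functor_into_embedI:
  assumes "normed_cat W" "v_category Y" "\<forall>x\<in>obj W. f x \<in> pts Y"
    and "\<forall>a\<in>arr W. nrm W a \<le> vhm Y (f (src W a)) (f (tgt W a))"
  shows "normed_functor W (embed_vcat Y) (mk_ftr W f (\<lambda>a. upair (f (src W a)) (f (tgt W a))))"
  by (rule normed_functor_mk_ftr_ballI) (use assms in simp_all)

lemma normed_functor_embed:
  assumes "v_category X" "v_category Y" "v_functor X Y f"
  shows "normed_functor (embed_vcat X) (embed_vcat Y) (mk_ftr (embed_vcat X) f (umap f f))"
  by (rule normed_functor_mk_ftr_ballI) (use assms in simp_all)

lemma v_functor_fo:
  assumes "v_category X" "v_category Y" "normed_functor (embed_vcat X) (embed_vcat Y) F"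
  shows "v_functor X Y (fo F)"
proof -
  have "fo F \<in> extensional (pts X)"
    using assms(3) unfolding normed_functor_def small_functor_def by simp
  moreover have "vhm X x x' \<le> vhm Y (fo F x) (fo F x')" if "x \<in> pts X" "x' \<in> pts X" for x x'
    using normed_functor_simps(6)[OF assms(3), of "upair x x'"] functor_into_embed[OF assms(3), of "upair x x'"]
      normed_functor_simps(1)[OF assms(3)] that by simp
  ultimately show ?thesis
    unfolding v_functor_def using normed_functor_simps(1)[OF assms(3)] by (auto simp: PiE_iff)
qed

lemma embed_ftr_sel [simp]:
  "fo embed_ftr X = embed_vcat X"
  "fa embed_ftr (Mor X f Y) = Mor (embed_vcat X) (mk_ftr (embed_vcat X) f (umap f f)) (embed_vcat Y)"
  by (simp_all add: embed_ftr_def mk_nmor_def)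

lemma is_functor_embed_ftr: "is_functor VCat NCat embed_ftr"
proof (rule is_functorI)
  fix f g :: "('a, 'b) vmor" assume "f \<in> arr VCat" "g \<in> arr VCat" "tgt VCat f = src VCat g"
  then show "fa embed_ftr (cmp VCat g f) = cmp NCat (fa embed_ftr g) (fa embed_ftr f)"
    by (auto elim!: arr_VCatE utimesE)
qed (auto elim!: arr_VCatE utimesE simp: normed_functor_embed)

lemma full_embed_ftr: "full VCat NCat embed_ftr"
  unfolding full_def
proof (intro ballI subsetI)
  fix X Y :: "('a, 'b) vcat" and h
  assume "X \<in> obj VCat" "Y \<in> obj VCat" and h: "h \<in> homset NCat (fo embed_ftr X) (fo embed_ftr Y)"
  then have X: "v_category X" and Y: "v_category Y" by simp_all
  obtain H where H: "h = Mor (embed_vcat X) H (embed_vcat Y)" "normed_functor (embed_vcat X) (embed_vcat Y) H"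
    using h by (auto elim: homset_NCatE)
  have "fa embed_ftr (Mor X (fo H) Y) = h"
    using H functor_into_embed[OF H(2)] by simp
  moreover have "Mor X (fo H) Y \<in> homset VCat X Y" using v_functor_fo[OF X Y H(2)] X Y by simp
  ultimately show "h \<in> fa embed_ftr ` homset VCat X Y" by blast
qed

lemma faithful_embed_ftr: "faithful VCat NCat embed_ftr"
  unfolding faithful_def inj_on_def by (auto elim!: homset_VCatE intro: v_functor_ext)

lemma inj_on_embed_vcat: "inj_on embed_vcat (obj VCat)"
proof (rule inj_onI)
  fix X Y :: "('a, 'b) vcat" assume "X \<in> obj VCat" "Y \<in> obj VCat" and eq: "embed_vcat X = embed_vcat Y"
  then have v: "v_category X" "v_category Y" by simp_all
  have pts: "pts X = pts Y" using arg_cong[OF eq, of obj] by simp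
  have "vhm X x y = vhm Y x y" for x y
  proof (cases "x \<in> pts X \<and> y \<in> pts X")
    case True
    then show ?thesis using fun_cong[OF arg_cong[OF eq, of nrm], of "upair x y"] pts by simp
  next
    case False
    \<comment> \<open>Off the carrier both homs are \<open>undefined\<close> by the convention in
      \<open>v_category\<close>.\<close>
    then show ?thesis using v pts unfolding v_category_def by simp
  qed
  then show "X = Y" using pts by (intro vcat.equality) auto
qed

section \<open>Recognising embedded categories among the indiscrete ones\<close>

lemma iso_viaI:
  assumes "normed_cat X" "normed_cat Y" "normed_functor X Y F" "normed_functor Y X G"
    and "\<forall>x\<in>obj X. fo G (fo F x) = x" "\<forall>a\<in>arr X. fa G (fa F a) = a"
    and "\<forall>y\<in>obj Y. fo F (fo G y) = y" "\<forall>b\<in>arr Y. fa F (fa G b) = b"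
    and "\<forall>x\<in>obj X. fo F x = m x"
  shows "iso_via X Y m"
  unfolding iso_via_def using iso_NCatI[OF assms(1-8)] assms
  by (intro bexI[of _ "Mor X F Y"]) simp_all

lemma iso_viaE:
  assumes "iso_via X Y m"
  obtains F G where "normed_cat X" "normed_cat Y" "normed_functor X Y F" "normed_functor Y X G"
    "\<forall>x\<in>obj X. fo G (fo F x) = x" "\<forall>a\<in>arr X. fa G (fa F a) = a"
    "\<forall>y\<in>obj Y. fo F (fo G y) = y" "\<forall>b\<in>arr Y. fa F (fa G b) = b" "\<forall>x\<in>obj X. fo F x = m x"
proof -
  obtain F where F: "normed_cat X" "normed_cat Y" "normed_functor X Y F" "iso NCat (Mor X F Y)"
      "\<forall>x\<in>obj X. fo F x = m x"
    using assms unfolding iso_via_def by (auto elim!: homset_NCatE)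
  then obtain g where "g \<in> homset NCat Y X" "ncomp g (Mor X F Y) = ide NCat X" "ncomp (Mor X F Y) g = ide NCat Y"
    unfolding iso_def by auto
  then obtain G where "normed_functor Y X G"
      "ncomp (Mor Y G X) (Mor X F Y) = ide NCat X" "ncomp (Mor X F Y) (Mor Y G X) = ide NCat Y"
    by (auto elim!: homset_NCatE)
  with F show thesis by (intro that[of F G]) simp_all
qed

lemma indiscreteI:
  assumes "\<And>x y. x \<in> obj X \<Longrightarrow> y \<in> obj X \<Longrightarrow> \<exists>f\<in>arr X. src X f = x \<and> tgt X f = y"
    and "\<And>f g. f \<in> arr X \<Longrightarrow> g \<in> arr X \<Longrightarrow> src X f = src X g \<Longrightarrow> tgt X f = tgt X g \<Longrightarrow> f = g"
  shows "indiscrete X"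
  unfolding indiscrete_def in_homset
proof (intro ballI ex_ex1I)
  fix x y assume "x \<in> obj X" "y \<in> obj X"
  then show "\<exists>f. f \<in> arr X \<and> src X f = x \<and> tgt X f = y" using assms(1) by blast
qed (rule assms(2), simp_all)

lemma indiscreteD:
  assumes "indiscrete X" "category X"
  shows "f \<in> arr X \<Longrightarrow> g \<in> arr X \<Longrightarrow> src X f = src X g \<Longrightarrow> tgt X f = tgt X g \<Longrightarrow> f = g"
    and "x \<in> obj X \<Longrightarrow> y \<in> obj X \<Longrightarrow> \<exists>f\<in>arr X. src X f = x \<and> tgt X f = y"
proof -
  note unique = assms(1)[unfolded indiscrete_def in_homset, rule_format]
  show "f = g" if "f \<in> arr X" "g \<in> arr X" "src X f = src X g" "tgt X f = tgt X g"
    using unique[of "src X f" "tgt X f"] that assms(2) by (auto simp: Ex1_def)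
  show "\<exists>f\<in>arr X. src X f = x \<and> tgt X f = y" if "x \<in> obj X" "y \<in> obj X"
    using unique[OF that] by blast
qed

definition the_arr :: "('o, 'a, 'm) cat_scheme \<Rightarrow> 'o \<Rightarrow> 'o \<Rightarrow> 'a" where
  "the_arr X x y = (SOME f. f \<in> arr X \<and> src X f = x \<and> tgt X f = y)"

text \<open>Parallel arrows of an indiscrete category are equal, so each law only requires a
  comparison of end points.\<close>

lemma the_arr_simps:
  assumes ind: "indiscrete X" and X: "category X"
  shows "x \<in> obj X \<Longrightarrow> y \<in> obj X \<Longrightarrow> the_arr X x y \<in> arr X"
    and "x \<in> obj X \<Longrightarrow> y \<in> obj X \<Longrightarrow> src X (the_arr X x y) = x"
    and "x \<in> obj X \<Longrightarrow> y \<in> obj X \<Longrightarrow> tgt X (the_arr X x y) = y"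
    and "a \<in> arr X \<Longrightarrow> the_arr X (src X a) (tgt X a) = a"
    and "x \<in> obj X \<Longrightarrow> ide X x = the_arr X x x"
    and "x \<in> obj X \<Longrightarrow> y \<in> obj X \<Longrightarrow> z \<in> obj X \<Longrightarrow>
      cmp X (the_arr X y z) (the_arr X x y) = the_arr X x z"
proof -
  have e: "the_arr X x y \<in> arr X \<and> src X (the_arr X x y) = x \<and> tgt X (the_arr X x y) = y"
    if "x \<in> obj X" "y \<in> obj X" for x y
    unfolding the_arr_def by (rule someI_ex) (use indiscreteD(2)[OF ind X that] in blast)
  show "x \<in> obj X \<Longrightarrow> y \<in> obj X \<Longrightarrow> the_arr X x y \<in> arr X"
    "x \<in> obj X \<Longrightarrow> y \<in> obj X \<Longrightarrow> src X (the_arr X x y) = x"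
    "x \<in> obj X \<Longrightarrow> y \<in> obj X \<Longrightarrow> tgt X (the_arr X x y) = y"
    using e by simp_all
  show "a \<in> arr X \<Longrightarrow> the_arr X (src X a) (tgt X a) = a" "x \<in> obj X \<Longrightarrow> ide X x = the_arr X x x"
    "x \<in> obj X \<Longrightarrow> y \<in> obj X \<Longrightarrow> z \<in> obj X \<Longrightarrow>
      cmp X (the_arr X y z) (the_arr X x y) = the_arr X x z"
    by (rule indiscreteD(1)[OF ind X]; simp add: e X)+
qed

text \<open>Both sides are indiscrete, so a bijection of objects extends uniquely to arrows and the
  functor laws are automatic; only the norms have to be matched.\<close>

lemma iso_via_embedI:
  assumes X: "normed_cat X" and W: "v_category W" and ind: "indiscrete X"
    and m: "bij_betw m (obj X) (pts W)"
    and nrm: "\<forall>a\<in>arr X. nrm X a = vhm W (m (src X a)) (m (tgt X a))"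
  shows "iso_via X (embed_vcat W) m"
proof -
  let ?e = "the_arr X"
  note e = the_arr_simps[OF ind normed_cat_category[OF X]]
  define i where "i = inv_into (obj X) m"
  have mi: "m (i w) = w" "i w \<in> obj X" if "w \<in> pts W" for w
    using that m unfolding i_def by (auto simp: bij_betw_inv_into_right bij_betw_def inv_into_into)
  have im: "i (m x) = x" "m x \<in> pts W" if "x \<in> obj X" for x
    using that m unfolding i_def by (auto simp: bij_betw_inv_into_left bij_betw_def)
  let ?F = "mk_ftr X m (\<lambda>a. upair (m (src X a)) (m (tgt X a)))"
  let ?G = "mk_ftr (embed_vcat W) i (\<lambda>p. ?e (i (ufst p)) (i (usnd p)))"
  have F: "normed_functor X (embed_vcat W) ?F"
    by (rule normed_functor_into_embedI) (use X W im nrm in simp_all)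
  have G: "normed_functor (embed_vcat W) X ?G"
    by (rule normed_functor_mk_ftr_ballI) (use X W mi e nrm in simp_all)
  show ?thesis
    by (rule iso_viaI[OF X _ F G]) (use X W mi im e in simp_all)
qed

lemma iso_via_sym: "iso_via X Y (\<lambda>x. x) \<Longrightarrow> iso_via Y X (\<lambda>x. x)"
proof (erule iso_viaE)
  fix F G
  assume a: "normed_cat X" "normed_cat Y" "normed_functor X Y F" "normed_functor Y X G"
    "\<forall>x\<in>obj X. fo G (fo F x) = x" "\<forall>a\<in>arr X. fa G (fa F a) = a"
    "\<forall>y\<in>obj Y. fo F (fo G y) = y" "\<forall>b\<in>arr Y. fa F (fa G b) = b" "\<forall>x\<in>obj X. fo F x = x"
  have "\<forall>y\<in>obj Y. fo G y = y" using a(7,9) normed_functor_simps(1)[OF a(4)] by metis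
  then show "iso_via Y X (\<lambda>x. x)" by (rule iso_viaI[OF a(2,1,4,3,7,8,5,6)])
qed

text \<open>The hom of the enriched category on \<open>obj X\<close> is the norm of the unique
  arrow. The comparison is an isomorphism rather than an equality, because arrows of
  \<open>X\<close> may be members of the universe other than the pairs of their end points.\<close>

lemma indiscrete_iff_embed:
  assumes X: "normed_cat X"
  shows "indiscrete X \<longleftrightarrow> (\<exists>Y\<in>obj VCat. iso_via (embed_vcat Y) X (\<lambda>x. x))"
proof
  assume ind: "indiscrete X"
  let ?e = "the_arr X"
  note e = the_arr_simps[OF ind normed_cat_category[OF X]]
  let ?Y = "mk_vcat (obj X) (\<lambda>x y. nrm X (?e x y))"
  have Y: "v_category ?Y"
  proof (rule v_category_mk_vcatI)
    show "\<forall>x\<in>obj X. 1 \<le> nrm X (?e x x)" using nrm_ide[OF X] e(5) by simp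
    show "\<forall>x\<in>obj X. \<forall>y\<in>obj X. \<forall>z\<in>obj X. nrm X (?e x y) * nrm X (?e y z) \<le> nrm X (?e x z)"
    proof (intro ballI)
      fix x y z assume xyz: "x \<in> obj X" "y \<in> obj X" "z \<in> obj X"
      then show "nrm X (?e x y) * nrm X (?e y z) \<le> nrm X (?e x z)"
        using nrm_cmp[OF X, of "?e x y" "?e y z"] e by simp
    qed
  qed (use X in simp)
  have "iso_via X (embed_vcat ?Y) (\<lambda>x. x)"
    by (rule iso_via_embedI[OF X Y ind]) (use X e in \<open>simp_all add: bij_betw_def\<close>)
  then show "\<exists>Y\<in>obj VCat. iso_via (embed_vcat Y) X (\<lambda>x. x)" using Y iso_via_sym by auto
next
  assume "\<exists>Y\<in>obj VCat. iso_via (embed_vcat Y) X (\<lambda>x. x)"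
  then obtain Y where Y: "v_category Y" and iso: "iso_via (embed_vcat Y) X (\<lambda>x. x)" by auto
  from iso show "indiscrete X"
  proof (rule iso_viaE)
    fix F G
    assume F: "normed_functor (embed_vcat Y) X F" and G: "normed_functor X (embed_vcat Y) G"
      and inv: "\<forall>x\<in>obj X. fo F (fo G x) = x" "\<forall>a\<in>arr X. fa F (fa G a) = a"
      and id: "\<forall>x\<in>obj (embed_vcat Y). fo F x = x"
    \<comment> \<open>\<open>F\<close> fixes every point of \<open>Y\<close>, so
      \<open>fo F (fo G x) = x\<close> forces \<open>fo G x = x\<close>, and this lies in
      \<open>pts Y\<close>.\<close>
    have mem: "x \<in> pts Y" if "x \<in> obj X" for x
      using inv(1) id normed_functor_simps(1)[OF G that] that by force
    show "indiscrete X"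
    proof (rule indiscreteI)
      fix x y assume xy: "x \<in> obj X" "y \<in> obj X"
      then show "\<exists>f\<in>arr X. src X f = x \<and> tgt X f = y"
        using mem id normed_functor_simps(2-4)[OF F, of "upair x y"]
        by (intro bexI[of _ "fa F (upair x y)"]) simp_all
    next
      fix f g assume "f \<in> arr X" "g \<in> arr X" "src X f = src X g" "tgt X f = tgt X g"
      then show "f = g" using functor_into_embed[OF G] inv(2) by metis
    qed
  qed
qed

text \<open>A pair of arrows and an arrow between pairs hold the same four points in different
  order. Both sides are indiscrete on the same objects, and their norms are the same products of
  homs.\<close>

lemma iso_via_tensor:
  assumes "v_category X" "v_category Y"
  shows "iso_via (ntensor (embed_vcat X) (embed_vcat Y)) (embed_vcat (vtensor X Y)) (\<lambda>p. p)"
proof (rule iso_via_embedI)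
  show "indiscrete (ntensor (embed_vcat X) (embed_vcat Y))"
  proof (rule indiscreteI)
    fix p q assume "p \<in> obj (ntensor (embed_vcat X) (embed_vcat Y))" "q \<in> obj (ntensor (embed_vcat X) (embed_vcat Y))"
    then show "\<exists>f\<in>arr (ntensor (embed_vcat X) (embed_vcat Y)).
        src (ntensor (embed_vcat X) (embed_vcat Y)) f = p \<and> tgt (ntensor (embed_vcat X) (embed_vcat Y)) f = q"
      by (intro bexI[of _ "upair (upair (ufst p) (ufst q)) (upair (usnd p) (usnd q))"])
        (auto elim!: utimesE)
  qed (auto elim!: utimesE)
qed (use assms in \<open>simp_all add: bij_betw_def\<close>)

lemma iso_via_unit: "iso_via nunit (embed_vcat vunit) (\<lambda>x. x)"
  by (rule iso_via_embedI) (auto intro: indiscreteI simp: bij_betw_def)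

text \<open>Between embedded categories naturality is automatic, the component at \<open>x\<close>
  being the pair of \<open>fo F x\<close> and \<open>fo G x\<close>, and functors are determined by
  their object maps. Hence the functor category is indiscrete, and the first part of a code, the
  graph of the object map, gives a bijection onto the points of \<open>vhom X Y\<close>.\<close>

lemma iso_via_hom:
  fixes X Y :: "('u::universe, 'v::quantale) vcat"
  assumes X: "v_category X" and Y: "v_category Y"
  shows "iso_via (nhom (embed_vcat X) (embed_vcat Y)) (embed_vcat (vhom X Y)) ufst"
proof -
  let ?X = "embed_vcat X" and ?Y = "embed_vcat Y"
  have nX: "normed_cat ?X" and nY: "normed_cat ?Y" using X Y by simp_all
  have component: "\<alpha> x = upair (fo F x) (fo G x)" if "transformation ?X ?Y F G \<alpha>" "x \<in> pts X" for F G \<alpha> x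
    using embed_arr_eq[of "\<alpha> x" Y] transformation_simps[OF that(1), of x] that(2) by simp
  have trans: "transformation ?X ?Y F G (\<lambda>x. upair (fo F x) (fo G x))"
    if F: "normed_functor ?X ?Y F" and G: "normed_functor ?X ?Y G" for F G
    using X F G normed_functor_simps(1)[OF F] normed_functor_simps(1)[OF G]
      functor_into_embed[OF F] functor_into_embed[OF G]
    by (intro transformationI) simp_all
  have ufst: "ufst (code_ftr ?X F) = ulam (pts X) (fo F)" for F by (simp add: code_ftr_def)
  show ?thesis
  proof (rule iso_via_embedI)
    show "normed_cat (nhom ?X ?Y)" "v_category (vhom X Y)" using nX nY X Y by simp_all
    show "indiscrete (nhom ?X ?Y)"
    proof (rule indiscreteI)
      fix p q assume "p \<in> obj (nhom ?X ?Y)" "q \<in> obj (nhom ?X ?Y)"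
      then obtain F G where FG: "p = code_ftr ?X F" "normed_functor ?X ?Y F"
          "q = code_ftr ?X G" "normed_functor ?X ?Y G" by (elim obj_nhomE)
      then show "\<exists>f\<in>arr (nhom ?X ?Y). src (nhom ?X ?Y) f = p \<and> tgt (nhom ?X ?Y) f = q"
        using trans[OF FG(2,4)] nX by (intro bexI[of _ "code_nat ?X F G (\<lambda>x. upair (fo F x) (fo G x))"]) simp_all
    next
      fix f g
      assume fg: "f \<in> arr (nhom ?X ?Y)" "g \<in> arr (nhom ?X ?Y)"
        and eq: "src (nhom ?X ?Y) f = src (nhom ?X ?Y) g" "tgt (nhom ?X ?Y) f = tgt (nhom ?X ?Y) g"
      obtain F G \<alpha> where f: "f = code_nat ?X F G \<alpha>" "transformation ?X ?Y F G \<alpha>"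
        using fg(1) by (rule arr_nhomE)
      obtain F' G' \<beta> where g: "g = code_nat ?X F' G' \<beta>" "transformation ?X ?Y F' G' \<beta>"
        using fg(2) by (rule arr_nhomE)
      show "f = g"
        using eq f g nX component[OF f(2)] component[OF g(2)]
        by (simp add: code_nat_eq_iff) (simp add: code_ftr_eq_iff)
    qed
    show "bij_betw ufst (obj (nhom ?X ?Y)) (pts (vhom X Y))"
      unfolding bij_betw_def
    proof
      show "inj_on ufst (obj (nhom ?X ?Y))"
      proof (rule inj_onI)
        fix p q assume pq: "p \<in> obj (nhom ?X ?Y)" "q \<in> obj (nhom ?X ?Y)" "ufst p = ufst q"
        then obtain F G where FG: "p = code_ftr ?X F" "normed_functor ?X ?Y F"
          "q = code_ftr ?X G" "normed_functor ?X ?Y G" by (elim obj_nhomE)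
        have fo: "\<forall>x\<in>pts X. fo F x = fo G x" using pq(3) FG X by (simp add: ufst ulam_eq_iff)
        moreover have "fa F a = fa G a" if "a \<in> arr ?X" for a
          using functor_into_embed[OF FG(2) that] functor_into_embed[OF FG(4) that] fo nX that
            category_simps(1,2)[of ?X a] by simp
        ultimately show "p = q" using FG nX by (simp add: code_ftr_eq_iff)
      qed
      show "ufst ` obj (nhom ?X ?Y) = pts (vhom X Y)"
      proof (intro equalityI subsetI)
        fix p assume "p \<in> ufst ` obj (nhom ?X ?Y)"
        then show "p \<in> pts (vhom X Y)" using v_functor_fo[OF X Y] by (auto elim!: obj_nhomE simp: ufst)
      next
        fix p assume "p \<in> pts (vhom X Y)"
        then obtain f where f: "p = ulam (pts X) f" "v_functor X Y f" by (rule pts_vhomE)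
        have "p = ufst (code_ftr ?X (mk_ftr ?X f (umap f f)))"
          unfolding ufst f(1) by (rule ulam_cong) simp
        then show "p \<in> ufst ` obj (nhom ?X ?Y)"
          by (rule image_eqI[OF _ code_ftr_in_nhom[OF normed_functor_embed[OF X Y f(2)]]])
      qed
    qed
    have "(INF x\<in>pts X. nrm ?Y (\<alpha> x)) = (INF x\<in>pts X. vhm Y (fo F x) (fo G x))"
      if t: "transformation ?X ?Y F G \<alpha>" for F G \<alpha>
      using component[OF t] normed_functor_simps(1)[OF transformation_functors(1)[OF t]]
        normed_functor_simps(1)[OF transformation_functors(2)[OF t]]
      by (intro INF_cong) simp_all
    then show "\<forall>a\<in>arr (nhom ?X ?Y). nrm (nhom ?X ?Y) a =
        vhm (vhom X Y) (ufst (src (nhom ?X ?Y) a)) (ufst (tgt (nhom ?X ?Y) a))"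
      using nX X v_functor_fo[OF X Y] by (simp add: ufst)
  qed
qed

section \<open>Compatibility with the forgetful functors and with initial lifts\<close>

lemma mk_ftr_embed [simp]: "mk_ftr (embed_vcat X) f g = mk_ftr (indisc (pts X)) f g"
  using mk_ftr_truncate[of "embed_vcat X" f g] by simp

lemma indisc_ftr_sel [simp]:
  "fo indisc_ftr A = indisc A"
  "fa indisc_ftr (Mor A f B) = Mor (indisc A) (mk_ftr (indisc A) f (umap f f)) (indisc B)"
  by (simp_all add: indisc_ftr_def)

lemma embed_forget:
  "X \<in> obj VCat \<Longrightarrow> fo forget_norm (fo embed_ftr X) = fo indisc_ftr (fo forget_vcat X)"
  "f \<in> arr VCat \<Longrightarrow> fa forget_norm (fa embed_ftr f) = fa indisc_ftr (fa forget_vcat f)"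
  by (auto elim!: arr_VCatE)

text \<open>Both sides put a norm on the same indiscrete category, and \<open>add_norm\<close>
  restricts it to the arrows, so the comparison is an equality that can be checked at pairs of
  points.\<close>

lemma embed_initial_vcat:
  fixes Y :: "'i \<Rightarrow> ('u::universe, 'v::quantale) vcat"
  assumes "structured_source VCat SetC forget_vcat I A Y f"
  shows "embed_vcat (initial_vcat I A Y f) =
    initial_norm I (indisc A) (\<lambda>i. embed_vcat (Y i)) (\<lambda>i. fa indisc_ftr (f i))"
proof -
  have "f i \<in> homset SetC A (pts (Y i))" if "i \<in> I" for i
    using assms that unfolding structured_source_def by simp
  then have f: "f i = Mor A (mmap (f i)) (pts (Y i))" "mmap (f i) \<in> A \<rightarrow>\<^sub>E pts (Y i)" if "i \<in> I" for i
    using that by (metis homset_SetCE mor.sel(2), metis homset_SetCE mor.sel(2))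
  have "(INF i\<in>I. vhm (Y i) (mmap (f i) x) (mmap (f i) y)) =
      (INF i\<in>I. nrm (embed_vcat (Y i)) (fa (mmap (fa indisc_ftr (f i))) (upair x y)))"
    if xy: "x \<in> A" "y \<in> A" for x y
  proof (rule INF_cong[OF refl])
    fix i assume i: "i \<in> I"
    have "mmap (f i) x \<in> pts (Y i)" "mmap (f i) y \<in> pts (Y i)" using f(2)[OF i] xy by auto
    then show "vhm (Y i) (mmap (f i) x) (mmap (f i) y) =
        nrm (embed_vcat (Y i)) (fa (mmap (fa indisc_ftr (f i))) (upair x y))"
      \<comment> \<open>Only the occurrence of \<open>f i\<close> under \<open>indisc_ftr\<close> is
        expanded; its form as a \<open>Mor\<close> lets the selector rule apply.\<close>
      using xy by (subst (3) f(1)[OF i]) simp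
  qed
  then show ?thesis
    by (simp add: embed_vcat_def initial_vcat_def initial_norm_def add_norm_def)
qed

theorem theorem3p3:
  shows
    "symmetric_monoidal_closed_2cat
       (NCat :: ('u::universe, 'v::quantale) ncat_2cat) NCat_smc \<and>
     topological TYPE('i) (NCat :: ('u, 'v) ncat_2cat) CatC forget_norm \<and>
     (\<forall>(I :: 'i set) X (Y :: 'i \<Rightarrow> ('u, 'v) ncat) F.
        structured_source NCat CatC forget_norm I X Y F \<longrightarrow>
        initial_lift NCat CatC forget_norm I X Y F (initial_norm I X Y F)) \<and>
     small_complete TYPE('u) (NCat :: ('u, 'v) ncat_2cat) \<and>
     small_cocomplete TYPE('u) (NCat :: ('u, 'v) ncat_2cat) \<and>
     has_right_adjoint (NCat :: ('u, 'v) ncat_2cat) CatC forget_norm \<and>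
     has_left_adjoint (NCat :: ('u, 'v) ncat_2cat) CatC forget_norm \<and>

     symmetric_monoidal_closed (VCat :: ('u, 'v) vcat_cat) VCat_smc \<and>
     topological TYPE('i) (VCat :: ('u, 'v) vcat_cat) SetC forget_vcat \<and>
     (\<forall>(I :: 'i set) A (Y :: 'i \<Rightarrow> ('u, 'v) vcat) f.
        structured_source VCat SetC forget_vcat I A Y f \<longrightarrow>
        initial_lift VCat SetC forget_vcat I A Y f (initial_vcat I A Y f)) \<and>
     small_complete TYPE('u) (VCat :: ('u, 'v) vcat_cat) \<and>
     small_cocomplete TYPE('u) (VCat :: ('u, 'v) vcat_cat) \<and>
     has_right_adjoint (VCat :: ('u, 'v) vcat_cat) SetC forget_vcat \<and>
     has_left_adjoint (VCat :: ('u, 'v) vcat_cat) SetC forget_vcat \<and>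

     is_functor (VCat :: ('u, 'v) vcat_cat) NCat embed_ftr \<and>
     full (VCat :: ('u, 'v) vcat_cat) NCat embed_ftr \<and>
     faithful (VCat :: ('u, 'v) vcat_cat) NCat embed_ftr \<and>
     inj_on (embed_vcat :: ('u, 'v) vcat \<Rightarrow> ('u, 'v) ncat) (obj VCat) \<and>
     (\<forall>X \<in> obj (NCat :: ('u, 'v) ncat_2cat).
        indiscrete X \<longleftrightarrow> (\<exists>Y \<in> obj VCat. iso_via (embed_vcat Y) X (\<lambda>x. x))) \<and>
     (\<forall>X \<in> obj (VCat :: ('u, 'v) vcat_cat). \<forall>Y \<in> obj VCat.
        iso_via (ntensor (embed_vcat X) (embed_vcat Y)) (embed_vcat (vtensor X Y)) (\<lambda>p. p) \<and>
        iso_via (nhom (embed_vcat X) (embed_vcat Y)) (embed_vcat (vhom X Y)) ufst) \<and>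
     iso_via (nunit :: ('u, 'v) ncat) (embed_vcat vunit) (\<lambda>x. x) \<and>
     (\<forall>X \<in> obj (VCat :: ('u, 'v) vcat_cat).
        fo forget_norm (fo embed_ftr X) = fo indisc_ftr (fo forget_vcat X)) \<and>
     (\<forall>f \<in> arr (VCat :: ('u, 'v) vcat_cat).
        fa forget_norm (fa embed_ftr f) = fa indisc_ftr (fa forget_vcat f)) \<and>
     (\<forall>(I :: 'i set) A (Y :: 'i \<Rightarrow> ('u, 'v) vcat) f.
        structured_source VCat SetC forget_vcat I A Y f \<longrightarrow>
        embed_vcat (initial_vcat I A Y f) =
        initial_norm I (indisc A) (\<lambda>i. embed_vcat (Y i)) (\<lambda>i. fa indisc_ftr (f i)))"
proof (intro conjI)
  show "\<forall>(I :: 'i set) X (Y :: 'i \<Rightarrow> ('u, 'v) ncat) F. structured_source NCat CatC forget_norm I X Y F \<longrightarrow>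
      initial_lift NCat CatC forget_norm I X Y F (initial_norm I X Y F)"
    using initial_lift_NCat by blast
  show "\<forall>(I :: 'i set) A (Y :: 'i \<Rightarrow> ('u, 'v) vcat) f. structured_source VCat SetC forget_vcat I A Y f \<longrightarrow>
      initial_lift VCat SetC forget_vcat I A Y f (initial_vcat I A Y f)"
    using initial_lift_VCat by blast
  show "\<forall>X\<in>obj (NCat :: ('u, 'v) ncat_2cat).
      indiscrete X \<longleftrightarrow> (\<exists>Y\<in>obj VCat. iso_via (embed_vcat Y) X (\<lambda>x. x))"
    by (simp add: indiscrete_iff_embed)
  show "\<forall>X\<in>obj (VCat :: ('u, 'v) vcat_cat). \<forall>Y\<in>obj VCat.
      iso_via (ntensor (embed_vcat X) (embed_vcat Y)) (embed_vcat (vtensor X Y)) (\<lambda>p. p) \<and>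
      iso_via (nhom (embed_vcat X) (embed_vcat Y)) (embed_vcat (vhom X Y)) ufst"
    by (simp add: iso_via_tensor iso_via_hom)
  show "\<forall>X\<in>obj (VCat :: ('u, 'v) vcat_cat).
      fo forget_norm (fo embed_ftr X) = fo indisc_ftr (fo forget_vcat X)"
    using embed_forget(1) by blast
  show "\<forall>f\<in>arr (VCat :: ('u, 'v) vcat_cat).
      fa forget_norm (fa embed_ftr f) = fa indisc_ftr (fa forget_vcat f)"
    using embed_forget(2) by blast
  show "\<forall>(I :: 'i set) A (Y :: 'i \<Rightarrow> ('u, 'v) vcat) f. structured_source VCat SetC forget_vcat I A Y f \<longrightarrow>
      embed_vcat (initial_vcat I A Y f) =
      initial_norm I (indisc A) (\<lambda>i. embed_vcat (Y i)) (\<lambda>i. fa indisc_ftr (f i))"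
    using embed_initial_vcat by blast
\<comment> \<open>For the left adjoints, \<open>topological_NCat\<close> and
  \<open>topological_VCat\<close> are instantiated with pairs of an object and an arrow as index
  type.\<close>
qed (rule symmetric_monoidal_closed_2cat_NCat topological_NCat small_complete_NCat small_cocomplete_NCat
    topological_has_right_adjoint[OF topological_NCat] topological_has_left_adjoint[OF topological_NCat]
    symmetric_monoidal_closed_VCat topological_VCat small_complete_VCat small_cocomplete_VCat
    topological_has_right_adjoint[OF topological_VCat] topological_has_left_adjoint[OF topological_VCat]
    is_functor_embed_ftr full_embed_ftr faithful_embed_ftr inj_on_embed_vcat iso_via_unit)+

end
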